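(* Fix $a \in \{\phi,\sigma\}$, where $\phi$ is Euler's totient function and $\sigma$ is the sum-of-divisors function. Fix a positive integer $k$ and a real number $\beta < k-1$. Then, as $n \to \infty$ through positive integers, $$N_a^k(n) \le \frac{n}{L_{k,\beta+1}(n)^{1+o(1)}}.$$ Here $o(1)$ denotes a quantity tending to $0$ as $n\to\infty$ with $a,k,\beta$ fixed; equivalently, for every $\epsilon>0$ there is $n_0 = n_0(a,k,\beta,\epsilon)$ such that $N_a^k(n) \le n\, L_{k,\beta+1}(n)^{-(1-\epsilon)}$ for all integers $n \ge n_0$.
   Context: For an arithmetic function $a$ with positive integer values, $a_k$ denotes its $k$-th iterate ($a_1 = a$, $a_{k+1} = a\circ a_k$). Define $N_a^k(n) = \#\{m \in \mathbb{Z}_{>0} : a_k(m) = n\}$. For a positive integer $k$ and a real number $\gamma$, and for all sufficiently large $n$ (so that $\log\log\log n$ is defined and positive), define $$L_{k,\gamma}(n) = \exp\left(\frac{\log n \cdot (\log\log\log n)^{\gamma}}{(\log\log n)^k}\right).$$ *)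

theory Defs
  imports Complex_Main "HOL-Number_Theory.Number_Theory"
begin

definition sum_of_divisors :: "nat \<Rightarrow> nat" where
  "sum_of_divisors n = (\<Sum>d | d dvd n. d)"

definition iter_preimage_count :: "(nat \<Rightarrow> nat) \<Rightarrow> nat \<Rightarrow> nat \<Rightarrow> nat" where
  "iter_preimage_count a k n = card {m. m > 0 \<and> (a ^^ k) m = n}"

(* Only meaningful for n large enough that ln (ln (ln n)) > 0; powr agrees with real
   exponentiation there. *)
definition L_fun :: "nat \<Rightarrow> real \<Rightarrow> nat \<Rightarrow> real" where
  "L_fun k \<gamma> n =
     exp (ln (real n) * (ln (ln (ln (real n))) powr \<gamma>) / ln (ln (real n)) ^ k)"

(* Since card is 0 on infinite sets, we check that the sets counted by
   iter_preimage_count are finite for a = totient and a = sum_of_divisors. *)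

lemma le_sum_of_divisors:
  assumes "m > 0"
  shows "m \<le> sum_of_divisors m"
  unfolding sum_of_divisors_def
  by (rule member_le_sum) (use assms in auto)

lemma totient_ge:
  assumes "m > 0"
  shows "m \<le> totient m * 2 ^ Suc (totient m)"
proof -
  let ?P = "prime_factors m"
  have sub: "?P \<subseteq> {1..Suc (totient m)}"
  proof
    fix p assume p: "p \<in> ?P"
    hence "prime p" "p dvd m" by auto
    hence "p - 1 \<le> totient m"
      using totient_dvd_mono[of p m] assms totient_prime[of p] by simp
    with \<open>prime p\<close> show "p \<in> {1..Suc (totient m)}"
      using prime_ge_1_nat[of p] by auto
  qed
  have c: "card ?P \<le> Suc (totient m)"
    using card_mono[OF _ sub] by simp
  have "(1/2::real) ^ Suc (totient m) \<le> (1/2) ^ card ?P"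
    by (rule power_decreasing[OF c]) auto
  also have "\<dots> = (\<Prod>p\<in>?P. 1/2)" by simp
  also have "\<dots> \<le> (\<Prod>p\<in>?P. 1 - 1 / real p)"
  proof (rule prod_mono)
    fix p assume "p \<in> ?P"
    hence "real p \<ge> 2" using prime_ge_2_nat[of p] by auto
    thus "0 \<le> (1/2::real) \<and> 1/2 \<le> 1 - 1 / real p" by (simp add: field_simps)
  qed
  finally have "real m * (1/2) ^ Suc (totient m) \<le> real (totient m)"
    unfolding totient_formula2 by (intro mult_left_mono) auto
  hence "real m \<le> real (totient m) * 2 ^ Suc (totient m)"
    by (simp add: power_one_over field_simps)
  also have "\<dots> = real (totient m * 2 ^ Suc (totient m))" by simp
  finally show ?thesis by (simp only: of_nat_le_iff)
qed

lemma finite_iter_preimage: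
  assumes "a \<in> {totient, sum_of_divisors}"
  shows "finite {m. m > 0 \<and> (a ^^ k) m = n}"
proof (induction k arbitrary: n)
  case 0
  show ?case by simp
next
  case (Suc k)
  have pos: "a m > 0" if "m > 0" for m
    using assms le_sum_of_divisors[of m] that by auto
  have fin: "finite {m. m > 0 \<and> a m = y}" for y
  proof (rule finite_subset)
    show "{m. m > 0 \<and> a m = y} \<subseteq> {..y * 2 ^ Suc y} \<union> {..y}"
      using assms le_sum_of_divisors totient_ge by blast
  qed auto
  have "{m. m > 0 \<and> (a ^^ Suc k) m = n} \<subseteq>
      (\<Union>y\<in>{y. y > 0 \<and> (a ^^ k) y = n}. {m. m > 0 \<and> a m = y})"
    using pos by (auto simp: funpow_swap1)
  thus ?case
    by (rule finite_subset) (use Suc.IH fin in blast)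
qed

end

theory Submission
  imports Defs "HOL-Computational_Algebra.Squarefree" "HOL-Real_Asymp.Real_Asymp"
begin

text \<open>
  Write $u_i$ for the value at $m$ of the $i$-th iterate of $a$, so that $u_0 = m$ and $u_k = n$,
  and $L_1 = \ln n$, $L_2 = \ln L_1$, $L_3 = \ln L_2$. The engine is Rankin's trick: for $0 \le
  \eta \le 1/2$, of the integers up to $x$ whose prime factors all lie in a set $R$, there are at
  most $x^{1-\eta} \exp(4 \sum_{p \in R} p^{\eta-1})$ (\<open>card_le_powr_exp\<close>). So it
  suffices to find a set $R$ that contains the primes of every $m$ under consideration and makes
  the sum small for an $\eta$ with $n^\eta$ larger than the saving that is claimed.

  For the totient, every prime $q$ dividing $u_i$ has $q - 1$ dividing $u_{i+1}$. Starting with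
  the primes of $n$ and going back, the primes of $u_{k-j}$ lie in a set $R_j$ such that $q \in
  R_{j+1}$ forces all primes of $q - 1$ into $R_j$. In the sum over $R_{j+1}$ the primes up to $Z$
  contribute about $\ln \ln Z$, by Chebyshev's estimate, and Rankin's trick applied to the
  integers $q - 1$ shows that the larger ones are negligible if $\eta$ has dropped a little
  (\<open>prime_sum_step\<close>). With $\eta_j = 1 / (L_2 L_3^{2j})$ all sums are $O(L_3)$, and
  for $k \ge 2$ the saving $n^{\eta_k}$ is far larger than required. For $k = 1$ the smaller
  target allows $\eta = L_3^g / L_2$ with $g < 1$ (\<open>prime_chain_rate\<close>).

  For the sum of divisors, $q$ dividing $u_i$ yields $q + 1$ dividing $u_{i+1}$ in general only if
  $q^2$ does not divide $u_i$. Primes up to a fixed power $z$ of $L_1$ do no harm, since they are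
  counted among the small primes anyway. The primes $q > z$ with $q^2$ dividing $u_i$ divide
  $w_i$, the value of \<open>rough_root z\<close> at $u_i$, which is the $z$-rough part of the
  square root of the largest square divisor of $u_i$. Fixing the vector $(w_0, \ldots, w_{k-1})$
  makes the argument for the totient work, and if all $w_i$ are at most a small power of $n^\eta$,
  then the number of vectors is absorbed by the saving.

  It remains to see that few $m$ have a large $w_i$ (\<open>card_rough_exception_le\<close>). For
  a modulus $M$, the tower $F_0(m) = \gcd(M, m)$, $F_{i+1}(m) = \prod_{p \mid m} F_i(p+1)$ is
  submultiplicative, and $\gcd(M, u_i)$ is at most $F_i(m)$ times a power of the square parts of
  the earlier iterates (\<open>gcd_iterate_le\<close>). The moment $\sum_m F_{i+1}(m)^s / m$ is
  bounded by an Euler product, at most $\exp(4 \sum_p F_i(p+1)^s / p)$, and in this sum the primes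
  with a small value of $F_i(p+1)$ contribute $O(L_2)$, while for the others the condition that
  $p$ is prime can be dropped at the price of lowering $s$ (\<open>tower_moment_step\<close>).
  Markov's inequality with $M = w^2$, summed over $w$, bounds the exceptional set for the rough
  part. With $M$ a product of high powers of all primes up to $z$ it bounds the smooth part of the
  square parts (\<open>card_smooth_exception_le\<close>), which is needed only for $i \le k - 2$.
  This second bound loses one factor $L_2$ in the exponent at every iteration, which is why the
  saving obtained here involves a power of $L_2$ that grows with $k$.
\<close>

section \<open>Euler products\<close>

lemma geometric_tail_le:
  fixes x h :: real
  assumes "0 < x" "x < 1" "h \<ge> 0"
  shows "(\<Sum>i\<le>A. (if i = 0 then 1 else h) * x ^ i) \<le> 1 + h * (x / (1 - x))"
proof -
  have eq: "(\<Sum>i\<le>A. (if i = 0 then 1 else h) * x ^ i) = 1 + h * (x * (1 - x ^ A) / (1 - x))"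
  proof (induction A)
    case (Suc A)
    then show ?case using assms by (simp add: field_simps)
  qed simp
  have "x * (1 - x ^ A) / (1 - x) \<le> x / (1 - x)"
    using assms by (intro divide_right_mono) auto
  then show ?thesis unfolding eq using assms mult_left_mono by fastforce
qed

text \<open>
  Expanding the product over $P$ produces every integer of $N$ once, with its summand as weight.
  Finite sets on both sides avoid all questions of convergence; the induction strips off the full
  power of one prime.
\<close>
lemma euler_product_bound:
  fixes h :: "nat \<Rightarrow> real" and s :: real
  assumes "finite P" "\<forall>p\<in>P. prime p" "\<forall>p\<in>P. 0 \<le> h p" "s > 0"
    and "finite N" "\<forall>m\<in>N. m > 0 \<and> prime_factors m \<subseteq> P"
  shows "(\<Sum>m\<in>N. (\<Prod>p\<in>prime_factors m. h p) * real m powr -s)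
           \<le> (\<Prod>p\<in>P. 1 + h p * (real p powr -s / (1 - real p powr -s)))"
  using assms(1,2,3,5,6)
proof (induction P arbitrary: N rule: finite_induct)
  case empty
  have "N \<subseteq> {1}"
  proof
    fix m assume "m \<in> N"
    then have "m > 0" "prime_factors m = {}" using empty by auto
    then show "m \<in> {1}" by (simp add: prime_factorization_empty_iff set_mset_eq_empty_iff)
  qed
  then have "N = {} \<or> N = {1}" by auto
  then show ?case by auto
next
  case (insert p P)
  let ?f = "\<lambda>m. (\<Prod>p\<in>prime_factors m. h p) * real m powr -s"
  let ?a = "\<lambda>m. multiplicity p m" let ?r = "\<lambda>m. m div p ^ multiplicity p m"
  define x where "x = real p powr -s"
  define c where "c = (\<lambda>i::nat. (if i = 0 then 1 else h p) * x ^ i)"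
  have p: "prime p" "h p \<ge> 0" using insert.prems by auto
  have p2: "real p \<ge> 2" using prime_ge_2_nat[OF p(1)] by simp
  have x: "0 < x" "x < 1" unfolding x_def using p2 assms(4) by (auto simp: powr_less_one)
  have dec: "m = p ^ ?a m * ?r m" for m by (simp add: multiplicity_dvd)
  have r: "?r m > 0 \<and> prime_factors (?r m) = prime_factors m - {p}" if "m \<in> N" for m
  proof -
    have m0: "m > 0" using insert.prems that by auto
    have r0: "?r m > 0" using m0 dec[of m] by (metis mult_0_right neq0_conv)
    have nd: "\<not> p dvd ?r m" using multiplicity_decompose[of m p] m0 p(1)
      by (metis not_prime_unit gr0_implies_Suc nat.distinct(1))
    have "prime_factors (p ^ ?a m * ?r m) = prime_factors (p ^ ?a m) \<union> prime_factors (?r m)"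
      by (rule prime_factors_product) (use p(1) r0 in auto)
    moreover have "prime_factors (p ^ ?a m) \<subseteq> {p}"
      using p(1) by (auto simp: in_prime_factors_iff) (metis prime_dvd_power primes_dvd_imp_eq)
    moreover have "p \<notin> prime_factors (?r m)" using nd by auto
    ultimately have "prime_factors (?r m) = prime_factors m - {p}" using dec[of m] by auto
    with r0 show ?thesis by auto
  qed
  have f: "?f m = c (?a m) * ?f (?r m)" if "m \<in> N" for m
  proof -
    have m0: "m > 0" using insert.prems that by auto
    have "real m powr -s = real (p ^ ?a m * ?r m) powr -s" using dec[of m] by simp
    also have "\<dots> = x ^ ?a m * real (?r m) powr -s"
      by (simp add: powr_mult x_def powr_power powr_powr mult.commute flip: powr_realpow)
         (use p2 in \<open>simp add: powr_powr powr_realpow[symmetric] mult.commute\<close>)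
    finally have 1: "real m powr -s = x ^ ?a m * real (?r m) powr -s" .
    show ?thesis
    proof (cases "p dvd m")
      case True
      then have "p \<in> prime_factors m" using p m0 by (auto simp: in_prime_factors_iff)
      then have "(\<Prod>p\<in>prime_factors m. h p) = h p * (\<Prod>p\<in>prime_factors (?r m). h p)"
        using r[OF that] by (simp add: prod.remove)
      moreover have "?a m > 0" using True p m0 by (simp add: prime_multiplicity_gt_zero_iff)
      ultimately show ?thesis using 1 by (simp add: c_def)
    next
      case False
      then have "?a m = 0" by (simp add: not_dvd_imp_multiplicity_0)
      then show ?thesis by (simp add: c_def)
    qed
  qed
  define A where "A = Max (insert 0 (?a ` N))"
  let ?g = "\<lambda>m. (?a m, ?r m)"
  have fn: "?f m \<ge> 0" if "m > 0" "prime_factors m \<subseteq> P" for m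
    using insert.prems that by (intro mult_nonneg_nonneg prod_nonneg) auto
  have inj: "inj_on ?g N" by (rule inj_onI) (metis dec prod.inject)
  have N': "finite (?r ` N)" "\<forall>m\<in>?r ` N. m > 0 \<and> prime_factors m \<subseteq> P"
    using r insert.prems by auto
  have cn: "c i \<ge> 0" for i using x p by (simp add: c_def)
  have "(\<Sum>m\<in>N. ?f m) = (\<Sum>m\<in>N. c (?a m) * ?f (?r m))" using f by (intro sum.cong) auto
  also have "\<dots> = (\<Sum>y\<in>?g ` N. c (fst y) * ?f (snd y))" by (subst sum.reindex[OF inj]) simp
  also have "\<dots> \<le> (\<Sum>y\<in>{..A} \<times> ?r ` N. c (fst y) * ?f (snd y))"
  proof (rule sum_mono2)
    show "?g ` N \<subseteq> {..A} \<times> ?r ` N" using insert.prems by (auto simp: A_def intro!: Max_ge)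
    show "0 \<le> c (fst b) * ?f (snd b)" if "b \<in> {..A} \<times> ?r ` N - ?g ` N" for b
    proof -
      have "snd b \<in> ?r ` N" using that by auto
      then have "snd b > 0 \<and> prime_factors (snd b) \<subseteq> P" using N'(2) by blast
      then have "0 \<le> ?f (snd b)" using fn by blast
      then show ?thesis by (rule mult_nonneg_nonneg[OF cn])
    qed
  qed (use N' in auto)
  also have "\<dots> = (\<Sum>i\<le>A. c i) * (\<Sum>m\<in>?r ` N. ?f m)"
    by (simp add: sum_product sum.cartesian_product case_prod_unfold)
  also have "\<dots> \<le> (1 + h p * (x / (1 - x))) *
      (\<Prod>p\<in>P. 1 + h p * (real p powr -s / (1 - real p powr -s)))"
  proof (rule mult_mono)
    show "(\<Sum>i\<le>A. c i) \<le> 1 + h p * (x / (1 - x))"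
      unfolding c_def by (rule geometric_tail_le) (use x p in auto)
    show "(\<Sum>m\<in>?r ` N. ?f m) \<le> (\<Prod>p\<in>P. 1 + h p * (real p powr -s / (1 - real p powr -s)))"
      by (rule insert.IH) (use insert.prems N' in auto)
    show "0 \<le> (\<Sum>m\<in>?r ` N. ?f m)" using N'(2) fn by (intro sum_nonneg) blast
  qed (use x p in auto)
  also have "\<dots> = (\<Prod>p\<in>insert p P. 1 + h p * (real p powr -s / (1 - real p powr -s)))"
    using insert.hyps by (simp add: x_def)
  finally show ?case .
qed

text \<open>
  The factor 4 is $1 / (1 - 3/4)$, from summing the geometric series of powers of one prime. It is
  harmless throughout, because only the order of magnitude of the exponent matters.
\<close>
lemma euler_exp_bound:
  fixes h :: "nat \<Rightarrow> real" and s :: real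
  assumes "finite P" "\<forall>p\<in>P. prime p" "\<forall>p\<in>P. 0 \<le> h p" "s > 0"
    and small: "\<forall>p\<in>P. real p powr -s \<le> 3/4"
    and "finite N" "\<forall>m\<in>N. m > 0 \<and> prime_factors m \<subseteq> P"
  shows "(\<Sum>m\<in>N. (\<Prod>p\<in>prime_factors m. h p) * real m powr -s)
           \<le> exp (4 * (\<Sum>p\<in>P. h p * real p powr -s))"
proof -
  have "(\<Prod>p\<in>P. 1 + h p * (real p powr -s / (1 - real p powr -s)))
      \<le> (\<Prod>p\<in>P. exp (4 * (h p * real p powr -s)))"
  proof (rule prod_mono)
    fix p assume p: "p \<in> P"
    let ?x = "real p powr -s"
    have x: "0 \<le> ?x" "?x \<le> 3/4" using small p by auto
    have "?x * 1 \<le> ?x * (4 * (1 - ?x))" using x by (intro mult_left_mono) auto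
    then have "?x / (1 - ?x) \<le> 4 * ?x" using x
      by (subst pos_divide_le_eq) (auto simp: algebra_simps)
    then have "h p * (?x / (1 - ?x)) \<le> 4 * (h p * ?x)"
      using assms(3) p by (metis mult.left_commute mult_left_mono)
    moreover have "1 + 4 * (h p * ?x) \<le> exp (4 * (h p * ?x))" by (rule exp_ge_add_one_self)
    moreover have "0 \<le> h p * (?x / (1 - ?x))" using assms(3) p x by auto
    ultimately show "0 \<le> 1 + h p * (?x / (1 - ?x)) \<and>
       1 + h p * (?x / (1 - ?x)) \<le> exp (4 * (h p * ?x))" by linarith
  qed
  also have "\<dots> = exp (4 * (\<Sum>p\<in>P. h p * real p powr -s))"
    using assms(1) by (simp add: exp_sum sum_distrib_left)
  finally show ?thesis using euler_product_bound[OF assms(1-4,6,7)] by linarith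
qed

lemma prime_powr_le_three_quarters:
  fixes s :: real
  assumes "prime (p::nat)" "s \<le> 1/2"
  shows "real p powr (s - 1) \<le> 3/4"
proof -
  have p: "real p \<ge> 2" using assms prime_ge_2_nat[of p] by auto
  have "real p powr (s - 1) \<le> real p powr (-1/2)" using assms p by (intro powr_mono) auto
  also have "\<dots> \<le> 2 powr (-1/2)" using p by (intro powr_mono2') auto
  also have "\<dots> = 1 / sqrt 2" using powr_minus_divide[of "2::real" "1/2"] powr_half_sqrt[of 2] by simp
  also have "\<dots> \<le> 3 / 4"
  proof -
    have "4 / 3 \<le> sqrt 2" by (rule real_le_rsqrt) (simp add: power_divide)
    then show ?thesis by (simp add: field_simps)
  qed
  finally show ?thesis .
qed

section \<open>Reciprocals of primes\<close>
definition prime_recip :: "real \<Rightarrow> real" where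
  "prime_recip X = (\<Sum>p | prime p \<and> real p \<le> X. 1 / real p)"

lemma finite_primes_le [simp]: "finite {p::nat. prime p \<and> real p \<le> X}"
  by (rule finite_subset[of _ "{..nat \<lfloor>X\<rfloor>}"]) (auto simp: le_nat_floor)

lemma prod_primes_dvd:
  fixes n :: nat
  assumes "finite A" "\<forall>p\<in>A. prime p \<and> p dvd n"
  shows "\<Prod>A dvd n"
  using assms
proof (induction A rule: finite_induct)
  case (insert p A)
  have "coprime p (\<Prod>A)"
    by (rule prod_coprime_right) (use insert in \<open>auto intro: primes_coprime\<close>)
  then show ?case using insert by (simp add: divides_mult)
qed simp

text \<open>
  Chebyshev's argument: a prime in $(n, 2n]$ divides the central binomial coefficient.
\<close>
lemma prime_block_prod_le:
  "(\<Prod>p | prime p \<and> n < p \<and> p \<le> 2 * n. p) \<le> (4::nat) ^ n"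
proof -
  have "(\<Prod>p | prime p \<and> n < p \<and> p \<le> 2 * n. p) dvd ((2 * n) choose n)"
  proof (rule prod_primes_dvd)
    show "\<forall>p\<in>{p. prime p \<and> n < p \<and> p \<le> 2 * n}. prime p \<and> p dvd ((2 * n) choose n)"
    proof safe
      fix p :: nat assume p: "prime p" "n < p" "p \<le> 2 * n"
      have "p dvd fact (2 * n)" using p by (auto simp: prime_dvd_fact_iff)
      moreover have "fact (2 * n) = fact n * fact n * ((2 * n) choose n)"
        using binomial_fact_lemma[of n "2 * n"] by (simp add: mult_2)
      moreover have "\<not> p dvd fact n" using p by (auto simp: prime_dvd_fact_iff)
      ultimately show "p dvd ((2 * n) choose n)" using p by (metis prime_dvd_mult_iff)
    qed
  qed (rule finite_subset[of _ "{..2 * n}"], auto)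
  then have "(\<Prod>p | prime p \<and> n < p \<and> p \<le> 2 * n. p) \<le> ((2 * n) choose n)"
    by (rule dvd_imp_le) simp
  also have "\<dots> \<le> 2 ^ (2 * n)" by (rule binomial_le_pow2)
  also have "\<dots> = 4 ^ n" by (simp add: power_mult)
  finally show ?thesis .
qed

lemma prime_recip_block:
  assumes "j \<ge> 1"
  shows "(\<Sum>p | prime p \<and> 2 ^ j < p \<and> p \<le> 2 ^ Suc j. 1 / real p) \<le> 2 / real j"
proof -
  let ?A = "{p::nat. prime p \<and> 2 ^ j < p \<and> p \<le> 2 ^ Suc j}"
  have fin: "finite ?A" by (rule finite_subset[of _ "{..2 ^ Suc j}"]) auto
  have "(2 ^ j) ^ card ?A = (\<Prod>p\<in>?A. (2::nat) ^ j)" by simp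
  also have "\<dots> \<le> (\<Prod>p\<in>?A. p)" by (intro prod_mono) auto
  also have "\<dots> \<le> 4 ^ (2 ^ j)" using prime_block_prod_le[of "2 ^ j"] by simp
  also have "\<dots> = 2 ^ (2 * 2 ^ j)" by (simp add: power_mult)
  finally have "(2::nat) ^ (j * card ?A) \<le> 2 ^ (2 * 2 ^ j)" by (simp add: power_mult)
  then have "j * card ?A \<le> 2 * 2 ^ j" by (rule power_le_imp_le_exp[rotated]) simp
  then have "real (j * card ?A) \<le> real (2 * 2 ^ j)" by (simp only: of_nat_le_iff)
  then have c: "real j * real (card ?A) \<le> 2 * 2 ^ j" by simp
  have "(\<Sum>p\<in>?A. 1 / real p) \<le> (\<Sum>p\<in>?A. 1 / 2 ^ j)"
  proof (rule sum_mono)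
    fix p assume "p \<in> ?A"
    then have "real (2 ^ j) \<le> real p" by (intro of_nat_mono) auto
    then show "1 / real p \<le> 1 / 2 ^ j" by (intro frac_le) auto
  qed
  also have "\<dots> = real (card ?A) / 2 ^ j" by simp
  also have "\<dots> \<le> 2 / real j" using c assms by (simp add: field_simps)
  finally show ?thesis .
qed

lemma sum_inverse_nat_le: "n \<ge> 1 \<Longrightarrow> (\<Sum>j=1..n. 1 / real j) \<le> 1 + ln (real n)"
proof (induction n rule: dec_induct)
  case (step n)
  have "ln (real n / real (Suc n)) \<le> real n / real (Suc n) - 1"
    using step by (intro ln_le_minus_one) auto
  then have "1 / real (Suc n) \<le> ln (real (Suc n)) - ln (real n)"
    using step by (simp add: ln_div field_simps)
  then show ?case using step by simp
qed simp

lemma ln_2_ge_half: "ln 2 \<ge> (1/2 :: real)"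
  using ln_le_minus_one[of "1 / 2 :: real"] by (simp add: ln_div)

lemma prime_recip_pow2: "J \<ge> 1 \<Longrightarrow> prime_recip (2 ^ J) \<le> 5 / 2 + 2 * ln (real J)"
proof -
  assume "J \<ge> 1"
  have "prime_recip (2 ^ J) \<le> 1 / 2 + (\<Sum>j=1..<J. 2 / real j)" using \<open>J \<ge> 1\<close>
  proof (induction J rule: dec_induct)
    case base
    have "p = 2" if "prime p" "p \<le> 2" for p :: nat
      using prime_ge_2_nat[OF that(1)] that(2) by simp
    then have "{p::nat. prime p \<and> real p \<le> 2 ^ 1} = {2}" by auto
    then show ?case by (simp add: prime_recip_def)
  next
    case (step J)
    have conv: "real p \<le> 2 ^ i \<longleftrightarrow> p \<le> 2 ^ i" for p i
      using of_nat_le_iff[of p "2 ^ i", where 'a=real] by simp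
    have "p \<le> 2 ^ J \<Longrightarrow> p \<le> 2 ^ Suc J" for p :: nat by simp
    then have "{p::nat. prime p \<and> real p \<le> 2 ^ Suc J} =
       {p. prime p \<and> real p \<le> 2 ^ J} \<union> {p. prime p \<and> 2 ^ J < p \<and> p \<le> 2 ^ Suc J}"
      unfolding conv by (auto simp del: power_Suc)
    moreover have "{p::nat. prime p \<and> real p \<le> 2 ^ J} \<inter> {p. prime p \<and> 2 ^ J < p \<and> p \<le> 2 ^ Suc J} = {}"
      unfolding conv by auto
    moreover have "finite {p::nat. prime p \<and> 2 ^ J < p \<and> p \<le> 2 ^ Suc J}"
      by (rule finite_subset[of _ "{..2 ^ Suc J}"]) auto
    ultimately have "prime_recip (2 ^ Suc J) = prime_recip (2 ^ J) +
        (\<Sum>p | prime p \<and> 2 ^ J < p \<and> p \<le> 2 ^ Suc J. 1 / real p)"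
      unfolding prime_recip_def by (simp add: sum.union_disjoint)
    then show ?case using step prime_recip_block[of J] by simp
  qed
  also have "(\<Sum>j=1..<J. 2 / real j) \<le> (\<Sum>j=1..J. 2 / real j)" by (rule sum_mono2) auto
  also have "\<dots> = 2 * (\<Sum>j=1..J. 1 / real j)" by (simp add: sum_distrib_left)
  also have "\<dots> \<le> 2 * (1 + ln (real J))" using sum_inverse_nat_le[OF \<open>J \<ge> 1\<close>] by simp
  finally show ?thesis by simp
qed

lemma prime_recip_nonneg: "prime_recip X \<ge> 0"
  unfolding prime_recip_def by (intro sum_nonneg) auto

lemma prime_recip_mono: "X \<le> Y \<Longrightarrow> prime_recip X \<le> prime_recip Y"
  unfolding prime_recip_def by (intro sum_mono2) auto

text \<open>
  Only the order $\ln \ln X$ matters later, not the constant 2 of this dyadic version of Mertens'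
  estimate.
\<close>
lemma prime_recip_le:
  assumes "X \<ge> 1"
  shows "prime_recip X \<le> 6 + 2 * ln (1 + ln X)"
proof -
  define J where "J = nat \<lceil>1 + 2 * ln X\<rceil>"
  have lx: "ln X \<ge> 0" using assms by simp
  have J: "J \<ge> 1" "real J \<ge> 1 + 2 * ln X" "real J \<le> 2 + 2 * ln X" using lx unfolding J_def by linarith+
  have ln2: "ln 2 \<ge> (1/2::real)" by (rule ln_2_ge_half)
  have "ln X \<le> real J * (1/2)" using J by simp
  also have "\<dots> \<le> real J * ln 2" by (rule mult_left_mono[OF ln2]) simp
  also have "\<dots> = ln (2 ^ J)" by (simp add: ln_realpow)
  finally have "X \<le> 2 ^ J" using assms by simp
  then have "prime_recip X \<le> 5 / 2 + 2 * ln (real J)"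
    using prime_recip_mono prime_recip_pow2[OF J(1)] by (meson order_trans)
  also have "ln (real J) \<le> ln (2 * (1 + ln X))" using J lx by (subst ln_le_cancel_iff) auto
  also have "\<dots> = ln 2 + ln (1 + ln X)" using lx by (subst ln_mult) auto
  finally have "prime_recip X \<le> 5 / 2 + 2 * (ln 2 + ln (1 + ln X))" by simp
  then show ?thesis using ln_2_less_1 by argo
qed

section \<open>Greatest common divisors along the iterates\<close>

text \<open>
  Writing $m = d l$ with $d = \gcd(M, m)$ separates a sum over the divisors of $M$, which is an
  Euler product, from a harmonic sum over $l$.
\<close>
lemma sum_gcd_powr_le:
  fixes s :: real
  assumes M: "M > 0" and n: "n \<ge> 1" and s: "s < 1"
    and small: "\<forall>p\<in>prime_factors M. real p powr (s - 1) \<le> 3/4"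
    and N: "N \<subseteq> {1..n}"
  shows "(\<Sum>m\<in>N. real (gcd M m) powr s / real m)
           \<le> (1 + ln (real n)) * exp (4 * (\<Sum>p\<in>prime_factors M. real p powr (s - 1)))"
proof -
  let ?D = "{d. d dvd M}"
  let ?g = "\<lambda>m. (gcd M m, m div gcd M m)"
  have finD: "finite ?D" using M by simp
  have finN: "finite N" using N finite_subset by blast
  have dec: "m = gcd M m * (m div gcd M m)" for m by simp
  have inj: "inj_on ?g N" by (rule inj_onI) (metis dec prod.inject)
  have "(\<Sum>m\<in>N. real (gcd M m) powr s / real m)
      = (\<Sum>m\<in>N. (\<lambda>(d, l). real d powr (s - 1) * (1 / real l)) (?g m))"
  proof (rule sum.cong)
    fix m assume "m \<in> N"
    have g: "real (gcd M m) > 0" using M by simp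
    have "real m = real (gcd M m) * real (m div gcd M m)" using dec[of m] by (metis of_nat_mult)
    then show "real (gcd M m) powr s / real m = (\<lambda>(d, l). real d powr (s - 1) * (1 / real l)) (?g m)"
      using g by (simp add: powr_diff field_simps)
  qed simp
  also have "\<dots> = (\<Sum>y\<in>?g ` N. (\<lambda>(d, l). real d powr (s - 1) * (1 / real l)) y)"
    by (subst sum.reindex[OF inj]) (simp add: o_def)
  also have "\<dots> \<le> (\<Sum>y\<in>?D \<times> {1..n}. (\<lambda>(d, l). real d powr (s - 1) * (1 / real l)) y)"
  proof (rule sum_mono2)
    show "?g ` N \<subseteq> ?D \<times> {1..n}"
    proof safe
      fix m assume "m \<in> N"
      then have m: "1 \<le> m" "m \<le> n" using N by auto
      have "m div gcd M m \<noteq> 0" using m dec[of m] by (metis mult_0_right not_one_le_zero)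
      moreover have "m div gcd M m \<le> n" using m div_le_dividend le_trans by blast
      ultimately show "m div gcd M m \<in> {1..n}" by simp
    qed
  qed (use finD in auto)
  also have "\<dots> = (\<Sum>d\<in>?D. real d powr (s - 1)) * (\<Sum>l=1..n. 1 / real l)"
    by (simp only: sum_product sum.cartesian_product)
  also have "\<dots> \<le> exp (4 * (\<Sum>p\<in>prime_factors M. real p powr (s - 1))) * (1 + ln (real n))"
  proof (rule mult_mono)
    have "(\<Sum>d\<in>?D. (\<Prod>p\<in>prime_factors d. 1) * real d powr -(1 - s))
        \<le> exp (4 * (\<Sum>p\<in>prime_factors M. 1 * real p powr -(1 - s)))"
    proof (rule euler_exp_bound)
      show "\<forall>m\<in>?D. 0 < m \<and> prime_factors m \<subseteq> prime_factors M"
        using M by (auto simp: in_prime_factors_iff intro!: Nat.gr0I)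
    qed (use s small finD in auto)
    then show "(\<Sum>d\<in>?D. real d powr (s - 1)) \<le> exp (4 * (\<Sum>p\<in>prime_factors M. real p powr (s - 1)))"
      by simp
    show "(\<Sum>l=1..n. 1 / real l) \<le> 1 + ln (real n)" by (rule sum_inverse_nat_le[OF n])
  qed (auto intro: sum_nonneg)
  finally show ?thesis by (simp add: mult.commute)
qed

text \<open>
  A majorant for the greatest common divisor of $M$ and the $i$-th iterate of the sum of divisors.
  It pretends that every iterate is squarefree, so that a prime $p$ always passes on the factor $p
  + 1$, and it counts a prime that divides several of these factors once for each of them. In
  return it is submultiplicative in its last argument for every pair of positive factors, coprime
  or not.
\<close>
fun gcd_tower :: "nat \<Rightarrow> nat \<Rightarrow> nat \<Rightarrow> nat" where
  "gcd_tower M 0 n = gcd M n"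
| "gcd_tower M (Suc i) n = (\<Prod>p\<in>prime_factors n. gcd_tower M i (p + 1))"

lemma gcd_tower_pos: "M > 0 \<Longrightarrow> gcd_tower M i n \<ge> 1"
proof (induction i arbitrary: n)
  case 0
  then show ?case by (simp add: Suc_leI)
next
  case (Suc i)
  show ?case unfolding gcd_tower.simps by (rule prod_ge_1) (use Suc in blast)
qed

lemma gcd_mult_dvd: "gcd M (a * b) dvd gcd M a * gcd M (b::nat)"
proof -
  have "gcd M (a * b) dvd gcd (M * gcd M b) (a * gcd M b)"
    by (rule gcd_greatest) (simp_all add: gcd_mult_distrib_nat)
  then show ?thesis using gcd_mult_distrib_nat[of "gcd M b" M a] by (metis mult.commute)
qed

lemma gcd_tower_mult_le:
  assumes "M > 0" "a > 0" "b > 0"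
  shows "gcd_tower M i (a * b) \<le> gcd_tower M i a * gcd_tower M i b"
proof (cases i)
  case 0
  have "gcd M (a * b) \<le> gcd M a * gcd M b"
    by (rule dvd_imp_le[OF gcd_mult_dvd]) (use assms in simp)
  then show ?thesis using 0 by simp
next
  case (Suc j)
  let ?f = "\<lambda>p. gcd_tower M j (p + 1)"
  have "prime_factors (a * b) = prime_factors a \<union> prime_factors b"
    using assms by (intro prime_factors_product) auto
  then have "gcd_tower M i (a * b) = prod ?f (prime_factors a \<union> prime_factors b)" using Suc by simp
  also have "\<dots> \<le> prod ?f (prime_factors a \<union> prime_factors b) * prod ?f (prime_factors a \<inter> prime_factors b)"
  proof -
    have "1 \<le> prod ?f (prime_factors a \<inter> prime_factors b)"
      using gcd_tower_pos[OF assms(1)] by (intro prod_ge_1) auto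
    then show ?thesis by simp
  qed
  also have "\<dots> = gcd_tower M i a * gcd_tower M i b" using Suc by (simp add: prod.union_inter)
  finally show ?thesis .
qed

lemma gcd_tower_prod_le:
  assumes "M > 0" "finite A" "\<forall>x\<in>A. f x > 0"
  shows "gcd_tower M i (\<Prod>x\<in>A. f x) \<le> (\<Prod>x\<in>A. gcd_tower M i (f x))"
  using assms(2,3)
proof (induction A rule: finite_induct)
  case empty
  then show ?case by (cases i) auto
next
  case (insert x A)
  have "gcd_tower M i (f x * prod f A) \<le> gcd_tower M i (f x) * gcd_tower M i (prod f A)"
    using insert assms(1) by (intro gcd_tower_mult_le) auto
  also have "\<dots> \<le> gcd_tower M i (f x) * (\<Prod>x\<in>A. gcd_tower M i (f x))"
    using insert by (intro mult_left_mono) auto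
  finally show ?case using insert by simp
qed

lemma prod_prime_factors_le: "n > 0 \<Longrightarrow> \<Prod>(prime_factors n) \<le> (n::nat)"
  by (rule dvd_imp_le[OF prod_primes_dvd]) auto

lemma gcd_tower_le_power: "M > 0 \<Longrightarrow> n > 0 \<Longrightarrow> gcd_tower M i n \<le> n ^ (2 ^ i)"
proof (induction i arbitrary: n)
  case 0
  then show ?case by (simp add: dvd_imp_le)
next
  case (Suc i)
  have "gcd_tower M (Suc i) n \<le> (\<Prod>p\<in>prime_factors n. (p ^ 2) ^ (2 ^ i))"
    unfolding gcd_tower.simps
  proof (rule prod_mono, safe)
    fix p assume "p \<in> prime_factors n"
    then have "p \<ge> 2" using prime_ge_2_nat by auto
    moreover from this have "p * 2 \<le> p * p" by (intro mult_left_mono) auto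
    ultimately have "p + 1 \<le> p ^ 2" unfolding power2_eq_square by linarith
    then have "(p + 1) ^ 2 ^ i \<le> (p ^ 2) ^ 2 ^ i" by (intro power_mono) auto
    then show "gcd_tower M i (p + 1) \<le> (p ^ 2) ^ (2 ^ i)"
      using Suc.IH[of "p + 1"] Suc.prems by (meson add_gr_0 order_trans zero_less_one)
  qed
  also have "\<dots> = (\<Prod>(prime_factors n)) ^ (2 ^ Suc i)"
    by (simp add: prod_power_distrib power_mult[symmetric] mult.commute)
  also have "\<dots> \<le> n ^ (2 ^ Suc i)" using prod_prime_factors_le Suc.prems by (intro power_mono) auto
  finally show ?case .
qed

lemma sum_of_divisors_mult:
  assumes "coprime a b" "a > 0" "b > 0"
  shows "sum_of_divisors (a * b) = sum_of_divisors a * sum_of_divisors b"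
proof -
  let ?D = "\<lambda>n::nat. {d. d dvd n}"
  have "sum_of_divisors a * sum_of_divisors b = (\<Sum>(x, y)\<in>?D a \<times> ?D b. x * y)"
    by (simp add: sum_of_divisors_def sum_product sum.cartesian_product)
  also have "\<dots> = (\<Sum>d\<in>?D (a * b). d)"
  proof (rule sum.reindex_bij_witness[of _ "\<lambda>d. (gcd d a, gcd d b)" "\<lambda>(x, y). x * y"])
    fix d assume "d \<in> ?D (a * b)"
    then have "gcd d (a * b) = d" by (simp add: gcd_nat.absorb1)
    then have "d dvd gcd d a * gcd d b" using gcd_mult_dvd[of d a b] by simp
    moreover have "coprime (gcd d a) (gcd d b)" using assms(1)
      by (meson coprime_divisors gcd_dvd2)
    then have "gcd d a * gcd d b dvd d" by (intro divides_mult) auto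
    ultimately show "(\<lambda>(x, y). x * y) (gcd d a, gcd d b) = d" by (simp add: dvd_antisym)
    show "(gcd d a, gcd d b) \<in> ?D a \<times> ?D b" by simp
  next
    fix y assume y: "y \<in> ?D a \<times> ?D b"
    obtain u v where [simp]: "y = (u, v)" by force
    have uv: "u dvd a" "v dvd b" using y by auto
    have "coprime v a" "coprime u b" using assms(1) uv
      by (meson coprime_commute coprime_divisors dvd_refl)+
    then have "gcd (u * v) a = u" "gcd (u * v) b = v"
      using uv by (simp_all add: gcd_mult_left_right_cancel gcd_mult_left_left_cancel gcd_nat.absorb1 coprime_commute)
    then show "((\<lambda>d. (gcd d a, gcd d b)) ((\<lambda>(x, y). x * y) y)) = y" by simp
    show "(\<lambda>(x, y). x * y) y \<in> ?D (a * b)" using uv by (simp add: mult_dvd_mono)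
  qed (auto)
  finally show ?thesis by (simp add: sum_of_divisors_def)
qed

lemma sum_of_divisors_pos: "n > 0 \<Longrightarrow> sum_of_divisors n > 0"
  using le_sum_of_divisors[of n] by linarith

lemma sum_of_divisors_1 [simp]: "sum_of_divisors 1 = 1" "sum_of_divisors (Suc 0) = 1"
  by (simp_all add: sum_of_divisors_def)

lemma sum_of_divisors_prod_prime_powers:
  assumes "finite A" "\<forall>p\<in>A. prime p"
  shows "sum_of_divisors (\<Prod>p\<in>A. p ^ e p) = (\<Prod>p\<in>A. sum_of_divisors (p ^ e p))"
  using assms
proof (induction A rule: finite_induct)
  case (insert p A)
  have "coprime (p ^ e p) (\<Prod>p\<in>A. p ^ e p)"
    by (rule prod_coprime_right) (use insert in \<open>auto intro!: primes_coprime\<close>)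
  moreover have "p ^ e p > 0" "(\<Prod>p\<in>A. p ^ e p) > 0"
    using insert by (auto intro!: prod_pos prime_gt_0_nat)
  ultimately show ?case using insert by (simp add: sum_of_divisors_mult)
qed simp

lemma sum_of_divisors_eq_prod:
  assumes "n > 0"
  shows "sum_of_divisors n = (\<Prod>p\<in>prime_factors n. sum_of_divisors (p ^ multiplicity p n))"
  by (rule trans[OF arg_cong[OF prime_factorization_nat[OF assms], of sum_of_divisors]
        sum_of_divisors_prod_prime_powers]) auto

lemma sum_of_divisors_le_square: "n > 0 \<Longrightarrow> sum_of_divisors n \<le> n ^ 2"
proof -
  assume n: "n > 0"
  have "sum_of_divisors n \<le> (\<Sum>d\<in>{1..n}. n)" unfolding sum_of_divisors_def
    by (rule order_trans[OF sum_mono[of _ _ "\<lambda>_. n"] sum_mono2])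
       (use n in \<open>auto intro: dvd_imp_le dvd_pos_nat Suc_leI\<close>)
  then show ?thesis by (simp add: power2_eq_square)
qed

lemma sum_of_divisors_prime: "prime p \<Longrightarrow> sum_of_divisors p = p + 1"
proof -
  assume p: "prime p"
  then have "{d. d dvd p} = {1, p}" by (auto simp: prime_nat_iff)
  moreover have "p \<noteq> 1" using p by auto
  ultimately show ?thesis by (simp add: sum_of_divisors_def)
qed

lemma square_part_eq_prod:
  "n > 0 \<Longrightarrow> square_part n = (\<Prod>p\<in>prime_factors n. p ^ (multiplicity p n div 2))" for n :: nat
  by (simp add: square_part_nonzero)

text \<open>
  A prime dividing $u$ exactly once contributes $p + 1$ to the sum of divisors, as in the tower.
  For $p^v$ with $v \ge 2$ the trivial bound is enough: the sum of divisors of $p^v$ is at most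
  $p^{2v}$, and $2v \le 6 \lfloor v/2 \rfloor$, which is where the exponent 6 comes from.
\<close>
lemma gcd_tower_sum_of_divisors_le:
  assumes M: "M > 0" and u: "u > 0"
  shows "gcd_tower M i (sum_of_divisors u) \<le> square_part u ^ (6 * 2 ^ i) * gcd_tower M (Suc i) u"
proof -
  have pp: "prime p" "p > 0" "multiplicity p u \<ge> 1" if "p \<in> prime_factors u" for p
  proof -
    show "prime p" "p > 0" using that prime_gt_0_nat by auto
    have "p dvd u" using that by auto
    then show "multiplicity p u \<ge> 1"
      using \<open>prime p\<close> u prime_multiplicity_gt_zero_iff[of p u] by (simp add: Suc_le_eq)
  qed
  have "gcd_tower M i (sum_of_divisors u) = gcd_tower M i (\<Prod>p\<in>prime_factors u. sum_of_divisors (p ^ multiplicity p u))"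
    by (simp add: sum_of_divisors_eq_prod[OF u])
  also have "\<dots> \<le> (\<Prod>p\<in>prime_factors u. gcd_tower M i (sum_of_divisors (p ^ multiplicity p u)))"
    by (rule gcd_tower_prod_le) (use M pp in \<open>auto intro!: sum_of_divisors_pos\<close>)
  also have "\<dots> \<le> (\<Prod>p\<in>prime_factors u. (p ^ (multiplicity p u div 2)) ^ (6 * 2 ^ i) * gcd_tower M i (p + 1))"
  proof (rule prod_mono, safe)
    fix p assume p: "p \<in> prime_factors u"
    let ?v = "multiplicity p u"
    show "gcd_tower M i (sum_of_divisors (p ^ ?v)) \<le> (p ^ (?v div 2)) ^ (6 * 2 ^ i) * gcd_tower M i (p + 1)"
    proof (cases "?v = 1")
      case True
      then show ?thesis using pp[OF p] by (simp add: sum_of_divisors_prime)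
    next
      case False
      have "2 * v \<le> 6 * (v div 2)" if "v \<ge> 1" "v \<noteq> 1" for v :: nat using that by presburger
      then have v: "2 * ?v \<le> 6 * (?v div 2)" using pp(3)[OF p] False by blast
      have "gcd_tower M i (sum_of_divisors (p ^ ?v)) \<le> sum_of_divisors (p ^ ?v) ^ (2 ^ i)"
        by (rule gcd_tower_le_power) (use M pp[OF p] in \<open>auto intro!: sum_of_divisors_pos\<close>)
      also have "\<dots> \<le> ((p ^ ?v) ^ 2) ^ (2 ^ i)"
        by (intro power_mono sum_of_divisors_le_square) (use pp[OF p] in auto)
      also have "\<dots> = p ^ (2 * ?v * 2 ^ i)" by (simp add: power_mult[symmetric] mult.commute)
      also have "\<dots> \<le> p ^ (6 * (?v div 2) * 2 ^ i)"
        by (rule power_increasing) (use v pp[OF p] in auto)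
      also have "\<dots> = (p ^ (?v div 2)) ^ (6 * 2 ^ i)" by (simp add: power_mult[symmetric] mult_ac)
      also have "\<dots> \<le> \<dots> * gcd_tower M i (p + 1)" using gcd_tower_pos[OF M, of i "p + 1"] by simp
      finally show ?thesis .
    qed
  qed
  also have "\<dots> = square_part u ^ (6 * 2 ^ i) * gcd_tower M (Suc i) u"
    by (simp add: prod.distrib prod_power_distrib square_part_eq_prod[OF u])
  finally show ?thesis .
qed

section \<open>Moments of the towers\<close>

text \<open>
  For $n \ge 3$ the range of summation contains all positive integers up to $n$ and all $p + 1$
  with $p \le n$ prime, but no integer with a prime factor above $n$. So passing from a tower to
  the next one, through integers of the form $p + 1$, leaves the range unchanged.
\<close>
definition tower_moment :: "nat \<Rightarrow> nat \<Rightarrow> real \<Rightarrow> nat \<Rightarrow> real" where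
  "tower_moment M i s n =
     (\<Sum>m | 1 \<le> m \<and> m \<le> n + 1 \<and> prime_factors m \<subseteq> {..n}.
        real (gcd_tower M i m) powr s / real m)"

lemma tower_moment_0_le:
  assumes "M > 0" "s < 1" "\<forall>p\<in>prime_factors M. real p powr (s - 1) \<le> 3/4"
  shows "tower_moment M 0 s n
    \<le> (1 + ln (real n + 1)) * exp (4 * (\<Sum>p\<in>prime_factors M. real p powr (s - 1)))"
proof -
  have "{m. 1 \<le> m \<and> m \<le> n + 1 \<and> prime_factors m \<subseteq> {..n}} \<subseteq> {1..n + 1}" by auto
  from sum_gcd_powr_le[OF assms(1) _ assms(2,3) this] show ?thesis
    by (simp add: tower_moment_def add.commute)
qed

lemma tower_moment_Suc_le:
  "tower_moment M (Suc i) s n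
     \<le> exp (4 * (\<Sum>p | prime p \<and> real p \<le> real n. real (gcd_tower M i (p + 1)) powr s / real p))"
proof -
  let ?N = "{m. 1 \<le> m \<and> m \<le> n + 1 \<and> prime_factors m \<subseteq> {..n}}"
  let ?h = "\<lambda>p. real (gcd_tower M i (p + 1)) powr s"
  have fin: "finite ?N" by (rule finite_subset[of _ "{..n + 1}"]) auto
  have "tower_moment M (Suc i) s n = (\<Sum>m\<in>?N. (\<Prod>p\<in>prime_factors m. ?h p) * real m powr -1)"
    unfolding tower_moment_def
  proof (rule sum.cong)
    fix m assume "m \<in> ?N"
    have "real (gcd_tower M (Suc i) m) powr s = (\<Prod>p\<in>prime_factors m. ?h p)"
      by (simp add: prod_powr_distrib)
    then show "real (gcd_tower M (Suc i) m) powr s / real m = (\<Prod>p\<in>prime_factors m. ?h p) * real m powr -1"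
      by (simp add: powr_minus divide_inverse del: gcd_tower.simps)
  qed simp
  also have "\<dots> \<le> exp (4 * (\<Sum>p | prime p \<and> real p \<le> real n. ?h p * real p powr -1))"
  proof (rule euler_exp_bound)
    show "\<forall>p\<in>{p. prime p \<and> real p \<le> real n}. real p powr - 1 \<le> 3 / 4"
    proof safe
      fix p :: nat assume "prime p"
      then show "real p powr - 1 \<le> 3 / 4" using prime_powr_le_three_quarters[of p 0] by simp
    qed
  qed (use fin in auto)
  finally show ?thesis by (simp add: powr_minus divide_inverse)
qed

text \<open>
  The trivial bound $\tau$ is used where the tower is small; there the sum keeps the saving of the
  primes over the integers. Where the tower is large, a higher power of it compensates for
  replacing the shifted primes $p + 1$ by all integers.
\<close>
lemma shifted_prime_sum_le:
  assumes M: "M > 0" and n: "n \<ge> 3"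
    and trunc: "\<And>m. real (gcd_tower M i m) powr s \<le> \<tau> + \<theta> * real (gcd_tower M i m) powr s'"
    and nn: "\<theta> \<ge> 0"
  shows "(\<Sum>p | prime p \<and> real p \<le> real n. real (gcd_tower M i (p + 1)) powr s / real p)
     \<le> \<tau> * prime_recip (real n) + 2 * \<theta> * tower_moment M i s' n"
proof -
  let ?A = "{p. prime p \<and> real p \<le> real n}"
  let ?N = "{m. 1 \<le> m \<and> m \<le> n + 1 \<and> prime_factors m \<subseteq> {..n}}"
  let ?F = "\<lambda>m. real (gcd_tower M i m)"
  have fin: "finite ?N" by (rule finite_subset[of _ "{..n + 1}"]) auto
  have sub: "(\<lambda>p. p + 1) ` ?A \<subseteq> ?N"
  proof safe
    fix p q assume p: "prime p" "real p \<le> real n" and q: "q \<in> prime_factors (p + 1)"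
    then have q': "prime q" "q dvd p + 1" by auto
    have "q \<le> p + 1" using q' by (intro dvd_imp_le) auto
    show "q \<le> n"
    proof (rule ccontr)
      assume "\<not> q \<le> n"
      \<comment> \<open>A prime factor above $n$ of $p + 1$ would make $n$ and $n + 1$ both prime.\<close>
      then have "q = p + 1" "p = n" using \<open>q \<le> p + 1\<close> p by auto
      then have "prime p" "prime (p + 1)" "p \<ge> 3" using p q' n by auto
      then show False using prime_odd_nat[of p] prime_odd_nat[of "p + 1"] by auto
    qed
  qed auto
  have "(\<Sum>p\<in>?A. ?F (p + 1) powr s / real p)
      \<le> (\<Sum>p\<in>?A. \<tau> * (1 / real p) + 2 * \<theta> * (?F (p + 1) powr s' / real (p + 1)))"
  proof (rule sum_mono)
    fix p assume "p \<in> ?A"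
    then have p: "real p \<ge> 1" using prime_ge_1_nat by force
    have "?F (p + 1) powr s / real p \<le> (\<tau> + \<theta> * ?F (p + 1) powr s') / real p"
      using trunc[of "p + 1"] p by (intro divide_right_mono) auto
    also have "\<dots> = \<tau> * (1 / real p) + \<theta> * ?F (p + 1) powr s' * (1 / real p)"
      by (simp add: add_divide_distrib)
    also have "\<theta> * ?F (p + 1) powr s' * (1 / real p) \<le> \<theta> * ?F (p + 1) powr s' * (2 / real (p + 1))"
      using p nn by (intro mult_left_mono) (auto simp: field_simps)
    also have "\<theta> * ?F (p + 1) powr s' * (2 / real (p + 1)) = 2 * \<theta> * (?F (p + 1) powr s' / real (p + 1))"
      by simp
    finally show "?F (p + 1) powr s / real p
       \<le> \<tau> * (1 / real p) + 2 * \<theta> * (?F (p + 1) powr s' / real (p + 1))" by simp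
  qed
  also have "\<dots> = \<tau> * prime_recip (real n) + 2 * \<theta> * (\<Sum>p\<in>?A. ?F (p + 1) powr s' / real (p + 1))"
    by (simp add: sum.distrib sum_distrib_left prime_recip_def)
  also have "(\<Sum>p\<in>?A. ?F (p + 1) powr s' / real (p + 1)) = (\<Sum>m\<in>(\<lambda>p. p + 1) ` ?A. ?F m powr s' / real m)"
    by (subst sum.reindex) auto
  also have "\<dots> \<le> tower_moment M i s' n"
    unfolding tower_moment_def using fin sub by (intro sum_mono2) auto
  finally show ?thesis using nn by (simp add: mult_left_mono)
qed

lemma tower_moment_step:
  assumes "M > 0" "n \<ge> 3"
    and "\<And>m. real (gcd_tower M i m) powr s \<le> \<tau> + \<theta> * real (gcd_tower M i m) powr s'"
    and "\<theta> \<ge> 0"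
    and "tower_moment M i s' n \<le> G" "\<theta> * G \<le> 1"
  shows "tower_moment M (Suc i) s n \<le> exp (4 * \<tau> * prime_recip (real n) + 8)"
proof -
  have "2 * \<theta> * tower_moment M i s' n \<le> 2 * \<theta> * G" using assms by (intro mult_left_mono) auto
  then have "\<tau> * prime_recip (real n) + 2 * \<theta> * tower_moment M i s' n \<le> \<tau> * prime_recip (real n) + 2"
    using assms(6) by linarith
  then have "(\<Sum>p | prime p \<and> real p \<le> real n. real (gcd_tower M i (p + 1)) powr s / real p)
      \<le> \<tau> * prime_recip (real n) + 2"
    using shifted_prime_sum_le[OF assms(1-4)] by linarith
  then have "4 * (\<Sum>p | prime p \<and> real p \<le> real n. real (gcd_tower M i (p + 1)) powr s / real p)
      \<le> 4 * \<tau> * prime_recip (real n) + 8" by (simp add: algebra_simps)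
  then show ?thesis using tower_moment_Suc_le[of M i s n] by (meson exp_le_cancel_iff order_trans)
qed

lemma tower_moment_iterate:
  fixes \<sigma> :: "nat \<Rightarrow> real"
  assumes "M > 0" "n \<ge> 3"
    and trunc: "\<And>i m. i < k \<Longrightarrow>
      real (gcd_tower M i m) powr \<sigma> (Suc i) \<le> 2 + \<theta> * real (gcd_tower M i m) powr \<sigma> i"
    and "\<theta> \<ge> 0" "\<theta> * G \<le> 1"
    and "tower_moment M 0 (\<sigma> 0) n \<le> G"
    and "exp (8 * prime_recip (real n) + 8) \<le> G"
  shows "i \<le> k \<Longrightarrow> tower_moment M i (\<sigma> i) n \<le> G"
proof (induction i)
  case 0
  then show ?case using assms by simp
next
  case (Suc i)
  then show ?case
    using tower_moment_step[of M n i "\<sigma> (Suc i)" 2 \<theta> "\<sigma> i" G] assms by fastforce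
qed

text \<open>
  If $M$ has no small prime factors, then the tower cannot take small values other than 1. This
  makes the truncation at 2 gain a power of $z$.
\<close>
lemma gcd_tower_rough:
  assumes "\<forall>p\<in>prime_factors M. real p \<ge> z" "M > 0"
  shows "gcd_tower M i m = 1 \<or> real (gcd_tower M i m) \<ge> z"
proof (induction i arbitrary: m)
  case 0
  show ?case
  proof (cases "gcd M m = 1")
    case False
    then obtain p where p: "prime p" "p dvd gcd M m" by (metis prime_factor_nat)
    then have "p \<le> gcd M m" using assms(2) by (intro dvd_imp_le) auto
    moreover have "real p \<ge> z" using p assms by (auto simp: in_prime_factors_iff)
    ultimately show ?thesis by simp
  qed simp
next
  case (Suc i)
  show ?case
  proof (cases "\<forall>p\<in>prime_factors m. gcd_tower M i (p + 1) = 1")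
    case True
    then show ?thesis by simp
  next
    case False
    then obtain p where p: "p \<in> prime_factors m" "gcd_tower M i (p + 1) \<noteq> 1" by blast
    have "1 \<le> (\<Prod>q\<in>prime_factors m - {p}. gcd_tower M i (q + 1))"
      using gcd_tower_pos[OF assms(2)] by (intro prod_ge_1) blast
    then have "gcd_tower M i (p + 1) * 1 \<le> gcd_tower M i (p + 1) * (\<Prod>q\<in>prime_factors m - {p}. gcd_tower M i (q + 1))"
      by (intro mult_left_mono) auto
    also have "\<dots> = gcd_tower M (Suc i) m" using p by (simp add: prod.remove)
    finally have "real (gcd_tower M i (p + 1)) \<le> real (gcd_tower M (Suc i) m)" by linarith
    then show ?thesis using Suc.IH[of "p + 1"] p by linarith
  qed
qed

text \<open>
  The exponent starts at $7/8$ and loses $1/(8k)$ at every level, so that it is at least $3/4$ for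
  $k$ levels and sums of $w^{-2s}$ over $w$ converge. The factor $z^{-1/(8k)}$ gained in each
  truncation has to beat $G$, a power of $\ln n$.
\<close>
lemma rough_tower_moment_le:
  assumes M: "M > 0" and n: "n \<ge> 3" and k: "k \<ge> 1" and z: "z > 0"
    and rough: "\<forall>p\<in>prime_factors M. real p \<ge> z"
    and few: "real (card (prime_factors M)) * z powr (-1/8) \<le> 1"
    and z2: "z powr (-1/8) \<le> 3/4"
    and G: "z powr (-1 / (8 * real k)) * G \<le> 1"
      "exp (8 * prime_recip (real n) + 8) \<le> G" "(1 + ln (real n + 1)) * exp 4 \<le> G"
    and i: "i \<le> k"
  shows "tower_moment M i (7/8 - real i / (8 * real k)) n \<le> G"
proof (rule tower_moment_iterate[where \<theta> = "z powr (-1 / (8 * real k))" and \<sigma> = "\<lambda>i. 7/8 - real i / (8 * real k)"])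
  fix i m assume "i < k"
  let ?F = "real (gcd_tower M i m)"
  let ?s = "\<lambda>i. 7/8 - real i / (8 * real k)"
  have eq: "?s i = ?s (Suc i) + 1 / (8 * real k)" using k by (simp add: field_simps)
  consider "?F = 1" | "?F \<ge> z" using gcd_tower_rough[OF rough M] by fastforce
  then show "?F powr ?s (Suc i) \<le> 2 + z powr (-1 / (8 * real k)) * ?F powr ?s i"
  proof cases
    case 1
    then show ?thesis by simp
  next
    case 2
    have "z powr (1 / (8 * real k)) \<le> ?F powr (1 / (8 * real k))"
      using 2 z k by (intro powr_mono2) auto
    then have "1 \<le> z powr (-1 / (8 * real k)) * ?F powr (1 / (8 * real k))"
      using z by (simp add: powr_minus field_simps)
    then have "?F powr ?s (Suc i) * 1 \<le> ?F powr ?s (Suc i) * (z powr (-1 / (8 * real k)) * ?F powr (1 / (8 * real k)))"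
      by (intro mult_left_mono) auto
    also have "\<dots> = z powr (-1 / (8 * real k)) * ?F powr ?s i"
      unfolding eq powr_add by simp
    finally show ?thesis by simp
  qed
next
  have p: "real p powr (7 / 8 - 1) \<le> z powr (-1/8)" if "p \<in> prime_factors M" for p
    using powr_mono2'[of "-1/8" z "real p"] rough that z by simp
  have "tower_moment M 0 (7/8) n
    \<le> (1 + ln (real n + 1)) * exp (4 * (\<Sum>p\<in>prime_factors M. real p powr (7/8 - 1)))"
  proof (rule tower_moment_0_le)
    show "\<forall>p\<in>prime_factors M. real p powr (7 / 8 - 1) \<le> 3 / 4" using p z2 order_trans by blast
  qed (use M in auto)
  also have "\<dots> \<le> (1 + ln (real n + 1)) * exp (4 * 1)"
  proof -
    have "(\<Sum>p\<in>prime_factors M. real p powr (7/8 - 1)) \<le> (\<Sum>p\<in>prime_factors M. z powr (-1/8))"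
      by (rule sum_mono) (rule p)
    then have "(\<Sum>p\<in>prime_factors M. real p powr (7/8 - 1)) \<le> 1" using few by simp
    then show ?thesis by (intro mult_left_mono) auto
  qed
  finally show "tower_moment M 0 (7/8 - real 0 / (8 * real k)) n \<le> G" using G(3) by simp
qed (use assms in auto)

text \<open>
  Where $F^s$ exceeds $\tau$, the ratio of $F^{s(1+K)}$ to $F^s$ is at least $\tau^K$.
\<close>
lemma powr_truncate:
  fixes F :: real
  assumes "F > 0" "\<tau> > 0" "K \<ge> 0"
  shows "F powr s \<le> \<tau> + \<tau> powr -K * F powr (s * (1 + K))"
proof (cases "F powr s \<le> \<tau>")
  case True
  then show ?thesis by (simp add: add_increasing2)
next
  case False
  then have "\<tau> powr K \<le> (F powr s) powr K" using assms by (intro powr_mono2) auto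
  then have "1 \<le> \<tau> powr -K * F powr (s * K)"
    using assms by (simp add: powr_powr powr_minus field_simps)
  then have "F powr s * 1 \<le> F powr s * (\<tau> powr -K * F powr (s * K))" by (intro mult_left_mono) auto
  also have "\<dots> = \<tau> powr -K * F powr (s * (1 + K))" by (simp add: distrib_left powr_add)
  finally show ?thesis using assms by simp
qed

lemma inverse_times_cancel: "y > 0 \<Longrightarrow> 1 / x = 1 / (x * y) * (y :: real)"
  by (cases "x = 0") (auto simp: field_simps)

text \<open>
  For smooth $M$ the tower takes all kinds of small values, and a truncation at 2 gains only the
  factor $2^{-K}$. This has to beat a power of $\ln n$, so $K$ is of order $\ln \ln n$, and that
  factor is lost in the exponent at each level. At the initial exponent $1 / \ln z$ the divisor
  sum of $M$ still behaves like a power of $\prod_{p \le z} (1 - 1/p)^{-1}$.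
\<close>
lemma smooth_tower_moment_le:
  assumes M: "M > 0" and n: "n \<ge> 3" and z0: "z > 0" and z: "ln z \<ge> 10"
    and smooth: "\<forall>p\<in>prime_factors M. real p \<le> z"
    and K: "K \<ge> 0" "2 powr -K * G \<le> 1"
    and G: "exp (8 * prime_recip (real n) + 8) \<le> G"
      "(1 + ln (real n + 1)) * exp (12 * prime_recip z) \<le> G"
  shows "tower_moment M i (1 / (ln z * (1 + K) ^ i)) n \<le> G"
proof (rule tower_moment_iterate[where \<theta> = "2 powr -K" and \<sigma> = "\<lambda>i. 1 / (ln z * (1 + K) ^ i)" and k = i])
  fix j m assume "j < i"
  have "1 / (ln z * (1 + K) ^ j) = 1 / (ln z * (1 + K) ^ Suc j) * (1 + K)"
    using inverse_times_cancel[of "1 + K" "ln z * (1 + K) ^ j"] K by (simp add: mult_ac)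
  then show "real (gcd_tower M j m) powr (1 / (ln z * (1 + K) ^ Suc j))
     \<le> 2 + 2 powr -K * real (gcd_tower M j m) powr (1 / (ln z * (1 + K) ^ j))"
    using powr_truncate[of "real (gcd_tower M j m)" 2 K "1 / (ln z * (1 + K) ^ Suc j)"]
      gcd_tower_pos[OF M, of j m] K by simp
next
  have p1: "real p powr (1 / ln z - 1) \<le> 3 / 4" and p2: "real p powr (1 / ln z - 1) \<le> 3 * (1 / real p)"
    if "p \<in> prime_factors M" for p
  proof -
    have p: "real p \<ge> 2" "real p \<le> z" using that smooth prime_ge_2_nat[of p] by auto
    have "1 / ln z \<le> 1 / 10" using z by (intro divide_left_mono) auto
    then show "real p powr (1 / ln z - 1) \<le> 3 / 4"
      using that by (intro prime_powr_le_three_quarters) auto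
    have "real p powr (1 / ln z) \<le> z powr (1 / ln z)" using p z by (intro powr_mono2) auto
    also have "\<dots> = exp 1" using z z0 by (auto simp: powr_def)
    also have "\<dots> \<le> 3" by (rule exp_le)
    finally show "real p powr (1 / ln z - 1) \<le> 3 * (1 / real p)"
      using p by (simp add: powr_diff divide_right_mono)
  qed
  have "tower_moment M 0 (1 / ln z) n
    \<le> (1 + ln (real n + 1)) * exp (4 * (\<Sum>p\<in>prime_factors M. real p powr (1 / ln z - 1)))"
    by (rule tower_moment_0_le) (use M z p1 in \<open>auto simp: field_simps\<close>)
  also have "\<dots> \<le> (1 + ln (real n + 1)) * exp (12 * prime_recip z)"
  proof -
    have "(\<Sum>p\<in>prime_factors M. real p powr (1 / ln z - 1)) \<le> (\<Sum>p\<in>prime_factors M. 3 * (1 / real p))"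
      by (rule sum_mono) (rule p2)
    also have "\<dots> \<le> (\<Sum>p | prime p \<and> real p \<le> z. 3 * (1 / real p))"
      using smooth by (intro sum_mono2) auto
    also have "\<dots> = 3 * prime_recip z" by (simp add: prime_recip_def sum_distrib_left)
    finally show ?thesis by (intro mult_left_mono) auto
  qed
  finally show "tower_moment M 0 (1 / (ln z * (1 + K) ^ 0)) n \<le> G" using G(2) by simp
qed (use assms in auto)

text \<open>
  At the last level nothing is iterated any more, so the moment may be as large as $\exp(\sqrt{\ln
  n})$. A truncation at $\tau = \sqrt{\ln n}$ instead of 2 then needs only a constant $K'$ and
  saves one factor $\ln \ln n$ in the exponent.
\<close>
lemma smooth_tower_moment_last_step:
  assumes M: "M > 0" and n: "n \<ge> 3" and z0: "z > 0" and z: "ln z \<ge> 10"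
    and smooth: "\<forall>p\<in>prime_factors M. real p \<le> z"
    and K: "K \<ge> 0" "2 powr -K * G \<le> 1"
    and G: "exp (8 * prime_recip (real n) + 8) \<le> G"
      "(1 + ln (real n + 1)) * exp (12 * prime_recip z) \<le> G"
    and \<tau>: "\<tau> > 0" "K' \<ge> 0" "\<tau> powr -K' * G \<le> 1"
  shows "tower_moment M (Suc i) (1 / (ln z * (1 + K) ^ i * (1 + K'))) n
           \<le> exp (4 * \<tau> * prime_recip (real n) + 8)"
proof (rule tower_moment_step[where s' = "1 / (ln z * (1 + K) ^ i)" and \<theta> = "\<tau> powr -K'"])
  show "tower_moment M i (1 / (ln z * (1 + K) ^ i)) n \<le> G"
    by (rule smooth_tower_moment_le[OF assms(1-9)])
  fix m
  have "1 / (ln z * (1 + K) ^ i) = 1 / (ln z * (1 + K) ^ i * (1 + K')) * (1 + K')"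
    using inverse_times_cancel \<tau> by simp
  then show "real (gcd_tower M i m) powr (1 / (ln z * (1 + K) ^ i * (1 + K')))
     \<le> \<tau> + \<tau> powr -K' * real (gcd_tower M i m) powr (1 / (ln z * (1 + K) ^ i))"
    using powr_truncate[of "real (gcd_tower M i m)" \<tau> K' "1 / (ln z * (1 + K) ^ i * (1 + K'))"]
      gcd_tower_pos[OF M, of i m] \<tau> by simp
qed (use assms in auto)

section \<open>Large square divisors of the iterates\<close>

declare gcd_tower.simps(2) [simp del]

text \<open>
  Since $w^2$ divides $u$ if and only if $w$ divides \<open>square_part u\<close>, the square part
  is the largest $w$ with this property. It is split into its $z$-rough and its $z$-smooth part.
\<close>
definition rough_root :: "real \<Rightarrow> nat \<Rightarrow> nat" where
  "rough_root z u = (\<Prod>p | p \<in> prime_factors u \<and> real p > z. p ^ (multiplicity p u div 2))"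

definition smooth_root :: "real \<Rightarrow> nat \<Rightarrow> nat" where
  "smooth_root z u = (\<Prod>p | p \<in> prime_factors u \<and> real p \<le> z. p ^ (multiplicity p u div 2))"

lemma square_part_eq_rough_smooth:
  assumes "u > 0"
  shows "square_part u = rough_root z u * smooth_root z u"
proof -
  have "prime_factors u = {p. p \<in> prime_factors u \<and> real p > z} \<union> {p. p \<in> prime_factors u \<and> real p \<le> z}"
    by auto
  then have "(\<Prod>p\<in>prime_factors u. p ^ (multiplicity p u div 2)) =
     (\<Prod>p\<in>{p. p \<in> prime_factors u \<and> real p > z} \<union> {p. p \<in> prime_factors u \<and> real p \<le> z}.
        p ^ (multiplicity p u div 2))" by simp
  also have "\<dots> = rough_root z u * smooth_root z u"
    unfolding rough_root_def smooth_root_def by (rule prod.union_disjoint) auto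
  finally show ?thesis using square_part_eq_prod[OF assms] by simp
qed

lemma rough_root_pos: "rough_root z u > 0"
  unfolding rough_root_def by (intro prod_pos) (auto intro!: prime_gt_0_nat)

lemma rough_root_square_dvd: "u > 0 \<Longrightarrow> rough_root z u ^ 2 dvd u"
  using square_part_eq_rough_smooth[of u z] square_part_square_dvd[of u]
  by (metis dvd_triv_left dvd_power_same dvd_trans)

lemma prime_factors_rough_root: "p \<in> prime_factors (rough_root z u) \<Longrightarrow> real p > z"
proof -
  assume p: "p \<in> prime_factors (rough_root z u)"
  then have "prime p" "p dvd (\<Prod>p | p \<in> prime_factors u \<and> real p > z. p ^ (multiplicity p u div 2))"
    by (auto simp: rough_root_def)
  then obtain q where "q \<in> prime_factors u" "real q > z" "p dvd q ^ (multiplicity q u div 2)"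
    by (auto simp: prime_dvd_prod_iff)
  then have "p = q" using \<open>prime p\<close> by (metis in_prime_factors_iff prime_dvd_power primes_dvd_imp_eq)
  then show ?thesis using \<open>real q > z\<close> by simp
qed

lemma square_dvd_imp_dvd_rough_root:
  assumes "u > 0" "prime q" "real q > z" "q ^ 2 dvd u"
  shows "q dvd rough_root z u"
proof -
  have "multiplicity q u \<ge> 2" using assms by (intro multiplicity_geI) auto
  then have m: "multiplicity q u div 2 \<ge> 1" by linarith
  have "q dvd q ^ (multiplicity q u div 2)" using m by (intro dvd_power) auto
  also have "\<dots> dvd rough_root z u" unfolding rough_root_def
  proof (rule dvd_prodI)
    have "q dvd u" using assms(4) by (metis dvd_power dvd_trans pos2)
    then show "q \<in> {p. p \<in> prime_factors u \<and> real p > z}" using assms by (auto simp: in_prime_factors_iff)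
  qed simp
  finally show ?thesis .
qed

text \<open>
  For $u \le n$, taking the greatest common divisor with this number extracts the full $z$-smooth
  part of $u$, because no prime occurs in $u$ to a power beyond $n$.
\<close>
definition smooth_modulus :: "real \<Rightarrow> nat \<Rightarrow> nat" where
  "smooth_modulus z n = (\<Prod>p | prime p \<and> real p \<le> z. p ^ n)"

lemma smooth_modulus_pos: "smooth_modulus z n > 0"
  unfolding smooth_modulus_def by (intro prod_pos) (auto intro!: prime_gt_0_nat)

lemma prime_factors_smooth_modulus: "p \<in> prime_factors (smooth_modulus z n) \<Longrightarrow> real p \<le> z"
proof -
  assume p: "p \<in> prime_factors (smooth_modulus z n)"
  then have "prime p" "p dvd (\<Prod>p | prime p \<and> real p \<le> z. p ^ n)"
    by (auto simp: smooth_modulus_def)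
  then obtain q where "prime q" "real q \<le> z" "p dvd q ^ n"
    by (auto simp: prime_dvd_prod_iff)
  then have "p = q" using \<open>prime p\<close> by (metis prime_dvd_power primes_dvd_imp_eq)
  then show ?thesis using \<open>real q \<le> z\<close> by simp
qed

lemma smooth_root_le_gcd:
  assumes "u > 0" "u \<le> n"
  shows "smooth_root z u \<le> gcd (smooth_modulus z n) u"
proof -
  have "smooth_root z u dvd smooth_modulus z n"
    unfolding smooth_root_def smooth_modulus_def
  proof (rule prod_dvd_prod_subset2)
    fix p assume "p \<in> {p. p \<in> prime_factors u \<and> real p \<le> z}"
    then have p: "prime p" by auto
    have "p ^ multiplicity p u \<le> u" using assms by (intro dvd_imp_le multiplicity_dvd) auto
    moreover have "multiplicity p u < p ^ multiplicity p u"
      using prime_ge_2_nat[OF p] by (intro power_gt_expt) auto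
    ultimately have "multiplicity p u div 2 \<le> n" using assms by linarith
    then show "p ^ (multiplicity p u div 2) dvd p ^ n" by (rule le_imp_power_dvd)
  qed auto
  moreover have "smooth_root z u dvd u"
    using square_part_eq_rough_smooth[OF assms(1), of z] square_part_square_dvd[of u]
    by (metis dvd_power dvd_trans dvd_triv_right pos2)
  ultimately have "smooth_root z u dvd gcd (smooth_modulus z n) u" by simp
  then show ?thesis using assms by (intro dvd_imp_le) auto
qed

lemma sum_of_divisors_iterate_pos: "m > 0 \<Longrightarrow> (sum_of_divisors ^^ i) m > 0"
  by (induction i) (auto intro!: sum_of_divisors_pos)

text \<open>
  Each application of \<open>gcd_tower_sum_of_divisors_le\<close> trades one iteration for one
  level of the tower, and doubles the exponent of the square part that is lost; $2^i - 1$ is the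
  resulting geometric sum.
\<close>
lemma gcd_tower_iterate_le:
  fixes X :: real
  assumes "M > 0" "m > 0" "X \<ge> 1"
    and "\<forall>t<i. real (square_part ((sum_of_divisors ^^ t) m)) \<le> X"
  shows "real (gcd_tower M j ((sum_of_divisors ^^ i) m))
     \<le> X ^ (6 * (2 ^ i - 1) * 2 ^ j) * real (gcd_tower M (i + j) m)"
  using assms(4)
proof (induction i arbitrary: j)
  case 0
  then show ?case by simp
next
  case (Suc i)
  let ?u = "(sum_of_divisors ^^ i) m"
  have sq: "real (square_part ?u) \<le> X" using Suc.prems by auto
  have "real (gcd_tower M j ((sum_of_divisors ^^ Suc i) m))
      \<le> real (square_part ?u ^ (6 * 2 ^ j) * gcd_tower M (Suc j) ?u)"
    using gcd_tower_sum_of_divisors_le[OF assms(1) sum_of_divisors_iterate_pos[OF assms(2)], of j i]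
    unfolding of_nat_le_iff by simp
  also have "\<dots> = real (square_part ?u) ^ (6 * 2 ^ j) * real (gcd_tower M (Suc j) ?u)" by simp
  also have "\<dots> \<le> X ^ (6 * 2 ^ j) * (X ^ (6 * (2 ^ i - 1) * 2 ^ Suc j) * real (gcd_tower M (i + Suc j) m))"
    using Suc.IH[of "Suc j"] Suc.prems sq assms(3) by (intro mult_mono power_mono) auto
  also have "\<dots> = X ^ (6 * 2 ^ j + 6 * (2 ^ i - 1) * 2 ^ Suc j) * real (gcd_tower M (Suc i + j) m)"
    by (simp add: power_add)
  also have "6 * 2 ^ j + 6 * (2 ^ i - 1) * 2 ^ Suc j = 6 * (2 ^ Suc i - 1) * (2::nat) ^ j"
  proof -
    have "1 + 2 * (y - 1) = 2 * y - 1" if "y \<ge> 1" for y :: nat using that by simp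
    from this[of "2 ^ i"] have "6 * 2 ^ j * (1 + 2 * (2 ^ i - 1)) = 6 * 2 ^ j * (2 * 2 ^ i - (1::nat))" by simp
    then show ?thesis by (simp add: algebra_simps)
  qed
  finally show ?case .
qed

lemma gcd_iterate_le:
  fixes X :: real
  assumes "M > 0" "m > 0" "X \<ge> 1"
    and "\<forall>t<i. real (square_part ((sum_of_divisors ^^ t) m)) \<le> X"
  shows "real (gcd M ((sum_of_divisors ^^ i) m)) \<le> X ^ (6 * 2 ^ i) * real (gcd_tower M i m)"
proof -
  have "real (gcd M ((sum_of_divisors ^^ i) m)) \<le> X ^ (6 * (2 ^ i - 1)) * real (gcd_tower M i m)"
    using gcd_tower_iterate_le[OF assms, of 0] by simp
  also have "\<dots> \<le> X ^ (6 * 2 ^ i) * real (gcd_tower M i m)"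
    using assms(3) by (intro mult_right_mono power_increasing) auto
  finally show ?thesis .
qed

text \<open>
  Markov's inequality for the $s$-th moment; replacing counting by summation with weights $n / m
  \ge 1$ turns the count into the logarithmic moment.
\<close>
lemma card_large_tower_le:
  assumes "M > 0" "B > 0" "J > 0" "s \<ge> 0"
  shows "real (card {m\<in>{1..n}. B \<le> J * real (gcd_tower M i m)})
     \<le> (J / B) powr s * (real n * tower_moment M i s n)"
proof -
  let ?S = "{m\<in>{1..n}. B \<le> J * real (gcd_tower M i m)}"
  let ?N = "{m. 1 \<le> m \<and> m \<le> n + 1 \<and> prime_factors m \<subseteq> {..n}}"
  have fin: "finite ?N" by (rule finite_subset[of _ "{..n + 1}"]) auto
  have sub: "?S \<subseteq> ?N"
  proof safe
    fix m p assume "m \<in> {1..n}" "p \<in> prime_factors m"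
    then show "p \<le> n" using dvd_imp_le[of p m] by (auto simp: in_prime_factors_iff)
  qed auto
  have "real (card ?S) = (\<Sum>m\<in>?S. 1)" by simp
  also have "\<dots> \<le> (\<Sum>m\<in>?S. (J / B) powr s * real n * (real (gcd_tower M i m) powr s / real m))"
  proof (rule sum_mono)
    fix m assume m: "m \<in> ?S"
    then have "1 \<le> J / B * real (gcd_tower M i m)" using assms by (simp add: field_simps)
    then have "1 \<le> (J / B * real (gcd_tower M i m)) powr s" using assms by (intro ge_one_powr_ge_zero) auto
    also have "\<dots> = (J / B) powr s * real (gcd_tower M i m) powr s" by (rule powr_mult)
    also have "\<dots> * 1 \<le> \<dots> * (real n / real m)" using m by (intro mult_left_mono) (auto simp: field_simps)
    finally show "1 \<le> (J / B) powr s * real n * (real (gcd_tower M i m) powr s / real m)"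
      by (simp add: mult_ac)
  qed
  also have "\<dots> = (J / B) powr s * real n * (\<Sum>m\<in>?S. real (gcd_tower M i m) powr s / real m)"
    by (simp add: sum_distrib_left)
  also have "\<dots> \<le> (J / B) powr s * real n * tower_moment M i s n"
    unfolding tower_moment_def using fin sub by (intro mult_left_mono sum_mono2) auto
  finally show ?thesis by (simp add: mult_ac)
qed

lemma card_prime_factors_le: "n \<ge> 1 \<Longrightarrow> real (card (prime_factors n)) \<le> 2 * ln (real n)" for n :: nat
proof -
  assume n: "n \<ge> 1"
  have "(2::nat) ^ card (prime_factors n) = (\<Prod>p\<in>prime_factors n. 2)" by simp
  also have "\<dots> \<le> \<Prod>(prime_factors n)" by (intro prod_mono) (auto intro: prime_ge_2_nat)
  also have "\<dots> \<le> n" using n by (intro prod_prime_factors_le) auto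
  finally have "real (2 ^ card (prime_factors n)) \<le> real n" by (simp only: of_nat_le_iff)
  then have "ln (2 ^ card (prime_factors n)) \<le> ln (real n)" using n by simp
  then have "real (card (prime_factors n)) * ln 2 \<le> ln (real n)" by (simp add: ln_realpow)
  moreover have "real (card (prime_factors n)) * (1/2) \<le> real (card (prime_factors n)) * ln 2"
    using ln_2_ge_half by (intro mult_left_mono) auto
  ultimately show ?thesis by linarith
qed

text \<open>
  Each $m$ in this set provides a $z$-rough $w > W$ with $w^2$ dividing the $i$-th iterate, so the
  tower for the modulus $w^2$ is large at $m$. Since the exponent of the moment is at least $3/4$,
  Markov's inequality gives the weight $w^{-3/2}$ to each $w$; the excess over $w^{-1}$ yields
  $W^{-1/2}$.
\<close>
lemma card_rough_exception_le:
  fixes J W z G :: real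
  assumes n: "n \<ge> 3" and k: "k \<ge> 1" and i: "i \<le> k" and z: "z > 0"
    and few: "2 * ln (real n) * z powr (-1/8) \<le> 1"
    and z2: "z powr (-1/8) \<le> 3/4"
    and G: "z powr (-1 / (8 * real k)) * G \<le> 1"
      "exp (8 * prime_recip (real n) + 8) \<le> G" "(1 + ln (real n + 1)) * exp 4 \<le> G"
    and X: "X \<ge> 1" and J: "J = X ^ (6 * 2 ^ i)" "J \<le> W"
  shows "real (card {m\<in>{1..n}. (sum_of_divisors ^^ i) m \<le> n \<and>
            (\<forall>t<i. real (square_part ((sum_of_divisors ^^ t) m)) \<le> X) \<and>
            real (rough_root z ((sum_of_divisors ^^ i) m)) > W})
         \<le> J * real n * G * (1 + ln (real n)) * W powr (-1/2)"
proof -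
  let ?s = "7/8 - real i / (8 * real k)"
  let ?B = "{m\<in>{1..n}. (sum_of_divisors ^^ i) m \<le> n \<and>
            (\<forall>t<i. real (square_part ((sum_of_divisors ^^ t) m)) \<le> X) \<and>
            real (rough_root z ((sum_of_divisors ^^ i) m)) > W}"
  let ?R = "{w\<in>{1..n}. real w > W \<and> (\<forall>p\<in>prime_factors w. real p > z)}"
  let ?C = "\<lambda>w. {m\<in>{1..n}. real (w ^ 2) \<le> J * real (gcd_tower (w ^ 2) i m)}"
  have J1: "J \<ge> 1" using X J by simp
  have W1: "W \<ge> 1" using J1 J by linarith
  have s: "?s \<ge> 3/4" using i k by (simp add: field_simps)
  have "?B \<subseteq> (\<Union>w\<in>?R. ?C w)"
  proof
    fix m assume m: "m \<in> ?B"
    let ?u = "(sum_of_divisors ^^ i) m" let ?w = "rough_root z ?u"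
    have u: "?u > 0" "?u \<le> n" "m > 0" using m sum_of_divisors_iterate_pos[of m i] by auto
    have w0: "?w > 0" by (rule rough_root_pos)
    have d: "?w ^ 2 dvd ?u" by (rule rough_root_square_dvd[OF u(1)])
    then have "?w dvd ?u" by (metis dvd_power dvd_trans pos2)
    then have "?w \<le> n" using u dvd_imp_le order_trans by blast
    then have R: "?w \<in> ?R" using w0 m prime_factors_rough_root by auto
    have "gcd (?w ^ 2) ?u = ?w ^ 2" using d by (simp add: gcd_nat.absorb1)
    then have "real (?w ^ 2) \<le> J * real (gcd_tower (?w ^ 2) i m)"
      using gcd_iterate_le[of "?w ^ 2" m X i] w0 u X m J by simp
    then have "m \<in> ?C ?w" using m by auto
    then show "m \<in> (\<Union>w\<in>?R. ?C w)" using R by blast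
  qed
  then have "card ?B \<le> card (\<Union>w\<in>?R. ?C w)" by (intro card_mono) auto
  also have "\<dots> \<le> (\<Sum>w\<in>?R. card (?C w))" by (rule card_UN_le) auto
  finally have "real (card ?B) \<le> real (\<Sum>w\<in>?R. card (?C w))" by (rule of_nat_mono)
  also have "\<dots> = (\<Sum>w\<in>?R. real (card (?C w)))" by (rule of_nat_sum)
  also have "\<dots> \<le> (\<Sum>w\<in>?R. J * real n * G * W powr (-1/2) * (1 / real w))"
  proof (rule sum_mono)
    fix w assume w: "w \<in> ?R"
    have w1: "w \<ge> 1" "real w > W" "w \<le> n" using w by auto
    have pf: "prime_factors (w ^ 2) = prime_factors w" by (simp add: prime_factors_power)
    have cw: "real (card (prime_factors w)) * z powr (-1/8) \<le> 1"
    proof -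
      have "real (card (prime_factors w)) \<le> 2 * ln (real n)"
      proof -
        have "ln (real w) \<le> ln (real n)" using w1 by simp
        then show ?thesis using card_prime_factors_le[OF w1(1)] by linarith
      qed
      then have "real (card (prime_factors w)) * z powr (-1/8) \<le> 2 * ln (real n) * z powr (-1/8)"
        by (intro mult_right_mono) auto
      then show ?thesis using few by linarith
    qed
    have mom: "tower_moment (w ^ 2) i ?s n \<le> G"
      by (rule rough_tower_moment_le[OF _ n k z])
         (use w pf cw z2 G i in \<open>auto intro: less_imp_le\<close>)
    have G0: "G \<ge> 0" using G(2) exp_ge_zero order_trans by blast
    have base: "J / real (w ^ 2) \<le> 1"
    proof -
      have "real w * 1 \<le> real w * real w" using w1 by (intro mult_left_mono) auto
      then have "J \<le> real w * real w" using J w1 by linarith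
      then have "J \<le> real (w ^ 2)" by (simp add: power2_eq_square)
      then show ?thesis using w1 by simp
    qed
    have "(J / real (w ^ 2)) powr ?s \<le> (J / real (w ^ 2)) powr (3/4)"
      by (rule powr_mono'[OF s]) (use base J1 in auto)
    also have "\<dots> = J powr (3/4) * real w powr (-3/2)"
    proof -
      have "real (w ^ 2) powr (3/4) = (real w powr 2) powr (3/4)" using w1 by simp
      also have "\<dots> = real w powr (3/2)" by (simp only: powr_powr) simp
      finally show ?thesis using J1 w1 by (simp add: powr_divide powr_minus_divide)
    qed
    also have "\<dots> \<le> J * (1 / real w * W powr (-1/2))"
    proof (rule mult_mono)
      have "J powr (3/4) \<le> J powr 1" using J1 by (intro powr_mono) auto
      then show "J powr (3/4) \<le> J" using J1 by simp
      have "real w powr (-3/2) = real w powr (-1) * real w powr (-1/2)"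
        using powr_add[of "real w" "-1" "-1/2"] by simp
      also have "\<dots> \<le> 1 / real w * W powr (-1/2)"
      proof (rule mult_mono)
        show "real w powr (-1/2) \<le> W powr (-1/2)" using w1 W1 by (intro powr_mono2') auto
        show "real w powr (-1) \<le> 1 / real w" using w1 by (simp add: powr_minus_divide)
      qed auto
      finally show "real w powr (-3/2) \<le> 1 / real w * W powr (-1/2)" .
    qed (use J1 in auto)
    finally have e: "(J / real (w ^ 2)) powr ?s \<le> J * (1 / real w * W powr (-1/2))" .
    have "real (card (?C w)) \<le> (J / real (w ^ 2)) powr ?s * (real n * tower_moment (w ^ 2) i ?s n)"
    proof (rule card_large_tower_le)
      show "0 < w ^ 2" "0 < real (w ^ 2)" using w1 by auto
      show "0 < J" "0 \<le> ?s" using J1 s by linarith+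
    qed
    also have "\<dots> \<le> J * (1 / real w * W powr (-1/2)) * (real n * G)"
    proof (rule mult_mono[OF e mult_left_mono[OF mom]])
      show "0 \<le> J * (1 / real w * W powr (-1/2))" using J1 by simp
      show "0 \<le> real n * tower_moment (w ^ 2) i ?s n"
        unfolding tower_moment_def by (intro mult_nonneg_nonneg sum_nonneg) auto
    qed simp
    finally show "real (card (?C w)) \<le> J * real n * G * W powr (-1/2) * (1 / real w)"
      by (simp add: mult_ac)
  qed
  also have "\<dots> = J * real n * G * W powr (-1/2) * (\<Sum>w\<in>?R. 1 / real w)" by (simp add: sum_distrib_left)
  also have "\<dots> \<le> J * real n * G * W powr (-1/2) * (1 + ln (real n))"
  proof (rule mult_left_mono)
    have "(\<Sum>w\<in>?R. 1 / real w) \<le> (\<Sum>w=1..n. 1 / real w)" by (intro sum_mono2) auto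
    then show "(\<Sum>w\<in>?R. 1 / real w) \<le> 1 + ln (real n)" using sum_inverse_nat_le[of n] n by linarith
    have "G \<ge> 0" using G(2) exp_ge_zero order_trans by blast
    then show "0 \<le> J * real n * G * W powr (-1/2)" using J1 by simp
  qed
  finally show ?thesis by (simp add: mult_ac)
qed

lemma card_smooth_exception_le:
  fixes J W z G :: real
  assumes n: "n \<ge> 3" and z0: "z > 0" and z: "ln z \<ge> 10"
    and K: "K \<ge> 0" "2 powr -K * G \<le> 1"
    and G: "exp (8 * prime_recip (real n) + 8) \<le> G"
      "(1 + ln (real n + 1)) * exp (12 * prime_recip z) \<le> G"
    and \<tau>: "\<tau> > 0" "K' \<ge> 0" "\<tau> powr -K' * G \<le> 1"
    and X: "X \<ge> 1" and J: "J = X ^ (6 * 2 ^ Suc i)" "J \<le> W"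
  shows "real (card {m\<in>{1..n}. (sum_of_divisors ^^ Suc i) m \<le> n \<and>
            (\<forall>t<Suc i. real (square_part ((sum_of_divisors ^^ t) m)) \<le> X) \<and>
            real (smooth_root z ((sum_of_divisors ^^ Suc i) m)) > W})
         \<le> (J / W) powr (1 / (ln z * (1 + K) ^ i * (1 + K'))) *
             (real n * exp (4 * \<tau> * prime_recip (real n) + 8))"
proof -
  let ?s = "1 / (ln z * (1 + K) ^ i * (1 + K'))"
  let ?B = "{m\<in>{1..n}. (sum_of_divisors ^^ Suc i) m \<le> n \<and>
            (\<forall>t<Suc i. real (square_part ((sum_of_divisors ^^ t) m)) \<le> X) \<and>
            real (smooth_root z ((sum_of_divisors ^^ Suc i) m)) > W}"
  let ?M = "smooth_modulus z n"
  have J1: "J \<ge> 1" using X J by simp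
  have W1: "W \<ge> 1" using J1 J by linarith
  have s: "?s \<ge> 0" using z K \<tau> by auto
  have M: "?M > 0" by (rule smooth_modulus_pos)
  have "?B \<subseteq> {m\<in>{1..n}. W \<le> J * real (gcd_tower ?M (Suc i) m)}"
  proof
    fix m assume m: "m \<in> ?B"
    let ?u = "(sum_of_divisors ^^ Suc i) m"
    have u: "?u > 0" "?u \<le> n" "m > 0" using m sum_of_divisors_iterate_pos[of m "Suc i"] by auto
    have "W \<le> real (smooth_root z ?u)" using m by auto
    also have "\<dots> \<le> real (gcd ?M ?u)" using smooth_root_le_gcd[OF u(1,2), of z] by (simp only: of_nat_le_iff)
    also have "\<dots> \<le> J * real (gcd_tower ?M (Suc i) m)"
      unfolding J by (rule gcd_iterate_le[OF M u(3) X]) (use m in auto)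
    finally show "m \<in> {m\<in>{1..n}. W \<le> J * real (gcd_tower ?M (Suc i) m)}" using m by auto
  qed
  then have "real (card ?B) \<le> real (card {m\<in>{1..n}. W \<le> J * real (gcd_tower ?M (Suc i) m)})"
    by (intro of_nat_mono card_mono) auto
  also have "\<dots> \<le> (J / W) powr ?s * (real n * tower_moment ?M (Suc i) ?s n)"
    by (rule card_large_tower_le) (use M W1 J1 s in auto)
  also have "\<dots> \<le> (J / W) powr ?s * (real n * exp (4 * \<tau> * prime_recip (real n) + 8))"
    by (intro mult_left_mono smooth_tower_moment_last_step[OF M n z0 z _ K G \<tau>])
       (use prime_factors_smooth_modulus in auto)
  finally show ?thesis .
qed

lemma card_square_exception_le:
  assumes "n \<ge> 1" "W > 0"
  shows "real (card {m\<in>{1..n}. real (square_part m) > W}) \<le> real n * (1 + ln (real n)) / W"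
proof -
  let ?R = "{w\<in>{1..n}. real w > W}"
  let ?C = "\<lambda>w. (\<lambda>l. w ^ 2 * l) ` {1..n div w ^ 2}"
  have "{m\<in>{1..n}. real (square_part m) > W} \<subseteq> (\<Union>w\<in>?R. ?C w)"
  proof
    fix m assume m: "m \<in> {m\<in>{1..n}. real (square_part m) > W}"
    let ?w = "square_part m"
    obtain l where l: "m = ?w ^ 2 * l" using square_part_square_dvd[of m] by (metis dvdE)
    have m0: "m > 0" "m \<le> n" using m by auto
    then have l0: "l > 0" and w0: "?w > 0" using l by (auto intro!: Nat.gr0I)
    have "l = m div ?w ^ 2" using l w0 by (metis nonzero_mult_div_cancel_left power_not_zero not_gr0)
    then have "l \<le> n div ?w ^ 2" using m0 by (simp add: div_le_mono)
    moreover have "?w \<le> n"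
    proof -
      have "?w dvd m" using square_part_square_dvd[of m] by (metis dvd_power dvd_trans pos2)
      then show ?thesis using m0 dvd_imp_le order_trans by blast
    qed
    ultimately have "?w \<in> ?R" "m \<in> ?C ?w" using m l l0 w0 by auto
    then show "m \<in> (\<Union>w\<in>?R. ?C w)" by blast
  qed
  then have "card {m\<in>{1..n}. real (square_part m) > W} \<le> card (\<Union>w\<in>?R. ?C w)"
    by (intro card_mono) auto
  also have "\<dots> \<le> (\<Sum>w\<in>?R. card (?C w))" by (rule card_UN_le) auto
  finally have "real (card {m\<in>{1..n}. real (square_part m) > W}) \<le> real (\<Sum>w\<in>?R. card (?C w))"
    by (rule of_nat_mono)
  also have "\<dots> = (\<Sum>w\<in>?R. real (card (?C w)))" by (rule of_nat_sum)
  also have "\<dots> \<le> (\<Sum>w\<in>?R. real n / W * (1 / real w))"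
  proof (rule sum_mono)
    fix w assume w: "w \<in> ?R"
    have "card (?C w) \<le> n div w ^ 2" using card_image_le[of "{1..n div w ^ 2}"] by simp
    then have "real (card (?C w)) \<le> real (n div w ^ 2)" by (simp only: of_nat_le_iff)
    also have "\<dots> \<le> real n / real (w ^ 2)" by (rule of_nat_div_le_of_nat)
    also have "\<dots> \<le> real n / (W * real w)"
      using w assms by (intro divide_left_mono) (auto simp: power2_eq_square)
    finally show "real (card (?C w)) \<le> real n / W * (1 / real w)" by simp
  qed
  also have "\<dots> = real n / W * (\<Sum>w\<in>?R. 1 / real w)" by (simp add: sum_distrib_left)
  also have "\<dots> \<le> real n / W * (1 + ln (real n))"
  proof (rule mult_left_mono)
    have "(\<Sum>w\<in>?R. 1 / real w) \<le> (\<Sum>w=1..n. 1 / real w)" by (intro sum_mono2) auto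
    then show "(\<Sum>w\<in>?R. 1 / real w) \<le> 1 + ln (real n)" using sum_inverse_nat_le[of n] assms by linarith
  qed (use assms in auto)
  finally show ?thesis by simp
qed

section \<open>Chains of prime sets\<close>

text \<open>
  The exceptional primes are handled by hypothesis, the primes up to $Z$ trivially. For $q > Z$ a
  factor $q^{\eta' - \eta}$ is split off; the rest is a sum over distinct integers $t(q) \le 2q$
  composed of primes of $R$, hence an Euler product. Here $t(q)$ stands for $q - 1$ or $q + 1$.
\<close>
lemma prime_sum_step:
  fixes \<eta> \<eta>' Z \<epsilon> :: real and t :: "nat \<Rightarrow> nat"
  assumes fin: "finite S" "finite E" "finite R" "\<forall>q\<in>R. prime q"
    and S: "\<forall>q\<in>S. prime q \<and> 0 < t q \<and> t q \<le> 2 * q \<and> (real q \<le> Z \<or> q \<in> E \<or> prime_factors (t q) \<subseteq> R)"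
    and inj: "inj_on t S"
    and eta: "0 \<le> \<eta>'" "\<eta>' \<le> \<eta>" "\<eta> \<le> 1/2" and Z: "Z \<ge> 1"
    and E: "(\<Sum>q\<in>E. real q powr (\<eta>' - 1)) \<le> \<epsilon>"
  shows "(\<Sum>q\<in>S. real q powr (\<eta>' - 1))
     \<le> Z powr \<eta>' * prime_recip Z + \<epsilon> +
        2 * Z powr (\<eta>' - \<eta>) * exp (4 * (\<Sum>q\<in>R. real q powr (\<eta> - 1)))"
proof -
  let ?f = "\<lambda>q. real q powr (\<eta>' - 1)"
  let ?A = "{q. prime q \<and> real q \<le> Z}"
  let ?C = "{q\<in>S. real q > Z \<and> prime_factors (t q) \<subseteq> R}"
  have "sum ?f S \<le> sum ?f (?A \<union> E \<union> ?C)"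
    by (rule sum_mono2) (use fin S in \<open>auto simp: not_le\<close>)
  also have "\<dots> \<le> sum ?f (?A \<union> E) + sum ?f ?C"
    using fin by (subst sum.union_inter[symmetric]) (auto simp: sum_nonneg)
  also have "sum ?f (?A \<union> E) \<le> sum ?f ?A + sum ?f E"
    using fin by (subst sum.union_inter[symmetric]) (auto simp: sum_nonneg)
  also have "sum ?f ?A \<le> (\<Sum>q\<in>?A. Z powr \<eta>' * (1 / real q))"
  proof (rule sum_mono)
    fix q assume "q \<in> ?A"
    then have q: "real q \<ge> 1" "real q \<le> Z" using prime_ge_1_nat[of q] by auto
    have "?f q = real q powr \<eta>' * (1 / real q)" using q by (simp add: powr_diff)
    also have "\<dots> \<le> Z powr \<eta>' * (1 / real q)" using q eta by (intro mult_right_mono powr_mono2) auto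
    finally show "?f q \<le> Z powr \<eta>' * (1 / real q)" .
  qed
  also have "\<dots> = Z powr \<eta>' * prime_recip Z" by (simp add: prime_recip_def sum_distrib_left)
  also have "sum ?f ?C \<le> (\<Sum>q\<in>?C. 2 * Z powr (\<eta>' - \<eta>) * real (t q) powr (\<eta> - 1))"
  proof (rule sum_mono)
    fix q assume q: "q \<in> ?C"
    then have q': "real q > Z" "t q > 0" "real (t q) \<le> 2 * real q" using S by (auto simp flip: of_nat_mult)
    have "?f q = real q powr (\<eta>' - \<eta>) * real q powr (\<eta> - 1)" by (simp flip: powr_add)
    also have "\<dots> \<le> Z powr (\<eta>' - \<eta>) * (2 * real (t q) powr (\<eta> - 1))"
    proof (rule mult_mono)
      show "real q powr (\<eta>' - \<eta>) \<le> Z powr (\<eta>' - \<eta>)" using q' eta Z by (intro powr_mono2') auto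
      have "real q powr (\<eta> - 1) \<le> (real (t q) / 2) powr (\<eta> - 1)"
        using q' eta by (intro powr_mono2') auto
      also have "\<dots> = real (t q) powr (\<eta> - 1) * (1 / 2 powr (\<eta> - 1))" by (simp add: powr_divide)
      also have "1 / 2 powr (\<eta> - 1) = 2 powr (1 - \<eta>)" by (simp add: powr_diff)
      also have "real (t q) powr (\<eta> - 1) * 2 powr (1 - \<eta>) \<le> real (t q) powr (\<eta> - 1) * 2 powr 1"
        using eta by (intro mult_left_mono powr_mono) auto
      finally show "real q powr (\<eta> - 1) \<le> 2 * real (t q) powr (\<eta> - 1)" by simp
    qed auto
    finally show "?f q \<le> 2 * Z powr (\<eta>' - \<eta>) * real (t q) powr (\<eta> - 1)" by simp
  qed
  also have "\<dots> = 2 * Z powr (\<eta>' - \<eta>) * (\<Sum>q\<in>?C. real (t q) powr (\<eta> - 1))"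
    by (simp add: sum_distrib_left)
  also have "(\<Sum>q\<in>?C. real (t q) powr (\<eta> - 1)) = (\<Sum>d\<in>t ` ?C. real d powr (\<eta> - 1))"
    by (subst sum.reindex) (use inj in \<open>auto intro: inj_on_subset\<close>)
  also have "\<dots> \<le> exp (4 * (\<Sum>q\<in>R. real q powr (\<eta> - 1)))"
  proof -
    have "(\<Sum>d\<in>t ` ?C. (\<Prod>p\<in>prime_factors d. 1) * real d powr -(1 - \<eta>))
       \<le> exp (4 * (\<Sum>p\<in>R. 1 * real p powr -(1 - \<eta>)))"
    proof (rule euler_exp_bound)
      show "\<forall>p\<in>R. real p powr - (1 - \<eta>) \<le> 3 / 4"
        using prime_powr_le_three_quarters[OF _ eta(3)] fin(4) by simp
    qed (use fin S eta in auto)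
    then show ?thesis by simp
  qed
  finally show ?thesis using E by (simp add: mult_left_mono)
qed

text \<open>
  The primes dividing $n$ beyond $\ln n$ are too few to matter, and the others are bounded by the
  sum over all primes up to $\ln n$.
\<close>
lemma prime_divisor_sum_le:
  fixes \<eta> :: real
  assumes n: "n \<ge> 1" and L: "L = ln (real n)" "L \<ge> 1" and eta: "0 \<le> \<eta>" "\<eta> \<le> 1"
    and S: "S \<subseteq> prime_factors n"
  shows "(\<Sum>q\<in>S. real q powr (\<eta> - 1)) \<le> L powr \<eta> * (prime_recip L + 2)"
proof -
  let ?A = "{q. prime q \<and> real q \<le> L}"
  have "(\<Sum>q\<in>S. real q powr (\<eta> - 1)) \<le> (\<Sum>q\<in>prime_factors n. real q powr (\<eta> - 1))"
    using S by (intro sum_mono2) auto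
  also have "\<dots> \<le> (\<Sum>q\<in>prime_factors n. L powr \<eta> * (if real q \<le> L then 1 / real q else 1 / L))"
  proof (rule sum_mono)
    fix q assume "q \<in> prime_factors n"
    then have q: "real q \<ge> 1" using prime_ge_1_nat[of q] by auto
    show "real q powr (\<eta> - 1) \<le> L powr \<eta> * (if real q \<le> L then 1 / real q else 1 / L)"
    proof (cases "real q \<le> L")
      case True
      have "real q powr \<eta> * (1 / real q) \<le> L powr \<eta> * (1 / real q)"
        using True q eta by (intro mult_right_mono powr_mono2) auto
      then show ?thesis using True q by (simp add: powr_diff)
    next
      case False
      have "real q powr (\<eta> - 1) \<le> L powr (\<eta> - 1)" using False L eta by (intro powr_mono2') auto
      then show ?thesis using False L by (simp add: powr_diff)
    qed
  qed
  also have "\<dots> = L powr \<eta> * (\<Sum>q\<in>prime_factors n. if real q \<le> L then 1 / real q else 1 / L)"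
    by (simp add: sum_distrib_left)
  also have "(\<Sum>q\<in>prime_factors n. if real q \<le> L then 1 / real q else 1 / L)
     \<le> (\<Sum>q\<in>prime_factors n. (if real q \<le> L then 1 / real q else 0) + 1 / L)"
    using L by (intro sum_mono) auto
  also have "\<dots> = (\<Sum>q\<in>prime_factors n. if real q \<le> L then 1 / real q else 0) + real (card (prime_factors n)) / L"
    by (simp add: sum.distrib)
  also have "(\<Sum>q\<in>prime_factors n. if real q \<le> L then 1 / real q else 0) \<le> prime_recip L"
  proof -
    have "(\<Sum>q\<in>prime_factors n. if real q \<le> L then 1 / real q else 0)
       = (\<Sum>q\<in>{q\<in>prime_factors n. real q \<le> L}. 1 / real q)"
      by (rule sum.inter_filter[symmetric]) simp
    also have "\<dots> \<le> prime_recip L" unfolding prime_recip_def by (intro sum_mono2) auto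
    finally show ?thesis .
  qed
  also have "real (card (prime_factors n)) / L \<le> 2"
    using card_prime_factors_le[OF n] L by (simp add: field_simps)
  finally show ?thesis by (simp add: mult_left_mono)
qed

text \<open>
  The sets $R_j$ are meant to contain the primes of the iterate $u_{k-j}$, so the index runs
  backwards from $n$. The function $t$ is the effect of the arithmetic function on primes. The
  sets $E_j$ collect the primes above $z$ whose square divides an iterate: no information on
  $t(q)$ is available for them, but there are few of them.
\<close>
definition prime_chain :: "nat \<Rightarrow> nat \<Rightarrow> real \<Rightarrow> (nat \<Rightarrow> nat) \<Rightarrow> (nat \<Rightarrow> nat set) \<Rightarrow> (nat \<Rightarrow> nat set) \<Rightarrow> bool" where
  "prime_chain k n z t R E \<longleftrightarrow>
     R 0 \<subseteq> prime_factors n \<and>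
     (\<forall>j<k. finite (R (Suc j)) \<and> inj_on t (R (Suc j)) \<and>
        finite (E j) \<and> real (card (E j)) \<le> 2 * ln (real n) \<and> (\<forall>q\<in>E j. real q > z) \<and>
        (\<forall>q\<in>R (Suc j). prime q \<and> 0 < t q \<and> t q \<le> 2 * q \<and>
           (real q \<le> z \<or> q \<in> E j \<or> prime_factors (t q) \<subseteq> R j)))"

lemma prime_chain_finite:
  assumes "prime_chain k n z t R E" "j \<le> k"
  shows "finite (R j)" "\<forall>q\<in>R j. prime q"
proof -
  have "finite (R j) \<and> (\<forall>q\<in>R j. prime q)"
  proof (cases j)
    case 0
    then show ?thesis using assms by (auto simp: prime_chain_def intro: finite_subset)
  next
    case (Suc i)
    then have "i < k" using assms by simp
    then show ?thesis using assms(1) Suc unfolding prime_chain_def by blast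
  qed
  then show "finite (R j)" "\<forall>q\<in>R j. prime q" by auto
qed

lemma exceptional_primes_sum_le:
  fixes \<eta> z :: real
  assumes "prime_chain k n z t R E" "j < k" "z \<ge> 1" "\<eta> \<le> 1/2"
    and few: "2 * ln (real n) * z powr (-1/2) \<le> 1"
  shows "(\<Sum>q\<in>E j. real q powr (\<eta> - 1)) \<le> 1"
proof -
  have E: "real (card (E j)) \<le> 2 * ln (real n)" "\<forall>q\<in>E j. real q > z"
    using assms by (auto simp: prime_chain_def)
  have "(\<Sum>q\<in>E j. real q powr (\<eta> - 1)) \<le> (\<Sum>q\<in>E j. z powr (-1/2))"
  proof (rule sum_mono)
    fix q assume "q \<in> E j"
    then have q: "real q > z" using E by auto
    have "real q powr (\<eta> - 1) \<le> real q powr (-1/2)" using q assms by (intro powr_mono) auto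
    also have "\<dots> \<le> z powr (-1/2)" using q assms by (intro powr_mono2') auto
    finally show "real q powr (\<eta> - 1) \<le> z powr (-1/2)" .
  qed
  also have "\<dots> = real (card (E j)) * z powr (-1/2)" by simp
  also have "\<dots> \<le> 2 * ln (real n) * z powr (-1/2)" using E by (intro mult_right_mono) auto
  finally show ?thesis using few by linarith
qed

lemma prime_chain_step:
  fixes \<eta> \<eta>' Z z :: real
  assumes ch: "prime_chain k n z t R E" and j: "j < k" and z: "1 \<le> z" "z \<le> Z"
    and few: "2 * ln (real n) * z powr (-1/2) \<le> 1"
    and eta: "0 \<le> \<eta>'" "\<eta>' \<le> \<eta>" "\<eta> \<le> 1/2"
    and B: "(\<Sum>q\<in>R j. real q powr (\<eta> - 1)) \<le> B"
  shows "(\<Sum>q\<in>R (Suc j). real q powr (\<eta>' - 1))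
     \<le> Z powr \<eta>' * prime_recip Z + 1 + 2 * Z powr (\<eta>' - \<eta>) * exp (4 * B)"
proof -
  have "(\<Sum>q\<in>R (Suc j). real q powr (\<eta>' - 1))
     \<le> Z powr \<eta>' * prime_recip Z + 1 +
        2 * Z powr (\<eta>' - \<eta>) * exp (4 * (\<Sum>q\<in>R j. real q powr (\<eta> - 1)))"
  proof (rule prime_sum_step[where E = "E j"])
    show "finite (R j)" "\<forall>q\<in>R j. prime q" using prime_chain_finite[OF ch, of j] j by auto
    show "(\<Sum>q\<in>E j. real q powr (\<eta>' - 1)) \<le> 1"
      by (rule exceptional_primes_sum_le[OF ch j]) (use assms in auto)
    show "\<forall>q\<in>R (Suc j). prime q \<and> 0 < t q \<and> t q \<le> 2 * q \<and> (real q \<le> Z \<or> q \<in> E j \<or> prime_factors (t q) \<subseteq> R j)"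
    proof
      fix q assume "q \<in> R (Suc j)"
      then have "prime q \<and> 0 < t q \<and> t q \<le> 2 * q \<and>
          (real q \<le> z \<or> q \<in> E j \<or> prime_factors (t q) \<subseteq> R j)"
        using ch j unfolding prime_chain_def by blast
      then show "prime q \<and> 0 < t q \<and> t q \<le> 2 * q \<and>
          (real q \<le> Z \<or> q \<in> E j \<or> prime_factors (t q) \<subseteq> R j)" using z by linarith
    qed
  qed (use assms in \<open>auto simp: prime_chain_def\<close>)
  also have "\<dots> \<le> Z powr \<eta>' * prime_recip Z + 1 + 2 * Z powr (\<eta>' - \<eta>) * exp (4 * B)"
    using B by (intro add_left_mono mult_left_mono) auto
  finally show ?thesis .
qed

lemma exp_le_3: "exp (x::real) \<le> 3" if "x \<le> 1"
proof -
  have "exp x \<le> exp 1" using that by simp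
  then show ?thesis using exp_le by linarith
qed

text \<open>
  Here $l = L_3$, so that $L_2 = e^l$. With $\eta_j = 1 / (L_2 l^{2j})$ the choice $Z = \exp(L_2
  l^{2j} l^{3/2})$ lies between two constraints: $Z^{\eta_{j+1}}$ stays bounded, while $Z^{\eta_j}
  = \exp(l^{3/2})$ exceeds $\exp(4 \cdot 36 l)$, the bound for the preceding Euler product. The
  threshold $288^2$ makes $\sqrt{l} / 2$ at least $4 \cdot 36$.
\<close>
lemma prime_chain_sum_le:
  fixes A l :: real
  assumes n: "n \<ge> 1" "ln (real n) = exp (exp l)" and A: "4 \<le> A" "A \<le> l" and l: "l \<ge> 288 ^ 2"
    and big: "l ^ (2 * k + 3) \<le> exp l"
    and ch: "prime_chain k n (exp (A * exp l)) t R E"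
  shows "j \<le> k \<Longrightarrow> (\<Sum>q\<in>R j. real q powr (1 / (exp l * l ^ (2 * j)) - 1)) \<le> 36 * l"
proof (induction j)
  case 0
  have l0: "l \<ge> 1" using l by simp
  have "(\<Sum>q\<in>R 0. real q powr (1 / exp l - 1))
      \<le> exp (exp l) powr (1 / exp l) * (prime_recip (exp (exp l)) + 2)"
    by (rule prime_divisor_sum_le[of n]) (use n ch l0 in \<open>auto simp: prime_chain_def\<close>)
  also have "exp (exp l) powr (1 / exp l) = exp 1" by (simp add: powr_def)
  also have "exp 1 * (prime_recip (exp (exp l)) + 2) \<le> 3 * (12 * l)"
  proof (rule mult_mono)
    have "prime_recip (exp (exp l)) \<le> 6 + 2 * ln (1 + exp l)" using prime_recip_le[of "exp (exp l)"] by simp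
    also have "ln (1 + exp l) \<le> ln (exp (l + 1))"
    proof -
      have "1 + exp l \<le> exp l * exp 1"
      proof -
        have "exp l * 2 \<le> exp l * exp 1"
          using exp_ge_add_one_self[of "1::real"] by (intro mult_left_mono) auto
        moreover have "1 \<le> exp l" using l0 by simp
        ultimately show ?thesis by linarith
      qed
      then show ?thesis by (subst ln_le_cancel_iff) (auto simp: exp_add add_pos_pos)
    qed
    finally show "prime_recip (exp (exp l)) + 2 \<le> 12 * l" using l0 by simp
  qed (use prime_recip_nonneg[of "exp (exp l)"] exp_le in auto)
  finally show ?case by simp
next
  case (Suc j)
  have l0: "l \<ge> 1" using l by simp
  have lj: "l ^ i \<ge> 1" for i using l0 by (simp add: one_le_power)
  let ?e = "\<lambda>j. 1 / (exp l * l ^ (2 * j))"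
  define Z where "Z = exp (exp l * l ^ (2 * j) * (l * sqrt l))"
  have sq: "sqrt l \<ge> 288" "sqrt l \<le> l" "sqrt l * sqrt l = l"
  proof -
    show "sqrt l \<ge> 288" using l by (rule real_le_rsqrt)
    show "sqrt l * sqrt l = l" using l0 by simp
    have "l * 1 \<le> l * l" using l0 by (intro mult_left_mono) auto
    then show "sqrt l \<le> l" using l0 by (intro real_le_lsqrt) (auto simp: power2_eq_square)
  qed
  have e1: "?e (Suc j) = ?e j / l ^ 2" by (simp add: field_simps power2_eq_square)
  have ej: "0 < ?e j" using l0 by simp
  have e2: "?e (Suc j) \<le> ?e j / 2"
  proof -
    have "2 * 1 \<le> l * l" using l l0 by (intro mult_mono) auto
    then have "2 \<le> l ^ 2" by (simp add: power2_eq_square)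
    then show ?thesis unfolding e1 using ej l0 by (intro divide_left_mono) auto
  qed
  have e3: "?e j \<le> 1/2"
  proof -
    have "2 \<le> exp l" using exp_ge_add_one_self[of l] l0 by linarith
    also have "exp l * 1 \<le> exp l * l ^ (2 * j)" using lj by (intro mult_left_mono) auto
    finally have "2 \<le> exp l * l ^ (2 * j)" by simp
    then show ?thesis using frac_le[of 1 1 2 "exp l * l ^ (2 * j)"] by simp
  qed
  have few: "2 * ln (real n) * exp (A * exp l) powr (-1/2) \<le> 1"
  proof -
    have "2 * ln (real n) * exp (A * exp l) powr (-1/2) = 2 * exp (exp l - A * exp l / 2)"
      by (simp add: n powr_def flip: exp_add)
    also have "\<dots> \<le> 2 * exp (- 1)"
    proof -
      have "exp l * 1 \<le> exp l * (A / 2 - 1)" using A by (intro mult_left_mono) auto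
      then have "exp l - A * exp l / 2 \<le> - exp l" by (simp add: algebra_simps)
      also have "\<dots> \<le> -1" using l0 by simp
      finally show ?thesis by simp
    qed
    also have "\<dots> \<le> 1" using exp_ge_add_one_self[of "1::real"] by (simp add: exp_minus field_simps)
    finally show ?thesis .
  qed
  have zZ: "exp (A * exp l) \<le> Z"
  proof -
    have "l * 1 \<le> l * sqrt l" using sq l0 by (intro mult_left_mono) auto
    moreover have "1 * (l * sqrt l) \<le> l ^ (2 * j) * (l * sqrt l)"
      using lj[of "2 * j"] l0 by (intro mult_right_mono) auto
    ultimately have "A \<le> l ^ (2 * j) * (l * sqrt l)" using A by linarith
    then have "exp l * A \<le> exp l * (l ^ (2 * j) * (l * sqrt l))" by (intro mult_left_mono) auto
    then show ?thesis unfolding Z_def by (simp add: mult_ac)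
  qed
  have Zp: "Z powr x = exp (x * (exp l * l ^ (2 * j) * (l * sqrt l)))" for x
    by (simp add: Z_def powr_def)
  have main: "(\<Sum>q\<in>R (Suc j). real q powr (?e (Suc j) - 1))
     \<le> Z powr ?e (Suc j) * prime_recip Z + 1 + 2 * Z powr (?e (Suc j) - ?e j) * exp (4 * (36 * l))"
  proof (rule prime_chain_step[OF ch])
    have "x / 2 \<le> x" if "0 < x" for x :: real using that by simp
    then show "?e (Suc j) \<le> ?e j" using e2 ej order_trans by blast
    show "(\<Sum>q\<in>R j. real q powr (?e j - 1)) \<le> 36 * l" using Suc by simp
    show "0 \<le> ?e (Suc j)" using l0 by simp
  qed (use Suc.prems e3 few zZ A in auto)
  have f1: "Z powr ?e (Suc j) \<le> 3"
  proof -
    have "Z powr ?e (Suc j) = exp (sqrt l / l)"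
    proof -
      have "?e j / l ^ 2 * (exp l * l ^ (2 * j) * (l * sqrt l)) = sqrt l / l"
        using l0 by (simp add: field_simps power2_eq_square)
      then show ?thesis unfolding Zp e1 by simp
    qed
    also have "\<dots> \<le> 3" using sq l0 by (intro exp_le_3) (simp add: divide_le_eq)
    finally show ?thesis .
  qed
  have f2: "prime_recip Z \<le> 10 * l"
  proof -
    have "prime_recip Z \<le> 6 + 2 * ln (1 + exp l * l ^ (2 * j) * (l * sqrt l))"
      using prime_recip_le[of Z] l0 by (simp add: Z_def)
    also have "ln (1 + exp l * l ^ (2 * j) * (l * sqrt l)) \<le> ln (exp (2 * l + 1))"
    proof -
      have "l ^ (2 * j) * (l * sqrt l) \<le> l ^ (2 * j) * (l * l)"
        using sq l0 lj[of "2 * j"] by (intro mult_left_mono) auto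
      also have "\<dots> = l ^ (2 * j + 2)" by (simp add: power_add power2_eq_square)
      also have "\<dots> \<le> l ^ (2 * k + 3)" using Suc.prems l0 by (intro power_increasing) auto
      also have "\<dots> \<le> exp l" by (rule big)
      finally have "exp l * (l ^ (2 * j) * (l * sqrt l)) \<le> exp l * exp l" by (intro mult_left_mono) auto
      moreover have "exp l * exp l = exp (2 * l)" by (simp flip: exp_add)
      moreover have "exp l * l ^ (2 * j) * (l * sqrt l) = exp l * (l ^ (2 * j) * (l * sqrt l))"
        by (rule mult.assoc)
      ultimately have "1 + exp l * l ^ (2 * j) * (l * sqrt l) \<le> 1 + exp (2 * l)" by linarith
      also have "\<dots> \<le> exp (2 * l) * exp 1"
      proof -
        have "exp (2 * l) * 2 \<le> exp (2 * l) * exp 1"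
          using exp_ge_add_one_self[of "1::real"] by (intro mult_left_mono) auto
        moreover have "1 \<le> exp (2 * l)" using l0 by simp
        ultimately show ?thesis by linarith
      qed
      also have "\<dots> = exp (2 * l + 1)" by (simp add: exp_add)
      finally have le: "1 + exp l * l ^ (2 * j) * (l * sqrt l) \<le> exp (2 * l + 1)" .
      have "0 \<le> exp l * l ^ (2 * j) * (l * sqrt l)" using l0 by (intro mult_nonneg_nonneg) auto
      then have "0 < 1 + exp l * l ^ (2 * j) * (l * sqrt l)" by linarith
      then show ?thesis using le by (intro ln_mono)
    qed
    finally show ?thesis using l by simp
  qed
  have f3: "2 * Z powr (?e (Suc j) - ?e j) * exp (4 * (36 * l)) \<le> 2"
  proof -
    have "Z powr (?e (Suc j) - ?e j) \<le> Z powr (- (?e j / 2))"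
    proof (rule powr_mono)
      show "1 \<le> Z" using zZ A by (simp add: order_trans[OF _ zZ])
      have "y - x \<le> - (x / 2)" if "y \<le> x / 2" for x y :: real using that by simp
      then show "?e (Suc j) - ?e j \<le> - (?e j / 2)" using e2 by blast
    qed
    also have "\<dots> = exp (- (l * sqrt l / 2))"
    proof -
      have "- (?e j / 2) * (exp l * l ^ (2 * j) * (l * sqrt l)) = - (l * sqrt l / 2)"
        using l0 by (simp add: field_simps)
      then show ?thesis unfolding Zp by simp
    qed
    also have "\<dots> \<le> exp (- (144 * l))"
    proof -
      have "l * 288 \<le> l * sqrt l" using sq l0 by (intro mult_left_mono) auto
      then show ?thesis by simp
    qed
    finally have "Z powr (?e (Suc j) - ?e j) * exp (144 * l) \<le> exp (- (144 * l)) * exp (144 * l)"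
      by (intro mult_right_mono) auto
    then show ?thesis by (simp flip: exp_add)
  qed
  \<comment> \<open>The three terms are at most $30 l$, 1 and 2.\<close>
  have f12: "Z powr ?e (Suc j) * prime_recip Z \<le> 3 * (10 * l)"
    by (rule mult_mono[OF f1 f2]) (use prime_recip_nonneg in auto)
  have "s \<le> 36 * l" if "a \<le> 3 * (10 * l)" "s \<le> a + 1 + b" "b \<le> 2" for s a b
    using that l0 by linarith
  from this[OF f12 main f3] show ?case .
qed

section \<open>Fibres with prescribed rough square divisors\<close>

text \<open>
  Rankin's trick: each $m \le x$ is counted with weight $(x/m)^{1-\eta} \ge 1$.
\<close>
lemma card_le_powr_exp:
  fixes \<eta> x :: real
  assumes "finite S" and S: "\<forall>m\<in>S. 0 < m \<and> real m \<le> x \<and> prime_factors m \<subseteq> R"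
    and R: "finite R" "\<forall>p\<in>R. prime p" and eta: "0 \<le> \<eta>" "\<eta> \<le> 1/2"
  shows "real (card S) \<le> x powr (1 - \<eta>) * exp (4 * (\<Sum>p\<in>R. real p powr (\<eta> - 1)))"
proof -
  have "real (card S) = (\<Sum>m\<in>S. 1)" by simp
  also have "\<dots> \<le> (\<Sum>m\<in>S. x powr (1 - \<eta>) * real m powr (\<eta> - 1))"
  proof (rule sum_mono)
    fix m assume "m \<in> S"
    then have m: "real m > 0" "real m \<le> x" using S by auto
    have "1 = real m powr (1 - \<eta>) * real m powr (\<eta> - 1)" using m by (simp flip: powr_add)
    also have "\<dots> \<le> x powr (1 - \<eta>) * real m powr (\<eta> - 1)"
      using m eta by (intro mult_right_mono powr_mono2) auto
    finally show "1 \<le> x powr (1 - \<eta>) * real m powr (\<eta> - 1)" .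
  qed
  also have "\<dots> = x powr (1 - \<eta>) * (\<Sum>m\<in>S. real m powr (\<eta> - 1))" by (simp add: sum_distrib_left)
  also have "\<dots> \<le> x powr (1 - \<eta>) * exp (4 * (\<Sum>p\<in>R. real p powr (\<eta> - 1)))"
  proof (rule mult_left_mono)
    have "(\<Sum>m\<in>S. (\<Prod>p\<in>prime_factors m. 1) * real m powr -(1 - \<eta>))
       \<le> exp (4 * (\<Sum>p\<in>R. 1 * real p powr -(1 - \<eta>)))"
    proof (rule euler_exp_bound)
      show "\<forall>p\<in>R. real p powr - (1 - \<eta>) \<le> 3 / 4"
        using prime_powr_le_three_quarters[OF _ eta(2)] R(2) by simp
    qed (use assms in auto)
    then show "(\<Sum>m\<in>S. real m powr (\<eta> - 1)) \<le> exp (4 * (\<Sum>p\<in>R. real p powr (\<eta> - 1)))" by simp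
  qed simp
  finally show ?thesis .
qed

lemma prime_factors_mono_dvd: "a dvd b \<Longrightarrow> b > 0 \<Longrightarrow> prime_factors a \<subseteq> prime_factors (b::nat)"
  by (rule dvd_prime_factors) auto

lemma totient_iterate_pos: "m > 0 \<Longrightarrow> (totient ^^ i) m > 0"
  by (induction i) auto

lemma prime_chain_totient:
  fixes k n :: nat
  defines "S \<equiv> {m. m > 0 \<and> (totient ^^ k) m = n}"
  assumes n: "n \<ge> 1"
  shows "prime_chain k n z (\<lambda>q. q - 1) (\<lambda>j. \<Union>m\<in>S. prime_factors ((totient ^^ (k - j)) m)) (\<lambda>_. {})"
proof -
  let ?R = "\<lambda>j. \<Union>m\<in>S. prime_factors ((totient ^^ (k - j)) m)"
  have fin: "finite S" unfolding S_def by (rule finite_iter_preimage) simp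
  have pr: "prime q" if "q \<in> ?R j" for q j using that by auto
  have step: "prime_factors (q - 1) \<subseteq> ?R j" if j: "j < k" and q: "q \<in> ?R (Suc j)" for q j
  proof -
    obtain m where m: "m \<in> S" "q \<in> prime_factors ((totient ^^ (k - Suc j)) m)" using q by auto
    let ?u = "(totient ^^ (k - Suc j)) m"
    have eq: "(totient ^^ (k - j)) m = totient ?u" using j
      by (metis Suc_diff_Suc comp_apply funpow.simps(2))
    have u0: "?u > 0" using m totient_iterate_pos by (simp add: S_def)
    have "totient q dvd totient ?u" using m by (intro totient_dvd) auto
    moreover have "totient q = q - 1" using m(2) by (intro totient_prime) auto
    ultimately have "q - 1 dvd totient ?u" by metis
    then have "prime_factors (q - 1) \<subseteq> prime_factors (totient ?u)"
      using u0 by (intro prime_factors_mono_dvd) auto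
    then have "prime_factors (q - 1) \<subseteq> prime_factors ((totient ^^ (k - j)) m)"
      unfolding eq .
    then show ?thesis using m(1) by blast
  qed
  have R0: "?R 0 \<subseteq> prime_factors n" by (auto simp: S_def)
  show ?thesis unfolding prime_chain_def
  proof (intro conjI allI impI ballI)
    show "?R 0 \<subseteq> prime_factors n" by (rule R0)
    fix j assume j: "j < k"
    show "finite (?R (Suc j))" using fin by auto
    show "inj_on (\<lambda>q. q - 1) (?R (Suc j))"
    proof (rule inj_onI)
      fix x y assume "x \<in> ?R (Suc j)" "y \<in> ?R (Suc j)" "x - 1 = y - 1"
      then show "x = y" using pr[of x "Suc j"] pr[of y "Suc j"] prime_ge_2_nat[of x] prime_ge_2_nat[of y] by linarith
    qed
    show "finite {}" "real (card {}) \<le> 2 * ln (real n)" using n by auto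
    show "real q > z" if "q \<in> {}" for q :: nat using that by simp
    fix q assume q: "q \<in> ?R (Suc j)"
    show "prime q" by (rule pr[OF q])
    then show "0 < q - 1" "q - 1 \<le> 2 * q" using prime_ge_2_nat[of q] by auto
    show "real q \<le> z \<or> q \<in> {} \<or> prime_factors (q - 1) \<subseteq> ?R j" using step[OF j q] by blast
  qed
qed

lemma prime_exactly_dividing:
  assumes "prime q" "q dvd u" "\<not> q ^ 2 dvd u" "u > 0"
  shows "q + 1 dvd sum_of_divisors u"
proof -
  obtain v where v: "u = q * v" using assms(2) by (auto elim: dvdE)
  have "\<not> q dvd v" using assms(3) v by (auto simp: power2_eq_square)
  then have "coprime q v" using assms(1) by (simp add: prime_imp_coprime)
  then have "sum_of_divisors u = sum_of_divisors q * sum_of_divisors v"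
    unfolding v using assms v by (intro sum_of_divisors_mult) (auto intro!: Nat.gr0I)
  then show ?thesis using sum_of_divisors_prime[OF assms(1)] by (metis dvd_triv_left)
qed

lemma sum_of_divisors_iterate_mono:
  assumes "m > 0" "i \<le> k"
  shows "(sum_of_divisors ^^ i) m \<le> (sum_of_divisors ^^ k) m"
  using assms(2)
proof (induction k rule: dec_induct)
  case (step k)
  then show ?case
    using le_sum_of_divisors[OF sum_of_divisors_iterate_pos[OF assms(1), of k]] by simp
qed simp

text \<open>
  On a fibre on which all rough roots are prescribed, the exceptional primes of the chain are
  those of the prescribed values: a prime $q > z$ divides an iterate exactly once, or it divides
  the rough root.
\<close>
lemma prime_chain_sum_of_divisors:
  fixes k n :: nat and z :: real and w :: "nat \<Rightarrow> nat"
  defines "S \<equiv> {m. m > 0 \<and> (sum_of_divisors ^^ k) m = n \<and>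
      (\<forall>i<k. rough_root z ((sum_of_divisors ^^ i) m) = w i)}"
  assumes n: "n \<ge> 1" and ne: "S \<noteq> {}"
  shows "prime_chain k n z (\<lambda>q. q + 1) (\<lambda>j. \<Union>m\<in>S. prime_factors ((sum_of_divisors ^^ (k - j)) m))
     (\<lambda>j. prime_factors (w (k - Suc j)))"
proof -
  let ?R = "\<lambda>j. \<Union>m\<in>S. prime_factors ((sum_of_divisors ^^ (k - j)) m)"
  have fin: "finite S"
    by (rule finite_subset[OF _ finite_iter_preimage[of sum_of_divisors k n]]) (auto simp: S_def)
  have pr: "prime q" if "q \<in> ?R j" for q j using that by auto
  have step: "real q \<le> z \<or> q \<in> prime_factors (w (k - Suc j)) \<or> prime_factors (q + 1) \<subseteq> ?R j"
    if j: "j < k" and q: "q \<in> ?R (Suc j)" for q j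
  proof -
    obtain m where m: "m \<in> S" "q \<in> prime_factors ((sum_of_divisors ^^ (k - Suc j)) m)" using q by auto
    let ?u = "(sum_of_divisors ^^ (k - Suc j)) m"
    have u0: "?u > 0" using m sum_of_divisors_iterate_pos by (simp add: S_def)
    have qp: "prime q" "q dvd ?u" using m by auto
    have w: "rough_root z ?u = w (k - Suc j)" using m(1) j by (simp add: S_def)
    have eq: "(sum_of_divisors ^^ (k - j)) m = sum_of_divisors ?u" using j
      by (metis Suc_diff_Suc comp_apply funpow.simps(2))
    consider "real q \<le> z" | "real q > z" "q ^ 2 dvd ?u" | "\<not> q ^ 2 dvd ?u" by linarith
    then show ?thesis
    proof cases
      case 2
      then have "q dvd w (k - Suc j)" using square_dvd_imp_dvd_rough_root[OF u0 qp(1), of z] w by metis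
      moreover have "w (k - Suc j) > 0" using rough_root_pos[of z ?u] w by simp
      ultimately show ?thesis using qp by (auto simp: in_prime_factors_iff)
    next
      case 3
      then have "q + 1 dvd sum_of_divisors ?u" using prime_exactly_dividing[OF qp _ u0] by simp
      then have "prime_factors (q + 1) \<subseteq> prime_factors (sum_of_divisors ?u)"
        by (intro prime_factors_mono_dvd sum_of_divisors_pos[OF u0])
      then have "prime_factors (q + 1) \<subseteq> prime_factors ((sum_of_divisors ^^ (k - j)) m)"
        unfolding eq .
      then show ?thesis using m(1) by blast
    qed simp
  qed
  have R0: "?R 0 \<subseteq> prime_factors n" by (auto simp: S_def)
  have w: "w i > 0" "w i \<le> n" "\<forall>q\<in>prime_factors (w i). real q > z" if i: "i < k" for i
  proof -
    obtain m where m: "m \<in> S" using ne by auto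
    let ?u = "(sum_of_divisors ^^ i) m"
    have u0: "?u > 0" using m sum_of_divisors_iterate_pos by (simp add: S_def)
    have wi: "rough_root z ?u = w i" using m i by (simp add: S_def)
    show "w i > 0" using rough_root_pos[of z ?u] wi by simp
    have "w i dvd ?u" using rough_root_square_dvd[OF u0, of z] wi by (metis dvd_power dvd_trans pos2)
    then have "w i \<le> ?u" using u0 by (rule dvd_imp_le)
    also have "?u \<le> n" using sum_of_divisors_iterate_mono[of m i k] m i by (simp add: S_def)
    finally show "w i \<le> n" .
    show "\<forall>q\<in>prime_factors (w i). real q > z" using prime_factors_rough_root[of _ z ?u] wi by simp
  qed
  show ?thesis unfolding prime_chain_def
  proof (intro conjI allI impI ballI)
    show "?R 0 \<subseteq> prime_factors n" by (rule R0)
    fix j assume j: "j < k"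
    then have jk: "k - Suc j < k" by simp
    show "finite (?R (Suc j))" using fin by auto
    show "inj_on (\<lambda>q. q + 1) (?R (Suc j))" by (rule inj_onI) simp
    show "finite (prime_factors (w (k - Suc j)))" by simp
    have "real (card (prime_factors (w (k - Suc j)))) \<le> 2 * ln (real (w (k - Suc j)))"
      using w(1)[OF jk] by (intro card_prime_factors_le) simp
    also have "\<dots> \<le> 2 * ln (real n)" using w(1,2)[OF jk] by simp
    finally show "real (card (prime_factors (w (k - Suc j)))) \<le> 2 * ln (real n)" .
    show "real q > z" if "q \<in> prime_factors (w (k - Suc j))" for q using that w(3)[OF jk] by blast
    fix q assume q: "q \<in> ?R (Suc j)"
    show "prime q" by (rule pr[OF q])
    then show "0 < q + 1" "q + 1 \<le> 2 * q" using prime_ge_2_nat[of q] by auto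
    show "real q \<le> z \<or> q \<in> prime_factors (w (k - Suc j)) \<or> prime_factors (q + 1) \<subseteq> ?R j"
      by (rule step[OF j q])
  qed
qed

lemma card_bounded_rough_roots_le:
  fixes W b z :: real
  assumes W: "W \<ge> 1" and b: "b \<ge> 0"
    and fibre: "\<And>w. real (card {m. m > 0 \<and> (sum_of_divisors ^^ k) m = n \<and>
      (\<forall>i<k. rough_root z ((sum_of_divisors ^^ i) m) = w i)}) \<le> b"
  shows "real (card {m. m > 0 \<and> (sum_of_divisors ^^ k) m = n \<and>
      (\<forall>i<k. real (rough_root z ((sum_of_divisors ^^ i) m)) \<le> W)}) \<le> W ^ k * b"
proof -
  let ?r = "\<lambda>i m. rough_root z ((sum_of_divisors ^^ i) m)"
  let ?S = "{m. m > 0 \<and> (sum_of_divisors ^^ k) m = n \<and> (\<forall>i<k. real (?r i m) \<le> W)}"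
  let ?F = "\<lambda>w. {m. m > 0 \<and> (sum_of_divisors ^^ k) m = n \<and> (\<forall>i<k. ?r i m = w i)}"
  let ?N = "nat \<lfloor>W\<rfloor>"
  let ?P = "PiE {..<k} (\<lambda>_. {1..?N})"
  have finP: "finite ?P" by (intro finite_PiE) auto
  have finF: "finite (?F w)" for w
    by (rule finite_subset[OF _ finite_iter_preimage[of sum_of_divisors k n]]) auto
  have "?S \<subseteq> (\<Union>w\<in>?P. ?F w)"
  proof
    fix m assume m: "m \<in> ?S"
    \<comment> \<open>Restriction to the indices below $k$ puts the vector into a finite product of intervals.\<close>
    let ?w = "restrict (\<lambda>i. ?r i m) {..<k}"
    have "?w \<in> ?P"
    proof (rule PiE_I)
      fix i assume "i \<in> {..<k}"
      then show "?w i \<in> {1..?N}" using m rough_root_pos[of z] by (auto simp: le_nat_floor Suc_le_eq)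
    qed auto
    moreover have "m \<in> ?F ?w" using m by auto
    ultimately show "m \<in> (\<Union>w\<in>?P. ?F w)" by blast
  qed
  then have "card ?S \<le> card (\<Union>w\<in>?P. ?F w)" using finP finF by (intro card_mono) auto
  also have "\<dots> \<le> (\<Sum>w\<in>?P. card (?F w))" by (rule card_UN_le[OF finP])
  finally have "real (card ?S) \<le> real (\<Sum>w\<in>?P. card (?F w))" by (rule of_nat_mono)
  also have "\<dots> = (\<Sum>w\<in>?P. real (card (?F w)))" by (rule of_nat_sum)
  also have "\<dots> \<le> (\<Sum>w\<in>?P. b)" by (rule sum_mono) (rule fibre)
  also have "\<dots> = real ?N ^ k * b" by (simp add: card_PiE)
  also have "\<dots> \<le> W ^ k * b" using W b by (intro mult_right_mono power_mono) auto
  finally show ?thesis .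
qed

text \<open>
  If $m$ avoids the exceptional sets, then induction on $i$ bounds the square parts of the
  iterates before the $i$-th one, and only under such a bound are the next exceptional sets known
  to be small. The square part of $u_i$ enters only if $i + 1 < k$; so smooth parts are controlled
  for $1 \le i \le k - 2$, while for $i = 0$ the plain count of $m$ with a large square divisor is
  used.
\<close>
lemma sum_of_divisors_preimage_cover:
  fixes W :: "nat \<Rightarrow> real" and z :: real and k n :: nat
  defines "u \<equiv> \<lambda>i m. (sum_of_divisors ^^ i) m"
  defines "X \<equiv> \<lambda>i. if i = 0 then 1 else W (i - 1) ^ 2"
  defines "rough \<equiv> \<lambda>i. {m\<in>{1..n}. u i m \<le> n \<and> (\<forall>t<i. real (square_part (u t m)) \<le> X i) \<and>
              real (rough_root z (u i m)) > W i}"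
  defines "smooth \<equiv> \<lambda>i. {m\<in>{1..n}. u i m \<le> n \<and> (\<forall>t<i. real (square_part (u t m)) \<le> X i) \<and>
              real (smooth_root z (u i m)) > W i}"
  assumes W: "\<And>i. W i \<ge> 1" "mono W"
  shows "{m. m > 0 \<and> u k m = n} \<subseteq>
     {m. m > 0 \<and> u k m = n \<and> (\<forall>i<k. real (rough_root z (u i m)) \<le> W (k - 1))} \<union>
     (\<Union>i<k. rough i) \<union> {m\<in>{1..n}. real (square_part m) > W 0} \<union> (\<Union>i<k - 2. smooth (Suc i))"
proof
  fix m assume m: "m \<in> {m. m > 0 \<and> u k m = n}"
  show "m \<in> {m. m > 0 \<and> u k m = n \<and> (\<forall>i<k. real (rough_root z (u i m)) \<le> W (k - 1))} \<union>
     (\<Union>i<k. rough i) \<union> {m\<in>{1..n}. real (square_part m) > W 0} \<union> (\<Union>i<k - 2. smooth (Suc i))"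
  proof (rule ccontr)
    assume not: "\<not> ?thesis"
    have un: "u i m \<le> n" "u i m > 0" if "i \<le> k" for i
      using m sum_of_divisors_iterate_mono[of m i k] sum_of_divisors_iterate_pos[of m i] that by (auto simp: u_def)
    have m1: "m \<in> {1..n}" using un[of 0] m by (auto simp: u_def)
    have W2: "W i \<le> W i ^ 2" for i using W(1)[of i] mult_left_mono[of 1 "W i" "W i"] by (simp add: power2_eq_square)
    have X: "X i \<le> W i ^ 2" for i
    proof (cases i)
      case 0
      then show ?thesis using W(1)[of 0] by (simp add: X_def one_le_power)
    next
      case (Suc j)
      have "W j \<le> W i" using W(2) Suc by (simp add: mono_def)
      then show ?thesis using Suc W(1)[of j] by (simp add: X_def power_mono)
    qed
    have sq: "i < k \<Longrightarrow> \<forall>t<i. real (square_part (u t m)) \<le> X i" for i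
    proof (induction i)
      case (Suc i)
      have IH: "\<forall>t<i. real (square_part (u t m)) \<le> X i" using Suc by simp
      have XS: "X (Suc i) = W i ^ 2" by (simp add: X_def)
      have "real (square_part (u i m)) \<le> W i ^ 2"
      proof (cases i)
        case 0
        have "real (square_part m) \<le> W 0" using not m1 by force
        then show ?thesis using 0 W2[of 0] by (simp add: u_def)
      next
        case (Suc j)
        have r: "real (rough_root z (u i m)) \<le> W i"
        proof (rule ccontr)
          assume "\<not> ?thesis"
          then have "m \<in> rough i" using IH m1 un[of i] Suc.prems unfolding rough_def by auto
          then show False using not Suc.prems by (meson Suc_lessD UN_I UnI1 UnI2 lessThan_iff)
        qed
        have s: "real (smooth_root z (u i m)) \<le> W i"
        proof (rule ccontr)
          assume "\<not> ?thesis"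
          then have "m \<in> smooth (Suc j)" using IH m1 un[of i] Suc Suc.prems unfolding smooth_def by auto
          moreover have "j < k - 2" using Suc Suc.prems by linarith
          ultimately show False using not by blast
        qed
        have "real (square_part (u i m)) = real (rough_root z (u i m)) * real (smooth_root z (u i m))"
          using square_part_eq_rough_smooth[OF un(2)[of i], of z] Suc.prems by simp
        also have "\<dots> \<le> W i * W i" using r s W(1)[of i] by (intro mult_mono) auto
        finally show ?thesis by (simp add: power2_eq_square)
      qed
      then show ?case using IH X[of i] XS by (auto simp: less_Suc_eq intro: order_trans)
    qed simp
    have "real (rough_root z (u i m)) \<le> W (k - 1)" if "i < k" for i
    proof -
      have "real (rough_root z (u i m)) \<le> W i"
      proof (rule ccontr)
        assume "\<not> ?thesis"
        then have "m \<in> rough i" using sq[OF that] m1 un[of i] that unfolding rough_def by auto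
        then show False using not that by (meson UN_I UnI1 UnI2 lessThan_iff)
      qed
      also have "\<dots> \<le> W (k - 1)" using W(2) that by (simp add: mono_def)
      finally show ?thesis .
    qed
    then show False using not m by blast
  qed
qed

section \<open>Counting preimages under iterated sums of divisors\<close>
lemma ln_one_plus_exp_le: "ln (1 + exp x) \<le> x + 1" if "x \<ge> 0" for x :: real
proof -
  have "exp x * 2 \<le> exp x * exp 1" using exp_ge_add_one_self[of "1::real"] by (intro mult_left_mono) auto
  moreover have "1 \<le> exp x" using that by simp
  ultimately have "1 + exp x \<le> exp (x + 1)" unfolding exp_add by linarith
  then have "ln (1 + exp x) \<le> ln (exp (x + 1))" by (intro ln_mono) (auto simp: add_pos_pos)
  then show ?thesis by simp
qed

lemma one_plus_exp_le: "1 + exp x \<le> exp (2 * x)" if "x \<ge> 1" for x :: real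
proof -
  have "2 \<le> exp x" using exp_ge_add_one_self[of x] that by linarith
  then have "exp x * 2 \<le> exp x * exp x" by (intro mult_left_mono) auto
  moreover have "1 \<le> exp x" using that by simp
  moreover have "exp (2 * x) = exp x * exp x" by (simp flip: exp_add)
  ultimately show ?thesis by linarith
qed

lemma exp_minus_mult: "exp (- x) * (r * exp y) = r * exp (y - x)" for x y r :: real
  by (simp add: exp_diff exp_minus field_simps)

text \<open>
  In terms of $L = \ln \ln n$, the roughness bound is $z = \exp(320 k L)$ and the iterated moments
  are bounded by $G = \exp(40 L)$; the factor 320 makes $z^{1/(8k)}$ equal to $G$. The thresholds
  are $W_i = \exp(\kappa C^i)$: each is the $C$-th power of its predecessor, and $C = 4 \cdot 12
  \cdot 2^k$ is so large that the loss from the square parts of the earlier iterates is at most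
  $W_i^{1/4}$. The four summands bound the good part and the exceptional sets of
  \<open>sum_of_divisors_preimage_cover\<close>, in the same order.
\<close>
lemma sum_of_divisors_preimage_card_le:
  fixes L \<kappa> \<eta> B A :: real and k n :: nat
  defines "C \<equiv> 48 * 2 ^ k :: real" and "s \<equiv> 1 / (320 * k * L * (1 + 80 * L) ^ (k - 3) * 81)"
  assumes n: "n \<ge> 3" "ln (real n) = exp L" and k: "k \<ge> 1" and L: "L \<ge> 8"
    and zL: "72 + 24 * ln (1 + 320 * k * L) \<le> 20 * L"
    and lam: "\<kappa> \<ge> 0" and eta: "0 \<le> \<eta>" "\<eta> \<le> 1/2"
    and chain: "\<And>t R E. prime_chain k n (exp (320 * k * L)) t R E \<Longrightarrow>
       (\<Sum>p\<in>R k. real p powr (\<eta> - 1)) \<le> B"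
  shows "real (card {m. m > 0 \<and> (sum_of_divisors ^^ k) m = n}) \<le>
     exp (k * (\<kappa> * C ^ (k - 1))) * (real n powr (1 - \<eta>) * exp (4 * B)) +
     k * (real n * exp (42 * L - \<kappa> / 4)) + real n * exp (2 * L - \<kappa>) +
     (if k \<ge> 3 then k * (real n * exp (16 * L * exp (L / 2) + 8 - \<kappa> * s / 2)) else 0)"
proof -
  define z where "z = exp (320 * k * L)"
  define W where "W = (\<lambda>i::nat. exp (\<kappa> * C ^ i))"
  define X where "X = (\<lambda>i::nat. if i = 0 then 1 else W (i - 1) ^ 2)"
  define G where "G = exp (40 * L)"
  let ?u = "\<lambda>i m. (sum_of_divisors ^^ i) m"
  let ?S = "{m. m > 0 \<and> ?u k m = n}"
  let ?good = "{m. m > 0 \<and> ?u k m = n \<and> (\<forall>i<k. real (rough_root z (?u i m)) \<le> W (k - 1))}"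
  let ?rough = "\<lambda>i. {m\<in>{1..n}. ?u i m \<le> n \<and> (\<forall>t<i. real (square_part (?u t m)) \<le> X i) \<and>
              real (rough_root z (?u i m)) > W i}"
  let ?smooth = "\<lambda>i. {m\<in>{1..n}. ?u i m \<le> n \<and> (\<forall>t<i. real (square_part (?u t m)) \<le> X i) \<and>
              real (smooth_root z (?u i m)) > W i}"
  let ?sq = "{m\<in>{1..n}. real (square_part m) > W 0}"
  have k1: "real k \<ge> 1" using k by simp
  have kL: "320 * real k * L \<ge> 320 * L" using k1 L by simp
  have kL40: "L - 40 * real k * L \<le> -1" "-1/8 * (320 * real k * L) \<le> -1" using kL L by linarith+
  have "(2::real) ^ k \<ge> 1" by simp
  then have C1: "C \<ge> 48" "C \<ge> 1" unfolding C_def by linarith+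
  have Cp: "C ^ i \<ge> 1" for i using C1 by (simp add: one_le_power)
  have W1: "W i \<ge> 1" for i using lam Cp[of i] by (simp add: W_def)
  have Wm: "mono W"
  proof (rule monoI)
    fix i j :: nat assume "i \<le> j"
    then have "C ^ i \<le> C ^ j" using C1 by (intro power_increasing) auto
    then show "W i \<le> W j" using lam by (simp add: W_def mult_left_mono)
  qed
  have WS: "W (Suc i) = W i powr C" for i by (simp add: W_def powr_def mult_ac)
  have chain': "(\<Sum>p\<in>R k. real p powr (\<eta> - 1)) \<le> B" if "prime_chain k n z t R E" for t R E
    using chain that unfolding z_def by blast
  have z0: "z > 0" "z \<ge> 1" "ln z = 320 * k * L" using L by (auto simp: z_def)
  have lnz: "ln z \<ge> 10" using z0(3) kL L by linarith
  have zp: "z powr a = exp (a * (320 * k * L))" for a by (simp add: z_def powr_def)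
  have Pn: "prime_recip (real n) \<le> 4 * L"
  proof -
    have "prime_recip (real n) \<le> 6 + 2 * ln (1 + exp L)" using prime_recip_le[of "real n"] n by simp
    then show ?thesis using ln_one_plus_exp_le[of L] L by simp
  qed
  have ln1: "1 + ln (real n + 1) \<le> exp (2 * L)"
  proof -
    have "ln (real n + 1) \<le> ln (exp 1 * real n)"
    proof (intro ln_mono)
      have "2 * real n \<le> exp 1 * real n"
        using exp_ge_add_one_self[of "1::real"] by (intro mult_right_mono) auto
      moreover have "real n \<ge> 3" using n(1) by simp
      ultimately show "real n + 1 \<le> exp 1 * real n" by linarith
    qed (use n in auto)
    also have "\<dots> = 1 + exp L" using n by (simp add: ln_mult)
    finally have "1 + ln (real n + 1) \<le> 1 + (1 + exp L)" by simp
    also have "\<dots> \<le> exp L * exp L"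
    proof -
      have "exp L \<ge> 9" using exp_ge_add_one_self[of L] L by linarith
      then have "exp L * 9 \<le> exp L * exp L" by (intro mult_left_mono) auto
      then show ?thesis using \<open>exp L \<ge> 9\<close> by linarith
    qed
    finally show ?thesis by (simp flip: exp_add)
  qed
  have G1: "exp (8 * prime_recip (real n) + 8) \<le> G" using Pn L by (simp add: G_def)
  have G2: "(1 + ln (real n + 1)) * exp 4 \<le> G"
  proof -
    have "(1 + ln (real n + 1)) * exp 4 \<le> exp (2 * L) * exp 4" using ln1 by (intro mult_right_mono) auto
    also have "\<dots> \<le> G" using L by (simp add: G_def flip: exp_add)
    finally show ?thesis .
  qed
  have G3: "(1 + ln (real n + 1)) * exp (12 * prime_recip z) \<le> G"
  proof -
    have "prime_recip z \<le> 6 + 2 * ln (1 + 320 * k * L)" using prime_recip_le[OF z0(2)] z0(3) by simp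
    then have "12 * prime_recip z \<le> 20 * L" using zL by linarith
    then have "(1 + ln (real n + 1)) * exp (12 * prime_recip z) \<le> exp (2 * L) * exp (20 * L)"
      using ln1 by (intro mult_mono) auto
    also have "\<dots> \<le> G" using L by (simp add: G_def flip: exp_add)
    finally show ?thesis .
  qed
  have K1: "2 powr -(80 * L) * G \<le> 1"
  proof -
    have "80 * L * (1/2) \<le> 80 * L * ln 2" using L ln_2_ge_half by (intro mult_left_mono) auto
    then show ?thesis by (simp add: G_def powr_def flip: exp_add)
  qed
  have K2: "exp (L / 2) powr -80 * G \<le> 1" by (simp add: G_def powr_def flip: exp_add)
  have X1: "X i \<ge> 1" for i using W1 by (simp add: X_def one_le_power)
  define J where "J = (\<lambda>i::nat. X i ^ (6 * 2 ^ i))"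
  have J: "J i \<le> W i powr (1/4)" if "i < k" for i
  proof (cases i)
    case 0
    then show ?thesis using W1[of 0] by (simp add: J_def X_def ge_one_powr_ge_zero)
  next
    case (Suc j)
    have "J i = W j ^ (12 * 2 ^ i)" by (simp add: J_def X_def Suc flip: power_mult)
    also have "\<dots> \<le> W j ^ (12 * 2 ^ k)" using W1 that by (intro power_increasing mult_left_mono) auto
    also have "\<dots> = W j powr (12 * 2 ^ k)" using W1[of j] powr_realpow[of "W j" "12 * 2 ^ k"] by simp
    also have "\<dots> = W i powr (1/4)" unfolding Suc WS by (simp add: powr_powr C_def)
    finally show ?thesis .
  qed
  have JW: "J i \<le> W i" if "i < k" for i
  proof -
    have "W i powr (1/4) \<le> W i powr 1" using W1 by (intro powr_mono) auto
    then show ?thesis using J[OF that] W1[of i] by simp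
  qed
  have J0: "J i \<ge> 1" for i using X1 by (simp add: J_def one_le_power)
  have W0: "exp \<kappa> \<le> W i" for i using lam Cp[of i] mult_left_mono[of 1 "C ^ i" \<kappa>] by (simp add: W_def)
  have lnn: "1 + ln (real n) \<le> exp (2 * L)" using one_plus_exp_le[of L] L n by simp
  have rough: "real (card (?rough i)) \<le> real n * exp (42 * L - \<kappa> / 4)" if i: "i < k" for i
  proof -
    have "real (card (?rough i)) \<le> J i * real n * G * (1 + ln (real n)) * W i powr (-1/2)"
    proof (rule card_rough_exception_le[OF n(1) k])
      show "2 * ln (real n) * z powr (-1/8) \<le> 1"
      proof -
        have "2 * ln (real n) * z powr (-1/8) = 2 * (exp L * exp (-1/8 * (320 * k * L)))"
          unfolding zp n by simp
        also have "\<dots> = 2 * exp (L - 40 * k * L)" by (simp flip: exp_add)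
        also have "\<dots> \<le> 2 * exp (-1)" using kL40(1) by (intro mult_left_mono) simp_all
        also have "\<dots> \<le> 1" using exp_ge_add_one_self[of "1::real"] by (simp add: exp_minus field_simps)
        finally show ?thesis .
      qed
      show "z powr (-1/8) \<le> 3/4"
      proof -
        have "z powr (-1/8) \<le> exp (-1)" unfolding zp using kL40(2) by simp
        also have "\<dots> \<le> 3/4" using exp_ge_add_one_self[of "1::real"] by (simp add: exp_minus field_simps)
        finally show ?thesis .
      qed
      have "-1 / (8 * real k) * (320 * k * L) = -(40 * L)" using k1 by (simp add: field_simps)
      then show "z powr (-1 / (8 * real k)) * G \<le> 1" unfolding zp G_def by (simp flip: exp_add)
    qed (use i z0 G1 G2 X1 JW J_def in auto)
    also have "\<dots> \<le> W i powr (1/4) * real n * G * exp (2 * L) * W i powr (-1/2)"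
      using J[OF i] lnn J0[of i] n(2) by (intro mult_mono) (auto simp: G_def)
    also have "\<dots> = real n * (G * exp (2 * L)) * (W i powr (1/4) * W i powr (-1/2))"
      by (simp only: mult_ac)
    also have "W i powr (1/4) * W i powr (-1/2) = W i powr (-1/4)" by (simp flip: powr_add)
    also have "G * exp (2 * L) = exp (42 * L)" by (simp add: G_def flip: exp_add)
    also have "real n * exp (42 * L) * W i powr (-1/4) \<le> real n * exp (42 * L) * exp (- \<kappa> / 4)"
    proof (rule mult_left_mono)
      have "W i powr (-1/4) \<le> exp \<kappa> powr (-1/4)" using W0[of i] by (intro powr_mono2') auto
      then show "W i powr (-1/4) \<le> exp (- \<kappa> / 4)" by (simp add: powr_def)
    qed simp
    also have "\<dots> = real n * exp (42 * L - \<kappa> / 4)"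
      by (simp add: mult.assoc flip: exp_add)
    finally show ?thesis by simp
  qed
  have sq: "real (card ?sq) \<le> real n * exp (2 * L - \<kappa>)"
  proof -
    have "real (card ?sq) \<le> real n * (1 + ln (real n)) / W 0"
      using n W1[of 0] by (intro card_square_exception_le) auto
    also have "\<dots> \<le> real n * exp (2 * L) / W 0" using lnn W1[of 0] by (intro divide_right_mono mult_left_mono) auto
    also have "\<dots> = real n * exp (2 * L - \<kappa>)" by (simp add: W_def exp_diff)
    finally show ?thesis .
  qed
  have smooth: "real (card (?smooth (Suc i))) \<le> real n * exp (16 * L * exp (L / 2) + 8 - \<kappa> * s / 2)"
    if i: "i < k - 2" for i
  proof -
    let ?s = "1 / (ln z * (1 + 80 * L) ^ i * (1 + 80))"
    have ik: "Suc i < k" using i by simp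
    have "real (card (?smooth (Suc i))) \<le> (J (Suc i) / W (Suc i)) powr ?s *
             (real n * exp (4 * exp (L / 2) * prime_recip (real n) + 8))"
      by (rule card_smooth_exception_le[OF n(1) z0(1) lnz _ K1 G1 G3 _ _ K2])
         (use L X1 JW[OF ik] J_def in auto)
    also have "\<dots> \<le> exp (- (\<kappa> * s / 2)) * (real n * exp (16 * L * exp (L / 2) + 8))"
    proof (rule mult_mono)
      have s: "0 < s" "s \<le> ?s"
      proof -
        have "(1 + 80 * L) ^ i \<le> (1 + 80 * L) ^ (k - 3)" using i L by (intro power_increasing) auto
        then have "ln z * (1 + 80 * L) ^ i * (1 + 80) \<le> 320 * k * L * (1 + 80 * L) ^ (k - 3) * 81"
          unfolding z0(3) using L by (intro mult_mono) auto
        moreover have "0 < ln z * (1 + 80 * L) ^ i * (1 + 80)" using lnz L by (intro mult_pos_pos) auto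
        ultimately show "s \<le> ?s" unfolding s_def by (intro frac_le) auto
        show "0 < s" unfolding s_def using k1 L by auto
      qed
      have "J (Suc i) / W (Suc i) \<le> W (Suc i) powr (1/4) / W (Suc i) powr 1"
        using J[OF ik] W1[of "Suc i"] by (simp add: divide_right_mono)
      also have "\<dots> = W (Suc i) powr (-3/4)"
        using powr_diff[of "W (Suc i)" "1/4" 1] by simp
      also have "\<dots> \<le> exp \<kappa> powr (-3/4)" using W0[of "Suc i"] by (intro powr_mono2') auto
      finally have le: "J (Suc i) / W (Suc i) \<le> exp (- (\<kappa> * (3/4)))" by (simp add: powr_def mult.commute)
      have "(J (Suc i) / W (Suc i)) powr ?s \<le> exp (- (\<kappa> * (3/4))) powr ?s"
      proof (rule powr_mono2)
        show "J (Suc i) / W (Suc i) \<le> exp (- (\<kappa> * (3/4)))" by (rule le)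
        show "0 \<le> ?s" using s by linarith
        show "0 \<le> J (Suc i) / W (Suc i)" using J0[of "Suc i"] W1[of "Suc i"] by simp
      qed
      also have "\<dots> = exp (- (\<kappa> * (3/4)) * ?s)" by (simp add: powr_def mult.commute)
      also have "\<dots> \<le> exp (- (\<kappa> * s / 2))"
      proof -
        have "\<kappa> * (1/2) * s \<le> \<kappa> * (3/4) * ?s" using lam s by (intro mult_mono) auto
        then show ?thesis by simp
      qed
      finally show "(J (Suc i) / W (Suc i)) powr ?s \<le> exp (- (\<kappa> * s / 2))" .
      have "exp (L / 2) * prime_recip (real n) \<le> exp (L / 2) * (4 * L)" using Pn by (intro mult_left_mono) auto
      then show "real n * exp (4 * exp (L / 2) * prime_recip (real n) + 8) \<le> real n * exp (16 * L * exp (L / 2) + 8)"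
        by (intro mult_left_mono) auto
    qed auto
    also have "\<dots> = real n * exp (16 * L * exp (L / 2) + 8 - \<kappa> * s / 2)"
      by (rule exp_minus_mult)
    finally show ?thesis .
  qed
  have good: "real (card ?good) \<le> W (k - 1) ^ k * (real n powr (1 - \<eta>) * exp (4 * B))"
  proof (rule card_bounded_rough_roots_le)
    fix w
    let ?F = "{m. m > 0 \<and> ?u k m = n \<and> (\<forall>i<k. rough_root z (?u i m) = w i)}"
    show "real (card ?F) \<le> real n powr (1 - \<eta>) * exp (4 * B)"
    proof (cases "?F = {}")
      case False
      let ?R = "\<lambda>j. \<Union>m\<in>?F. prime_factors (?u (k - j) m)"
      have ch: "prime_chain k n z (\<lambda>q. q + 1) ?R (\<lambda>j. prime_factors (w (k - Suc j)))"
        using n(1) False by (intro prime_chain_sum_of_divisors) simp_all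
      have "real (card ?F) \<le> real n powr (1 - \<eta>) * exp (4 * (\<Sum>p\<in>?R k. real p powr (\<eta> - 1)))"
      proof (rule card_le_powr_exp)
        show "finite ?F" by (rule finite_subset[OF _ finite_iter_preimage[of sum_of_divisors k n]]) auto
        show "\<forall>m\<in>?F. 0 < m \<and> real m \<le> real n \<and> prime_factors m \<subseteq> ?R k"
        proof (intro ballI conjI)
          fix m assume m: "m \<in> ?F"
          then show "0 < m" by simp
          show "real m \<le> real n" using sum_of_divisors_iterate_mono[of m 0 k] m by simp
          have "prime_factors m = prime_factors (?u (k - k) m)" by simp
          then show "prime_factors m \<subseteq> ?R k" using m by blast
        qed
        show "finite (?R k)" "\<forall>p\<in>?R k. prime p" using prime_chain_finite[OF ch, of k] by auto
      qed (use eta in auto)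
      also have "\<dots> \<le> real n powr (1 - \<eta>) * exp (4 * B)"
        using chain'[OF ch] by (intro mult_left_mono) auto
      finally show ?thesis .
    next
      case True
      show ?thesis unfolding True by simp
    qed
  qed (use W1 in auto)
  have Wk: "W (k - 1) ^ k = exp (k * (\<kappa> * C ^ (k - 1)))"
    by (simp add: W_def exp_of_nat_mult)
  have fin: "finite ?good"
    by (rule finite_subset[OF _ finite_iter_preimage[of sum_of_divisors k n]]) auto
  have cover: "?S \<subseteq> ?good \<union> (\<Union>i<k. ?rough i) \<union> ?sq \<union> (\<Union>i<k - 2. ?smooth (Suc i))"
    unfolding X_def by (rule sum_of_divisors_preimage_cover[OF W1 Wm])
  have "card ?S \<le> card (?good \<union> (\<Union>i<k. ?rough i) \<union> ?sq \<union> (\<Union>i<k - 2. ?smooth (Suc i)))"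
    by (rule card_mono[OF _ cover]) (use fin in auto)
  also have "\<dots> \<le> card ?good + card (\<Union>i<k. ?rough i) + card ?sq + card (\<Union>i<k - 2. ?smooth (Suc i))"
    by (intro order_trans[OF card_Un_le] add_mono order_refl)
  also have "\<dots> \<le> card ?good + (\<Sum>i<k. card (?rough i)) + card ?sq + (\<Sum>i<k - 2. card (?smooth (Suc i)))"
    by (intro add_mono order_refl card_UN_le) auto
  finally have "real (card ?S) \<le> real (card ?good + (\<Sum>i<k. card (?rough i)) + card ?sq + (\<Sum>i<k - 2. card (?smooth (Suc i))))"
    by (rule of_nat_mono)
  also have "\<dots> = real (card ?good) + (\<Sum>i<k. real (card (?rough i))) + real (card ?sq) + (\<Sum>i<k - 2. real (card (?smooth (Suc i))))"
    by simp
  also have "\<dots> \<le> exp (k * (\<kappa> * C ^ (k - 1))) * (real n powr (1 - \<eta>) * exp (4 * B)) +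
     k * (real n * exp (42 * L - \<kappa> / 4)) + real n * exp (2 * L - \<kappa>) +
     (if k \<ge> 3 then k * (real n * exp (16 * L * exp (L / 2) + 8 - \<kappa> * s / 2)) else 0)"
  proof (intro add_mono)
    show "real (card ?good) \<le> exp (k * (\<kappa> * C ^ (k - 1))) * (real n powr (1 - \<eta>) * exp (4 * B))"
      using good unfolding Wk .
    have "(\<Sum>i<k. real (card (?rough i))) \<le> (\<Sum>i<k. real n * exp (42 * L - \<kappa> / 4))"
      using rough by (intro sum_mono) auto
    then show "(\<Sum>i<k. real (card (?rough i))) \<le> k * (real n * exp (42 * L - \<kappa> / 4))" by simp
    show "real (card ?sq) \<le> real n * exp (2 * L - \<kappa>)" by (rule sq)
    show "(\<Sum>i<k - 2. real (card (?smooth (Suc i))))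
       \<le> (if k \<ge> 3 then k * (real n * exp (16 * L * exp (L / 2) + 8 - \<kappa> * s / 2)) else 0)"
    proof (cases "k \<ge> 3")
      case True
      let ?b = "real n * exp (16 * L * exp (L / 2) + 8 - \<kappa> * s / 2)"
      have "(\<Sum>i<k - 2. real (card (?smooth (Suc i)))) \<le> (\<Sum>i<k - 2. ?b)"
        using smooth by (intro sum_mono) auto
      also have "\<dots> = real (k - 2) * ?b" by simp
      also have "\<dots> \<le> k * ?b" by (intro mult_right_mono) auto
      finally show ?thesis using True by simp
    qed simp
  qed
  finally show ?thesis .
qed

section \<open>Choice of the saving\<close>
lemma eventually_powr_le_exp:
  fixes C a :: real
  shows "\<forall>\<^sub>F x in at_top. C * x powr a \<le> exp x"
proof -
  define N where "N = nat \<lceil>a\<rceil>"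
  have N: "a \<le> real N" unfolding N_def by linarith
  have "((\<lambda>x. \<bar>C\<bar> * (x ^ N / exp x)) \<longlongrightarrow> \<bar>C\<bar> * 0) at_top"
    by (intro tendsto_mult tendsto_const tendsto_power_div_exp_0)
  then have "\<forall>\<^sub>F x in at_top. \<bar>C\<bar> * (x ^ N / exp x) < 1"
    by (rule order_tendstoD) simp
  then show ?thesis using eventually_ge_at_top[of 1]
  proof eventually_elim
    case (elim x)
    have "C * x powr a \<le> \<bar>C\<bar> * x powr real N"
      using elim N by (intro mult_mono powr_mono) auto
    also have "\<dots> = \<bar>C\<bar> * (x ^ N / exp x) * exp x" using elim by (simp add: powr_realpow)
    also have "\<dots> \<le> 1 * exp x" using elim by (intro mult_right_mono) auto
    finally show ?case by simp
  qed
qed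

lemma eventually_powr_le_powr:
  fixes C a b :: real
  assumes "a < b"
  shows "\<forall>\<^sub>F x in at_top. C * x powr a \<le> x powr b"
proof -
  have "\<forall>\<^sub>F x in at_top. C \<le> x powr (b - a)"
    using assms by real_asymp
  then show ?thesis using eventually_gt_at_top[of 0]
  proof eventually_elim
    case (elim x)
    have "C * x powr a \<le> x powr (b - a) * x powr a" using elim by (intro mult_right_mono) auto
    also have "\<dots> = x powr b" by (simp flip: powr_add)
    finally show ?case .
  qed
qed

text \<open>
  The exponent $\eta$, as a function of $l = L_3$, has to exceed every multiple of the target
  $l^\gamma / L_2^k$. For $k \ge 2$ it is large enough to exceed even the multiples of $l^\gamma /
  L_2^2$, which leaves room for the factor $L_2^{k-2}$ that the smooth exceptional sets cost. For
  $k = 1$ a single step suffices, and the sum may be as large as $\sqrt{\ln n}$; this allows $\eta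
  = l^g / L_2$ with $\gamma < g < 1$, where $(\ln n)^\eta = \exp(l^g)$ is still a negligible power
  of $L_2$.
\<close>
lemma prime_chain_rate:
  fixes k :: nat and \<gamma> :: real
  assumes k: "k \<ge> 1" and \<gamma>: "\<gamma> < k"
  obtains \<eta> :: "real \<Rightarrow> real" where
    "\<And>C. \<forall>\<^sub>F l in at_top. C * l powr \<gamma> \<le> \<eta> l * exp l ^ min 2 k"
    "\<forall>\<^sub>F l in at_top. 0 \<le> \<eta> l \<and> \<eta> l \<le> 1/2"
    "\<forall>\<^sub>F l in at_top. \<forall>n t R E. n \<ge> 1 \<longrightarrow> ln (real n) = exp (exp l) \<longrightarrow>
       prime_chain k n (exp (320 * k * exp l)) t R E \<longrightarrow>
       (\<Sum>q\<in>R k. real q powr (\<eta> l - 1)) \<le> exp (exp l / 2)"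
proof (cases "k \<ge> 2")
  case True
  define \<eta> where "\<eta> = (\<lambda>l::real. 1 / (exp l * l ^ (2 * k)))"
  show ?thesis
  proof (rule that[of \<eta>])
    show "\<forall>\<^sub>F l in at_top. C * l powr \<gamma> \<le> \<eta> l * exp l ^ min 2 k" for C
      using eventually_powr_le_exp[of C "\<gamma> + 2 * k"] eventually_gt_at_top[of 0]
    proof eventually_elim
      case (elim l)
      have "C * l powr \<gamma> * l ^ (2 * k) = C * l powr (\<gamma> + 2 * k)"
        using elim powr_realpow[of l "2 * k"] by (simp add: powr_add)
      also have "\<dots> \<le> exp l" by (rule elim)
      finally have "C * l powr \<gamma> \<le> exp l / l ^ (2 * k)" using elim by (simp add: pos_le_divide_eq)
      also have "\<dots> = \<eta> l * exp l ^ min 2 k"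
        using True by (simp add: \<eta>_def min_def power2_eq_square)
      finally show ?case .
    qed
    show "\<forall>\<^sub>F l in at_top. 0 \<le> \<eta> l \<and> \<eta> l \<le> 1/2" using eventually_ge_at_top[of 1]
    proof eventually_elim
      case (elim l)
      have "2 \<le> exp l" using exp_ge_add_one_self[of l] elim by linarith
      moreover have "1 \<le> l ^ (2 * k)" using elim by (simp add: one_le_power)
      ultimately have "2 * 1 \<le> exp l * l ^ (2 * k)" by (intro mult_mono) auto
      then show ?case using elim frac_le[of 1 1 2 "exp l * l ^ (2 * k)"] by (simp add: \<eta>_def)
    qed
    have "\<forall>\<^sub>F l::real in at_top. 36 * l \<le> exp (exp l / 2)" by real_asymp
    then show "\<forall>\<^sub>F l in at_top. \<forall>n t R E. n \<ge> 1 \<longrightarrow> ln (real n) = exp (exp l) \<longrightarrow>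
       prime_chain k n (exp (320 * k * exp l)) t R E \<longrightarrow>
       (\<Sum>q\<in>R k. real q powr (\<eta> l - 1)) \<le> exp (exp l / 2)"
      using eventually_powr_le_exp[of 1 "2 * k + 3"] eventually_ge_at_top[of "288 ^ 2"]
        eventually_ge_at_top[of "320 * real k"]
    proof eventually_elim
      case (elim l)
      show ?case
      proof (intro allI impI)
        fix n t R E
        assume n: "1 \<le> n" "ln (real n) = exp (exp l)"
          and ch: "prime_chain k n (exp (320 * k * exp l)) t R E"
        have l0: "l > 0" using elim(3) by simp
        have big: "l ^ (2 * k + 3) \<le> exp l"
          using elim(2) powr_realpow[OF l0, of "2 * k + 3"] by simp
        have "(\<Sum>q\<in>R k. real q powr (1 / (exp l * l ^ (2 * k)) - 1)) \<le> 36 * l"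
          by (rule prime_chain_sum_le[OF n, where A = "320 * k"]) (use elim big ch k in auto)
        then show "(\<Sum>q\<in>R k. real q powr (\<eta> l - 1)) \<le> exp (exp l / 2)"
          using elim(1) unfolding \<eta>_def by linarith
      qed
    qed
  qed
next
  case False
  then have k1: "k = 1" using k by simp
  \<comment> \<open>The maximum with 0 also covers negative $\gamma$.\<close>
  define g where "g = (max \<gamma> 0 + 1) / 2"
  have g: "0 < g" "g < 1" "\<gamma> < g" using \<gamma> k1 unfolding g_def by (auto simp: max_def)
  define \<eta> where "\<eta> = (\<lambda>l::real. l powr g / exp l)"
  have small: "\<forall>\<^sub>F l::real in at_top. 640 * l powr g \<le> l"
    using eventually_powr_le_powr[OF g(2), of 640] eventually_gt_at_top[of 0]
    by eventually_elim simp
  show ?thesis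
  proof (rule that[of \<eta>])
    show "\<forall>\<^sub>F l in at_top. C * l powr \<gamma> \<le> \<eta> l * exp l ^ min 2 k" for C
      using eventually_powr_le_powr[OF g(3), of C]
      by eventually_elim (simp add: \<eta>_def k1)
    show "\<forall>\<^sub>F l in at_top. 0 \<le> \<eta> l \<and> \<eta> l \<le> 1/2" using small eventually_ge_at_top[of 1]
    proof eventually_elim
      case (elim l)
      have "2 * l powr g \<le> exp l" using exp_ge_add_one_self[of l] elim by linarith
      then show ?case by (simp add: \<eta>_def divide_le_eq)
    qed
    have a1: "\<forall>\<^sub>F l::real in at_top. exp (l / 2) * (10 + 2 * l) \<le> exp l / 16" by real_asymp
    have a2: "\<forall>\<^sub>F l::real in at_top. exp (l / 2) * (6 + 2 * ln (1 + 320 * exp l)) + 1 + 2 * exp (exp l / 4)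
       \<le> exp (exp l / 2)" by real_asymp
    show "\<forall>\<^sub>F l in at_top. \<forall>n t R E. n \<ge> 1 \<longrightarrow> ln (real n) = exp (exp l) \<longrightarrow>
       prime_chain k n (exp (320 * k * exp l)) t R E \<longrightarrow>
       (\<Sum>q\<in>R k. real q powr (\<eta> l - 1)) \<le> exp (exp l / 2)"
      using a1 a2 small eventually_ge_at_top[of 1]
    proof eventually_elim
      case (elim l)
      show ?case
      proof (intro allI impI)
        fix n t R E
        assume n: "1 \<le> n" "ln (real n) = exp (exp l)"
          and ch: "prime_chain k n (exp (320 * k * exp l)) t R E"
        let ?z = "exp (320 * exp l)"
        have z: "?z \<ge> 1" by simp
        have eta: "0 \<le> \<eta> l" "\<eta> l \<le> 1/2"
        proof -
          have "2 * l powr g \<le> exp l" using exp_ge_add_one_self[of l] elim by linarith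
          then show "0 \<le> \<eta> l" "\<eta> l \<le> 1/2" by (simp_all add: \<eta>_def divide_le_eq)
        qed
        have P1: "prime_recip (exp (exp l)) + 2 \<le> 10 + 2 * l"
          using prime_recip_le[of "exp (exp l)"] ln_one_plus_exp_le[of l] elim by simp
        have "(\<Sum>q\<in>R 0. real q powr (\<eta> l - 1)) \<le> exp (exp l) powr \<eta> l * (prime_recip (exp (exp l)) + 2)"
          by (rule prime_divisor_sum_le[of n]) (use n ch eta in \<open>auto simp: prime_chain_def\<close>)
        also have "exp (exp l) powr \<eta> l = exp (l powr g)" by (simp add: powr_def \<eta>_def)
        also have "\<dots> * (prime_recip (exp (exp l)) + 2) \<le> exp (l / 2) * (10 + 2 * l)"
          using elim P1 prime_recip_nonneg[of "exp (exp l)"] by (intro mult_mono) auto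
        also have "\<dots> \<le> exp l / 16" by (rule elim)
        finally have R0: "(\<Sum>q\<in>R 0. real q powr (\<eta> l - 1)) \<le> exp l / 16" .
        have few: "2 * ln (real n) * ?z powr (-1/2) \<le> 1"
        proof -
          have "2 * ln (real n) * ?z powr (-1/2) = 2 * (exp (exp l) * exp (-160 * exp l))"
            unfolding n by (simp add: powr_def)
          also have "\<dots> = 2 * exp (- 159 * exp l)" by (simp flip: exp_add)
          also have "\<dots> \<le> 2 * exp (-1)"
          proof -
            have "1 \<le> exp l" using elim by simp
            then have "- 159 * exp l \<le> -1" by linarith
            then show ?thesis by simp
          qed
          also have "\<dots> \<le> 1" using exp_ge_add_one_self[of "1::real"] by (simp add: exp_minus field_simps)
          finally show ?thesis .
        qed
        have ch': "prime_chain k n ?z t R E" using ch k1 by simp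
        have "(\<Sum>q\<in>R (Suc 0). real q powr (\<eta> l - 1))
           \<le> ?z powr \<eta> l * prime_recip ?z + 1 + 2 * ?z powr (\<eta> l - \<eta> l) * exp (4 * (exp l / 16))"
          by (rule prime_chain_step[OF ch' _ z order_refl few eta(1) order_refl eta(2) R0]) (use k1 in simp)
        also have "\<dots> = ?z powr \<eta> l * prime_recip ?z + 1 + 2 * exp (exp l / 4)" by simp
        also have "\<dots> \<le> exp (l / 2) * (6 + 2 * ln (1 + 320 * exp l)) + 1 + 2 * exp (exp l / 4)"
        proof -
          have "?z powr \<eta> l = exp (320 * l powr g)" by (simp add: powr_def \<eta>_def)
          also have "\<dots> \<le> exp (l / 2)" using elim by simp
          finally have "?z powr \<eta> l * prime_recip ?z \<le> exp (l / 2) * (6 + 2 * ln (1 + 320 * exp l))"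
            using prime_recip_le[OF z] prime_recip_nonneg[of ?z] by (intro mult_mono) auto
          then show ?thesis by simp
        qed
        also have "\<dots> \<le> exp (exp l / 2)" by (rule elim)
        finally show "(\<Sum>q\<in>R k. real q powr (\<eta> l - 1)) \<le> exp (exp l / 2)" using k1 by simp
      qed
    qed
  qed
qed

section \<open>Counting preimages under iterated totients\<close>

text \<open>
  The $j$-th smallest element of $A$ is at least $j + 1$, so the product telescopes.
\<close>
lemma prod_one_minus_inverse_ge:
  fixes A :: "nat set"
  assumes "finite A" "\<forall>p\<in>A. p \<ge> 2"
  shows "(\<Prod>p\<in>A. 1 - 1 / real p) \<ge> 1 / (real (card A) + 1)"
  using assms
proof (induction A rule: finite_linorder_max_induct)
  case (insert b A)
  have "A \<subseteq> {2..<b}" using insert by auto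
  then have "card A \<le> card {2..<b}" by (intro card_mono) auto
  moreover have "b \<ge> 2" using insert by auto
  ultimately have b: "real b \<ge> real (card A) + 2" by simp
  have "1 / (real (card A) + 2) = (1 - 1 / (real (card A) + 2)) * (1 / (real (card A) + 1))"
    by (simp add: field_simps)
  also have "\<dots> \<le> (1 - 1 / real b) * (\<Prod>p\<in>A. 1 - 1 / real p)"
  proof (rule mult_mono)
    show "1 - 1 / (real (card A) + 2) \<le> 1 - 1 / real b" using b by (simp add: frac_le)
    show "1 / (real (card A) + 1) \<le> (\<Prod>p\<in>A. 1 - 1 / real p)" using insert by auto
    show "0 \<le> 1 - 1 / real b" using \<open>b \<ge> 2\<close> by simp
  qed simp
  also have "\<dots> = (\<Prod>p\<in>insert b A. 1 - 1 / real p)"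
  proof -
    have "b \<notin> A" using insert by auto
    then show ?thesis using insert by simp
  qed
  finally show ?case using insert by (auto simp: add.commute)
qed simp

text \<open>
  The bound $m \le \varphi(m) (1 + 2 \ln m)$ is used twice: first with $\ln m = O(\sqrt{m})$,
  which gives $\ln m$ in terms of $\ln \varphi(m)$, and then again with this.
\<close>
lemma le_totient_mult_ln:
  assumes "m > 0"
  shows "real m \<le> real (totient m) * (9 + 4 * ln (real (totient m)))"
proof -
  let ?v = "real (totient m)"
  have v: "?v \<ge> 1" using assms by (simp add: Suc_le_eq)
  have m: "real m \<ge> 1" using assms by simp
  have "1 / (real (card (prime_factors m)) + 1) \<le> (\<Prod>p\<in>prime_factors m. 1 - 1 / real p)"
    by (rule prod_one_minus_inverse_ge) (auto intro: prime_ge_2_nat)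
  then have "real m * (1 / (real (card (prime_factors m)) + 1)) \<le> ?v"
    unfolding totient_formula2 by (intro mult_left_mono) auto
  then have "real m \<le> ?v * (real (card (prime_factors m)) + 1)" by (simp add: field_simps)
  also have "\<dots> \<le> ?v * (2 * ln (real m) + 1)"
    using card_prime_factors_le[of m] assms by (intro mult_left_mono) auto
  finally have 1: "real m \<le> ?v * (2 * ln (real m) + 1)" .
  have "ln (sqrt (real m)) \<le> sqrt (real m) - 1" using m by (intro ln_le_minus_one) simp
  then have "2 * ln (real m) + 1 \<le> 4 * sqrt (real m)" using m by (simp add: ln_sqrt)
  then have "?v * (2 * ln (real m) + 1) \<le> ?v * (4 * sqrt (real m))" using v by (intro mult_left_mono) auto
  moreover have "sqrt (real m) * sqrt (real m) = real m" by simp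
  ultimately have "sqrt (real m) * sqrt (real m) \<le> ?v * (4 * sqrt (real m))" using 1 by linarith
  then have "sqrt (real m) * sqrt (real m) \<le> 4 * ?v * sqrt (real m)" by (simp only: mult_ac)
  then have "sqrt (real m) \<le> 4 * ?v" using m by (subst (asm) mult_le_cancel_right) auto
  then have "ln (sqrt (real m)) \<le> ln (4 * ?v)" using m by (intro ln_mono) auto
  then have "ln (real m) \<le> 2 * ln 4 + 2 * ln ?v" using m v by (simp add: ln_sqrt ln_mult)
  moreover have "ln (4::real) \<le> 2" using ln_realpow[of 2 2] ln_2_less_1 by simp
  ultimately have "2 * ln (real m) + 1 \<le> 9 + 4 * ln ?v" by linarith
  then have "?v * (2 * ln (real m) + 1) \<le> ?v * (9 + 4 * ln ?v)" using v by (intro mult_left_mono) auto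
  with 1 show ?thesis by linarith
qed

lemma totient_iterate_preimage_le:
  fixes L :: real
  assumes n: "n \<ge> 1" "ln (real n) = exp L" and L: "L \<ge> 8" "2 * real k * L \<le> exp L"
  shows "j \<le> k \<Longrightarrow> m > 0 \<Longrightarrow> (totient ^^ j) m = n \<Longrightarrow> real m \<le> real n * exp (2 * real j * L)"
proof (induction j arbitrary: m)
  case 0
  then show ?case by simp
next
  case (Suc j)
  let ?v = "real (totient m)"
  have v1: "?v \<ge> 1" using Suc.prems by (simp add: Suc_le_eq)
  have v: "?v \<le> real n * exp (2 * real j * L)"
    using Suc by (intro Suc.IH) (auto simp: funpow_swap1)
  have "ln ?v \<le> ln (real n * exp (2 * real j * L))" using v v1 by (intro ln_mono) linarith+
  also have "\<dots> = exp L + 2 * real j * L" using n by (simp add: ln_mult)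
  also have "\<dots> \<le> exp L + 2 * real k * L" using Suc.prems L by (intro add_left_mono mult_right_mono) auto
  also have "\<dots> \<le> 2 * exp L" using L by simp
  finally have "9 + 4 * ln ?v \<le> 9 + 8 * exp L" by simp
  also have "\<dots> \<le> exp L * exp L"
  proof -
    have "exp L \<ge> 9" using exp_ge_add_one_self[of L] L by linarith
    moreover from this have "exp L * 9 \<le> exp L * exp L" by (intro mult_left_mono) auto
    ultimately show ?thesis by linarith
  qed
  also have "\<dots> = exp (2 * L)" by (simp flip: exp_add)
  finally have b: "9 + 4 * ln ?v \<le> exp (2 * L)" .
  have "real m \<le> ?v * (9 + 4 * ln ?v)" by (rule le_totient_mult_ln[OF Suc.prems(2)])
  also have "\<dots> \<le> real n * exp (2 * real j * L) * exp (2 * L)"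
    using v b v1 by (intro mult_mono) auto
  also have "\<dots> = real n * exp (2 * real (Suc j) * L)" by (simp add: exp_add[symmetric] algebra_simps)
  finally show ?case .
qed

lemma totient_preimage_card_le:
  fixes L \<eta> B z :: real
  assumes n: "n \<ge> 1" "ln (real n) = exp L" and L: "L \<ge> 8" "2 * real k * L \<le> exp L"
    and eta: "0 \<le> \<eta>" "\<eta> \<le> 1/2"
    and chain: "\<And>t R E. prime_chain k n z t R E \<Longrightarrow> (\<Sum>p\<in>R k. real p powr (\<eta> - 1)) \<le> B"
  shows "real (card {m. m > 0 \<and> (totient ^^ k) m = n}) \<le>
     real n powr (1 - \<eta>) * exp (2 * real k * L + 4 * B)"
proof -
  let ?S = "{m. m > 0 \<and> (totient ^^ k) m = n}"
  let ?R = "\<lambda>j. \<Union>m\<in>?S. prime_factors ((totient ^^ (k - j)) m)"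
  have ch: "prime_chain k n z (\<lambda>q. q - 1) ?R (\<lambda>_. {})" by (rule prime_chain_totient[OF n(1)])
  have "real (card ?S) \<le> (real n * exp (2 * real k * L)) powr (1 - \<eta>) * exp (4 * (\<Sum>p\<in>?R k. real p powr (\<eta> - 1)))"
  proof (rule card_le_powr_exp)
    show "finite ?S" by (rule finite_iter_preimage) simp
    show "\<forall>m\<in>?S. 0 < m \<and> real m \<le> real n * exp (2 * real k * L) \<and> prime_factors m \<subseteq> ?R k"
    proof (intro ballI conjI)
      fix m assume m: "m \<in> ?S"
      then show "0 < m" by simp
      show "real m \<le> real n * exp (2 * real k * L)"
        by (rule totient_iterate_preimage_le[OF n L order_refl]) (use m in auto)
      have "prime_factors m = prime_factors ((totient ^^ (k - k)) m)" by simp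
      then show "prime_factors m \<subseteq> ?R k" using m by blast
    qed
    show "finite (?R k)" "\<forall>p\<in>?R k. prime p" using prime_chain_finite[OF ch, of k] by auto
  qed (use eta in auto)
  also have "\<dots> \<le> real n powr (1 - \<eta>) * exp (2 * real k * L) * exp (4 * B)"
  proof (rule mult_mono)
    have "(real n * exp (2 * real k * L)) powr (1 - \<eta>) = real n powr (1 - \<eta>) * exp (2 * real k * L) powr (1 - \<eta>)"
      by (rule powr_mult)
    also have "\<dots> \<le> real n powr (1 - \<eta>) * exp (2 * real k * L) powr 1"
      using eta L by (intro mult_left_mono powr_mono) auto
    finally show "(real n * exp (2 * real k * L)) powr (1 - \<eta>) \<le> real n powr (1 - \<eta>) * exp (2 * real k * L)" by simp
    show "exp (4 * (\<Sum>p\<in>?R k. real p powr (\<eta> - 1))) \<le> exp (4 * B)" using chain[OF ch] by simp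
  qed auto
  finally show ?thesis by (simp add: exp_add mult.assoc)
qed

section \<open>The asymptotic bound\<close>
lemma preimage_rate_dominates:
  fixes k :: nat and \<gamma> C :: real and \<eta> :: "real \<Rightarrow> real"
  assumes "\<forall>\<^sub>F l in at_top. C * l powr \<gamma> \<le> \<eta> l * exp l ^ min 2 k"
  shows "\<forall>\<^sub>F l in at_top. C * (exp (exp l) * l powr \<gamma> / exp l ^ k) \<le> \<eta> l * exp (exp l) / exp l ^ (k - 2)"
  using assms
proof eventually_elim
  case (elim l)
  have kk: "exp l ^ k = exp l ^ min 2 k * exp l ^ (k - 2)"
  proof (cases "k \<ge> 2")
    case True
    then have "min 2 k = 2" "2 + (k - 2) = k" by auto
    then show ?thesis by (metis power_add)
  qed (simp add: min_def)
  have "C * (exp (exp l) * l powr \<gamma> / exp l ^ k) = exp (exp l) / exp l ^ k * (C * l powr \<gamma>)" by simp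
  also have "\<dots> \<le> exp (exp l) / exp l ^ k * (\<eta> l * exp l ^ min 2 k)"
    using elim by (intro mult_left_mono) auto
  also have "\<dots> = \<eta> l * exp (exp l) / exp l ^ (k - 2)" unfolding kk by simp
  finally show ?case .
qed

text \<open>
  All error terms in the exponent are at most $\exp(\tfrac34 L_2) = L_1^{3/4}$, and the target
  exponent $L_1 l^\gamma / L_2^k$ is larger, even for negative $\gamma$.
\<close>
lemma target_rate_lower:
  fixes k :: nat and \<gamma> :: real
  shows "\<forall>\<^sub>F l in at_top. exp (3/4 * exp l) \<le> exp (exp l) * l powr \<gamma> / exp l ^ k"
proof -
  have lim: "filterlim (\<lambda>l::real. exp l / 4) at_top at_top" by real_asymp
  from eventually_compose_filterlim[OF eventually_powr_le_exp[of "4 ^ (k + 1)" "k + 1"] lim]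
  have "\<forall>\<^sub>F l::real in at_top. 4 ^ (k + 1) * (exp l / 4) powr (k + 1) \<le> exp (exp l / 4)" .
  then show ?thesis using eventually_powr_le_exp[of 1 "-\<gamma>"] eventually_gt_at_top[of 0]
  proof eventually_elim
    case (elim l)
    have "exp l ^ (k + 1) = 4 ^ (k + 1) * (exp l / 4) ^ (k + 1)" by (simp add: power_divide)
    also have "\<dots> = 4 ^ (k + 1) * (exp l / 4) powr (k + 1)" using powr_realpow[of "exp l / 4" "k + 1"] by simp
    also have "\<dots> \<le> exp (exp l / 4)" by (rule elim)
    finally have p: "exp l ^ k * exp l \<le> exp (exp l / 4)" by (simp add: mult.commute)
    have "1 / l powr \<gamma> \<le> exp l" using elim by (simp add: powr_minus_divide)
    then have "1 \<le> exp l * l powr \<gamma>" using elim by (simp add: divide_le_eq)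
    then have "exp l ^ k * 1 \<le> exp l ^ k * (exp l * l powr \<gamma>)" by (intro mult_left_mono) auto
    also have "\<dots> = (exp l ^ k * exp l) * l powr \<gamma>" by simp
    also have "\<dots> \<le> exp (exp l / 4) * l powr \<gamma>" using p by (intro mult_right_mono) auto
    finally have "exp (3/4 * exp l) * exp l ^ k \<le> exp (3/4 * exp l) * (exp (exp l / 4) * l powr \<gamma>)"
      by (intro mult_left_mono) auto
    also have "\<dots> = exp (exp l) * l powr \<gamma>"
    proof -
      have "exp (3/4 * exp l) * exp (exp l / 4) = exp (exp l)" by (simp flip: exp_add)
      then show ?thesis by (simp only: mult.assoc[symmetric])
    qed
    finally show ?case by (simp add: pos_le_divide_eq)
  qed
qed

lemma powr_one_minus_eq:
  assumes "real n > 0" "ln (real n) = x"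
  shows "real n powr (1 - \<eta>) = real n * exp (- \<eta> * x)"
proof -
  have "real n = exp x" using assms by (metis exp_ln)
  moreover have "exp x * exp (- \<eta> * x) = exp ((1 - \<eta>) * x)"
    unfolding exp_add[symmetric] by (simp add: algebra_simps)
  moreover have "real n powr (1 - \<eta>) = exp ((1 - \<eta>) * x)" using assms by (simp add: powr_def)
  ultimately show ?thesis by metis
qed

lemma powr_one_minus_mult_exp:
  assumes "real n > 0" "ln (real n) = x"
  shows "real n powr (1 - \<eta>) * exp y = real n * exp (y - \<eta> * x)"
  unfolding powr_one_minus_eq[OF assms] mult.assoc exp_add[symmetric] by (simp add: algebra_simps)

lemma eventually_totient_preimage_le:
  fixes k :: nat and \<gamma> :: real
  assumes k: "k \<ge> 1" and \<gamma>: "\<gamma> < k"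
  shows "\<forall>\<^sub>F l in at_top. \<forall>n. n \<ge> 3 \<longrightarrow> ln (real n) = exp (exp l) \<longrightarrow>
     real (card {m. m > 0 \<and> (totient ^^ k) m = n}) \<le> real n * exp (- (exp (exp l) * l powr \<gamma> / exp l ^ k))"
proof -
  obtain \<eta> :: "real \<Rightarrow> real" where
    \<eta>: "\<And>C. \<forall>\<^sub>F l in at_top. C * l powr \<gamma> \<le> \<eta> l * exp l ^ min 2 k"
      "\<forall>\<^sub>F l in at_top. 0 \<le> \<eta> l \<and> \<eta> l \<le> 1/2"
      "\<forall>\<^sub>F l in at_top. \<forall>n t R E. n \<ge> 1 \<longrightarrow> ln (real n) = exp (exp l) \<longrightarrow>
         prime_chain k n (exp (320 * k * exp l)) t R E \<longrightarrow>
         (\<Sum>q\<in>R k. real q powr (\<eta> l - 1)) \<le> exp (exp l / 2)"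
    using prime_chain_rate[OF k \<gamma>] by blast
  have a: "\<forall>\<^sub>F l::real in at_top. 2 * real k * exp l + 4 * exp (exp l / 2) \<le> exp (3/4 * exp l)"
    by real_asymp
  have b: "\<forall>\<^sub>F l::real in at_top. 2 * real k * exp l \<le> exp (exp l)"
    by real_asymp
  show ?thesis
    using \<eta>(2,3) preimage_rate_dominates[OF \<eta>(1)[of 2]] target_rate_lower[of \<gamma> k] a b
      eventually_ge_at_top[of 7]
  proof eventually_elim
    case (elim l)
    let ?L = "exp l" and ?Q = "exp (exp l) * l powr \<gamma> / exp l ^ k"
    show ?case
    proof (intro allI impI)
      fix n :: nat assume n: "n \<ge> 3" "ln (real n) = exp (exp l)"
      have L: "?L \<ge> 8" using exp_ge_add_one_self[of l] elim(7) by linarith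
      have "?L ^ (k - 2) \<ge> 1" using L by (intro one_le_power) linarith
      then have "\<eta> l * exp ?L / ?L ^ (k - 2) \<le> \<eta> l * exp ?L / 1"
        using elim(1) by (intro divide_left_mono) auto
      then have 2: "2 * ?Q \<le> \<eta> l * exp ?L" using elim(3) by linarith
      have "real (card {m. m > 0 \<and> (totient ^^ k) m = n}) \<le>
         real n powr (1 - \<eta> l) * exp (2 * real k * ?L + 4 * exp (?L / 2))"
      proof (rule totient_preimage_card_le[where z = "exp (320 * k * exp l)"])
        show "(\<Sum>p\<in>R k. real p powr (\<eta> l - 1)) \<le> exp (?L / 2)"
          if "prime_chain k n (exp (320 * k * exp l)) t R E" for t R E
        proof -
          have "1 \<le> n" using n by simp
          then show ?thesis using elim(2) n(2) that by blast
        qed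
      qed (use n L elim(1,6) in auto)
      also have "\<dots> = real n * exp (2 * real k * ?L + 4 * exp (?L / 2) - \<eta> l * exp ?L)"
        by (rule powr_one_minus_mult_exp) (use n in auto)
      also have "\<dots> \<le> real n * exp (- ?Q)"
      proof -
        have "2 * real k * ?L + 4 * exp (?L / 2) - \<eta> l * exp ?L \<le> - ?Q"
          using 2 elim(4,5) by linarith
        then show ?thesis by (intro mult_left_mono) auto
      qed
      finally show "real (card {m. m > 0 \<and> (totient ^^ k) m = n}) \<le> real n * exp (- ?Q)" .
    qed
  qed
qed

text \<open>
  With $\kappa$ a constant multiple of $\eta L_1$ chosen such that the number of vectors of rough
  roots is at most $n^{\eta/2}$, every term saves at least twice the target $Q$ in the exponent.
  The constants $D$ and $C'$ collect the factors by which $\kappa$ and the exponent of the smooth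
  moments fall short of $\eta L_1$ and $1 / L_2^{k-2}$.
\<close>
lemma eventually_sum_of_divisors_preimage_le:
  fixes k :: nat and \<gamma> :: real
  assumes k: "k \<ge> 1" and \<gamma>: "\<gamma> < k"
  shows "\<forall>\<^sub>F l in at_top. \<forall>n. n \<ge> 3 \<longrightarrow> ln (real n) = exp (exp l) \<longrightarrow>
     real (card {m. m > 0 \<and> (sum_of_divisors ^^ k) m = n}) \<le> real n * exp (- (exp (exp l) * l powr \<gamma> / exp l ^ k))"
proof -
  obtain \<eta> :: "real \<Rightarrow> real" where
    \<eta>: "\<And>C. \<forall>\<^sub>F l in at_top. C * l powr \<gamma> \<le> \<eta> l * exp l ^ min 2 k"
      "\<forall>\<^sub>F l in at_top. 0 \<le> \<eta> l \<and> \<eta> l \<le> 1/2"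
      "\<forall>\<^sub>F l in at_top. \<forall>n t R E. n \<ge> 1 \<longrightarrow> ln (real n) = exp (exp l) \<longrightarrow>
         prime_chain k n (exp (320 * k * exp l)) t R E \<longrightarrow>
         (\<Sum>q\<in>R k. real q powr (\<eta> l - 1)) \<le> exp (exp l / 2)"
    using prime_chain_rate[OF k \<gamma>] by blast
  define D :: real where "D = 2 * k * (48 * 2 ^ k) ^ (k - 1)"
  define C' :: real where "C' = 320 * k * 81 * 81 ^ (k - 3)"
  have D: "D \<ge> 2"
  proof -
    have "(1::real) \<le> 48 * 2 ^ k" using one_le_power[of "2::real" k] by linarith
    then have "1 \<le> (48 * 2 ^ k :: real) ^ (k - 1)" by (rule one_le_power)
    moreover have "2 * 1 \<le> 2 * real k" using k by simp
    ultimately have "2 * 1 * 1 \<le> 2 * real k * (48 * 2 ^ k) ^ (k - 1)" by (intro mult_mono) auto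
    then show ?thesis by (simp add: D_def)
  qed
  have C': "C' \<ge> 1"
  proof -
    have "1 \<le> (81::real) ^ (k - 3)" by simp
    moreover have "1 \<le> real (320 * k * 81)" using k by simp
    ultimately have "1 * 1 \<le> real (320 * k * 81) * 81 ^ (k - 3)" by (intro mult_mono) auto
    then show ?thesis by (simp add: C'_def)
  qed
  have a: "\<forall>\<^sub>F l::real in at_top. 4 * exp (exp l / 2) \<le> exp (3/4 * exp l)"
      "\<forall>\<^sub>F l::real in at_top. 42 * exp l \<le> exp (3/4 * exp l)"
      "\<forall>\<^sub>F l::real in at_top. 16 * exp l * exp (exp l / 2) + 8 \<le> exp (3/4 * exp l)"
      "\<forall>\<^sub>F l::real in at_top. 2 * real k + 2 \<le> exp (3/4 * exp l)"
    by real_asymp+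
  have b: "\<forall>\<^sub>F l::real in at_top. 72 + 24 * ln (1 + 320 * real k * exp l) \<le> 20 * exp l"
    using k by real_asymp
  show ?thesis
    using \<eta>(2,3) preimage_rate_dominates[OF \<eta>(1)[of "12 * D * C'"]] target_rate_lower[of \<gamma> k] a b
      eventually_ge_at_top[of 7]
  proof eventually_elim
    case (elim l)
    define L where "L = exp l"
    define Q where "Q = exp (exp l) * l powr \<gamma> / exp l ^ k"
    define E where "E = \<eta> l * exp L"
    define \<kappa> where "\<kappa> = E / D"
    let ?s = "1 / (320 * k * L * (1 + 80 * L) ^ (k - 3) * 81)"
    have L: "L \<ge> 8" using exp_ge_add_one_self[of l] elim(10) unfolding L_def by linarith
    have Lp: "L ^ i \<ge> 1" for i using L by (simp add: one_le_power)
    have E0: "E \<ge> 0" using elim(1) by (simp add: E_def)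
    have Q: "exp (3/4 * L) \<le> Q" using elim(4) by (simp add: Q_def L_def)
    then have Q0: "Q \<ge> 0" using exp_ge_zero order_trans by blast
    have dom: "12 * D * C' * Q \<le> E / L ^ (k - 2)" using elim(3) by (simp add: Q_def E_def L_def)
    have "E / L ^ (k - 2) \<le> E / 1" using E0 Lp L by (intro divide_left_mono) auto
    then have domE: "12 * D * C' * Q \<le> E" using dom by simp
    have "12 * D * 1 * Q \<le> 12 * D * C' * Q" using C' D Q0 by (intro mult_right_mono mult_left_mono) auto
    then have domD: "12 * D * Q \<le> E" using domE by simp
    then have kap: "12 * Q \<le> \<kappa>" using D by (simp add: \<kappa>_def pos_le_divide_eq mult_ac)
    have "12 * 2 * Q \<le> 12 * D * Q" using D Q0 by (intro mult_right_mono mult_left_mono) auto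
    then have EQ: "24 * Q \<le> E" using domD by linarith
    show ?case
    proof (intro allI impI)
      fix n :: nat assume n: "n \<ge> 3" "ln (real n) = exp (exp l)"
      have nL: "ln (real n) = exp L" using n by (simp add: L_def)
      have half: "k * (\<kappa> * (48 * 2 ^ k) ^ (k - 1)) = E / 2"
        using k D unfolding \<kappa>_def D_def by (simp add: field_simps)
      have "real (card {m. m > 0 \<and> (sum_of_divisors ^^ k) m = n}) \<le>
        exp (k * (\<kappa> * (48 * 2 ^ k) ^ (k - 1))) * (real n powr (1 - \<eta> l) * exp (4 * exp (L / 2))) +
        k * (real n * exp (42 * L - \<kappa> / 4)) + real n * exp (2 * L - \<kappa>) +
        (if k \<ge> 3 then k * (real n * exp (16 * L * exp (L / 2) + 8 - \<kappa> * ?s / 2)) else 0)"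
      proof (rule sum_of_divisors_preimage_card_le[OF n(1) nL k L])
        show "72 + 24 * ln (1 + 320 * k * L) \<le> 20 * L" using elim(9) by (simp add: L_def)
        show "0 \<le> \<kappa>" using E0 D by (simp add: \<kappa>_def)
        show "0 \<le> \<eta> l" "\<eta> l \<le> 1/2" using elim(1) by auto
        show "(\<Sum>p\<in>R k. real p powr (\<eta> l - 1)) \<le> exp (L / 2)"
          if "prime_chain k n (exp (320 * k * L)) t R F" for t R F
        proof -
          have "1 \<le> n" using n by simp
          then show ?thesis using elim(2) n(2) that unfolding L_def by blast
        qed
      qed
      also have "\<dots> \<le> real n * exp (- 2 * Q) + k * (real n * exp (- 2 * Q)) + real n * exp (- 2 * Q) +
        k * (real n * exp (- 2 * Q))"
      proof (intro add_mono)
        have "exp (E / 2) * (real n powr (1 - \<eta> l) * exp (4 * exp (L / 2)))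
           = real n * exp (E / 2 + 4 * exp (L / 2) - E)"
        proof -
          have "exp (E / 2) * (real n powr (1 - \<eta> l) * exp (4 * exp (L / 2)))
             = real n powr (1 - \<eta> l) * exp (E / 2 + 4 * exp (L / 2))" by (simp add: exp_add)
          then show ?thesis using powr_one_minus_mult_exp[OF _ nL] n unfolding E_def by simp
        qed
        also have "\<dots> \<le> real n * exp (- 2 * Q)"
        proof -
          have "4 * exp (L / 2) \<le> Q" using elim(5) Q by (simp add: L_def)
          then have "E / 2 + 4 * exp (L / 2) - E \<le> - 2 * Q" using EQ Q0 by linarith
          then show ?thesis by (intro mult_left_mono) auto
        qed
        finally show "exp (k * (\<kappa> * (48 * 2 ^ k) ^ (k - 1))) * (real n powr (1 - \<eta> l) * exp (4 * exp (L / 2)))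
           \<le> real n * exp (- 2 * Q)" unfolding half .
        have q: "42 * L \<le> Q" using elim(6) Q by (simp add: L_def)
        then have "42 * L - \<kappa> / 4 \<le> - 2 * Q" "2 * L - \<kappa> \<le> - 2 * Q" using kap L Q0 by linarith+
        then show "k * (real n * exp (42 * L - \<kappa> / 4)) \<le> k * (real n * exp (- 2 * Q))"
          "real n * exp (2 * L - \<kappa>) \<le> real n * exp (- 2 * Q)"
          by (intro mult_left_mono; simp)+
        show "(if k \<ge> 3 then k * (real n * exp (16 * L * exp (L / 2) + 8 - \<kappa> * ?s / 2)) else 0)
           \<le> k * (real n * exp (- 2 * Q))"
        proof (cases "k \<ge> 3")
          case True
          have "(1 + 80 * L) ^ (k - 3) \<le> (81 * L) ^ (k - 3)" using L by (intro power_mono) auto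
          then have "320 * k * L * (1 + 80 * L) ^ (k - 3) * 81 \<le> 320 * k * L * (81 * L) ^ (k - 3) * 81"
            using L by (intro mult_right_mono mult_left_mono) auto
          also have "\<dots> = C' * (L * L ^ (k - 3))" by (simp add: C'_def power_mult_distrib)
          also have "L * L ^ (k - 3) = L ^ (k - 2)"
          proof -
            have "k - 2 = Suc (k - 3)" using True by simp
            then show ?thesis by simp
          qed
          finally have s: "320 * k * L * (1 + 80 * L) ^ (k - 3) * 81 \<le> C' * L ^ (k - 2)" .
          have spos: "0 < 320 * k * L * (1 + 80 * L) ^ (k - 3) * 81" using L k by auto
          \<comment> \<open>This is where the domination of the target by $\eta L_1 / L_2^{k-2}$ is used in full.\<close>
          have "12 * Q * (C' * L ^ (k - 2)) \<le> \<kappa>"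
          proof -
            have "12 * D * C' * Q * L ^ (k - 2) \<le> E" using dom Lp[of "k - 2"] by (simp add: pos_le_divide_eq)
            then show ?thesis using D by (simp add: \<kappa>_def pos_le_divide_eq mult_ac)
          qed
          then have "12 * Q \<le> \<kappa> / (C' * L ^ (k - 2))"
            using C' Lp[of "k - 2"] by (subst pos_le_divide_eq) auto
          also have "\<dots> \<le> \<kappa> / (320 * k * L * (1 + 80 * L) ^ (k - 3) * 81)"
          proof (rule divide_left_mono[OF s])
            show "0 \<le> \<kappa>" using E0 D by (simp add: \<kappa>_def)
            have "0 < C' * L ^ (k - 2)" using C' Lp[of "k - 2"] by (intro mult_pos_pos) linarith+
            then show "0 < C' * L ^ (k - 2) * (320 * k * L * (1 + 80 * L) ^ (k - 3) * 81)"
              using spos by (rule mult_pos_pos)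
          qed
          finally have "12 * Q \<le> \<kappa> * ?s" by simp
          moreover have "16 * L * exp (L / 2) + 8 \<le> Q" using elim(7) Q by (simp add: L_def)
          ultimately have "16 * L * exp (L / 2) + 8 - \<kappa> * ?s / 2 \<le> - 2 * Q" using Q0 by argo
          then show ?thesis using True by (auto intro!: mult_left_mono)
        qed simp
      qed
      also have "\<dots> = real n * ((2 * real k + 2) * exp (- 2 * Q))" by (simp add: algebra_simps)
      also have "\<dots> \<le> real n * exp (- Q)"
      proof (rule mult_left_mono)
        have "2 * real k + 2 \<le> Q" using elim(8) Q by (simp add: L_def)
        also have "Q \<le> exp Q" using exp_ge_add_one_self[of Q] by linarith
        finally have "(2 * real k + 2) * exp (- 2 * Q) \<le> exp Q * exp (- 2 * Q)" by (intro mult_right_mono) auto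
        also have "\<dots> = exp (- Q)" by (simp flip: exp_add)
        finally show "(2 * real k + 2) * exp (- 2 * Q) \<le> exp (- Q)" .
      qed simp
      finally show "real (card {m. m > 0 \<and> (sum_of_divisors ^^ k) m = n})
         \<le> real n * exp (- (exp (exp l) * l powr \<gamma> / exp l ^ k))" by (simp add: Q_def)
    qed
  qed
qed

theorem theorem1:
  fixes a :: "nat \<Rightarrow> nat" and k :: nat and \<beta> :: real
  assumes "a \<in> {totient, sum_of_divisors}"
    and "k \<ge> 1"
    and "\<beta> < real k - 1"
  shows "\<exists>\<delta> :: nat \<Rightarrow> real. \<delta> \<longlonglongrightarrow> 0 \<and>
    (\<forall>\<^sub>F n in sequentially.
       real (iter_preimage_count a k n) \<le> real n / L_fun k (\<beta> + 1) n powr (1 + \<delta> n))"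
proof (intro exI[of _ "\<lambda>_. 0"] conjI)
  \<comment> \<open>The error terms are so small that the bound holds with exponent exactly 1.\<close>
  have \<gamma>: "\<beta> + 1 < k" using assms(3) by simp
  have "\<forall>\<^sub>F l in at_top. \<forall>n. n \<ge> 3 \<longrightarrow> ln (real n) = exp (exp l) \<longrightarrow>
     real (iter_preimage_count a k n) \<le> real n * exp (- (exp (exp l) * l powr (\<beta> + 1) / exp l ^ k))"
    using assms(1) eventually_totient_preimage_le[OF assms(2) \<gamma>]
      eventually_sum_of_divisors_preimage_le[OF assms(2) \<gamma>]
    unfolding iter_preimage_count_def by blast
  moreover have "filterlim (\<lambda>n. ln (ln (ln (real n)))) at_top sequentially" by real_asymp
  ultimately have "\<forall>\<^sub>F n in sequentially. \<forall>n'. n' \<ge> 3 \<longrightarrow> ln (real n') = exp (exp (ln (ln (ln (real n))))) \<longrightarrow>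
     real (iter_preimage_count a k n') \<le> real n' *
       exp (- (exp (exp (ln (ln (ln (real n))))) * ln (ln (ln (real n))) powr (\<beta> + 1) / exp (ln (ln (ln (real n)))) ^ k))"
    by (rule eventually_compose_filterlim)
  moreover have "\<forall>\<^sub>F n in sequentially. ln (ln (real n)) > 0" "\<forall>\<^sub>F n in sequentially. ln (real n) > 0" by real_asymp+
  ultimately show "\<forall>\<^sub>F n in sequentially.
       real (iter_preimage_count a k n) \<le> real n / L_fun k (\<beta> + 1) n powr (1 + 0)"
    using eventually_ge_at_top[of 3]
  proof eventually_elim
    case (elim n)
    then have "real (iter_preimage_count a k n) \<le> real n *
       exp (- (ln (real n) * ln (ln (ln (real n))) powr (\<beta> + 1) / ln (ln (real n)) ^ k))" by simp
    then show ?case by (simp add: L_fun_def exp_minus divide_inverse)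
  qed
qed simp

end
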